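(* Let $k$ be a positive integer. For every string $S$ of length $n$ whose maximum character frequency is $m$, there exists a data structure occupying ${\rm O}\left(4^k n m\left(\frac{n}{m}\right)^{\frac{1}{2^{2^k}}}\right)$ bits, in addition to $S$ itself, such that for any query range $[l,r]$ with $0\le l\le r<n$ a mode of $S[l..r]$ can be reported in ${\rm O}(2^k)$ time.
   Context: $S=S[0..n-1]$ is a string over an alphabet $\Sigma$. There is a bijection $\Sigma\to\{0,\dots,|\Sigma|-1\}$ computable in constant time. A mode of a non-empty multiset is an element whose multiplicity is at least that of every other element. A mode of $S[l..r]$ is a mode of the multiset $\{S[l],\dots,S[r]\}$. $f(l,r)$ denotes the multiplicity of the modes of $S[l..r]$, and $m=f(0,n-1)$. The space of a data structure is counted in bits and excludes the input string $S$, which may be accessed during queries. *)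

theory Defs
  imports Complex_Main "HOL-Library.Multiset"
begin

section \<open>Range modes\<close>

definition is_mode :: "'a multiset \<Rightarrow> 'a \<Rightarrow> bool" where
  "is_mode M x \<longleftrightarrow> x \<in># M \<and> (\<forall>y. y \<in># M \<longrightarrow> count M y \<le> count M x)"

definition mode_mult :: "'a multiset \<Rightarrow> nat" where
  "mode_mult M = (THE q. \<exists>x. is_mode M x \<and> q = count M x)"

text \<open>The multiset \<open>{S[l], \<dots>, S[r]}\<close>; both ends are inclusive and indices start at 0.\<close>

definition range_mset :: "'a list \<Rightarrow> nat \<Rightarrow> nat \<Rightarrow> 'a multiset" where
  "range_mset S l r = image_mset (\<lambda>i. S ! i) (mset_set {l..r})"

definition range_freq :: "'a list \<Rightarrow> nat \<Rightarrow> nat \<Rightarrow> nat" where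
  "range_freq S l r = mode_mult (range_mset S l r)"

lemma is_mode_exists:
  assumes "M \<noteq> {#}"
  shows "\<exists>x. is_mode M x"
proof -
  have fin: "finite (count M ` set_mset M)" and ne: "count M ` set_mset M \<noteq> {}"
    using assms by auto
  obtain x where x: "x \<in># M" "count M x = Max (count M ` set_mset M)"
    using Max_in[OF fin ne] by auto
  have "count M y \<le> count M x" if "y \<in># M" for y
    using Max_ge[OF fin] that x(2) by auto
  with x(1) show ?thesis
    unfolding is_mode_def by blast
qed

lemma mode_mult_eq:
  assumes "is_mode M x"
  shows "mode_mult M = count M x"
  unfolding mode_mult_def
proof (rule the_equality)
  show "\<exists>y. is_mode M y \<and> count M x = count M y"
    using assms by blast
next
  fix q assume "\<exists>y. is_mode M y \<and> q = count M y"
  then show "q = count M x"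
    using assms unfolding is_mode_def by (meson le_antisym)
qed

section \<open>A word RAM with read-only string and read-only bit memory\<close>

text \<open>
  A machine with word size \<open>w\<close> stores numbers below \<open>2 ^ w\<close> in its working cells. Every
  instruction costs one time unit. Besides the working cells, which are initially zero apart
  from the inputs, it has read-only access to

  \<^item> the string, as a list of character codes, one code per access;
  \<^item> the data structure, as a list of bits, from which at most \<open>w\<close> consecutive bits are
    extracted per access. The offset need not be a multiple of \<open>w\<close>: an unaligned access amounts
    to two aligned word accesses and a constant number of shifts and masks.

  Numbers in instructions are addresses of working cells, except for the literal in \<open>Const\<close> and
  the jump targets.
\<close>

datatype binop = Add | Sub | Mul | Div | Mod | And | Or | Xor | Shl | Shr

datatype instr =
    Const nat nat
  | Op binop nat nat nat
  | Load nat nat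
  | Store nat nat
  | Read_String nat nat
  | Read_Bits nat nat nat
  | Jump nat
  | Jump_Less nat nat nat
  | Jump_Eq nat nat nat

type_synonym prog = "instr list"

text \<open>Program counter and working cells.\<close>

type_synonym state = "nat \<times> (nat \<Rightarrow> nat)"

fun eval_op :: "nat \<Rightarrow> binop \<Rightarrow> nat \<Rightarrow> nat \<Rightarrow> nat" where
  "eval_op w Add x y = (x + y) mod 2 ^ w"
| "eval_op w Sub x y = nat ((int x - int y) mod 2 ^ w)"
| "eval_op w Mul x y = (x * y) mod 2 ^ w"
| "eval_op w Div x y = x div y"
| "eval_op w Mod x y = x mod y"
| "eval_op w And x y = Bit_Operations.and x y"
| "eval_op w Or x y = Bit_Operations.or x y"
| "eval_op w Xor x y = Bit_Operations.xor x y"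
| "eval_op w Shl x y = (x * 2 ^ y) mod 2 ^ w"
| "eval_op w Shr x y = x div 2 ^ y"

text \<open>
  The number whose binary digits, least significant first, are the (at most \<open>len\<close>) bits of \<open>D\<close>
  from position \<open>off\<close> on; bits beyond the end of \<open>D\<close> count as 0.
\<close>

definition bits_at :: "bool list \<Rightarrow> nat \<Rightarrow> nat \<Rightarrow> nat" where
  "bits_at D off len = horner_sum of_bool 2 (take len (drop off D))"

fun exec :: "nat \<Rightarrow> nat list \<Rightarrow> bool list \<Rightarrow> instr \<Rightarrow> state \<Rightarrow> state" where
  "exec w S D (Const d a) (pc, M) = (Suc pc, M(d := a mod 2 ^ w))"
| "exec w S D (Op f d a b) (pc, M) = (Suc pc, M(d := eval_op w f (M a) (M b)))"
| "exec w S D (Load d a) (pc, M) = (Suc pc, M(d := M (M a)))"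
| "exec w S D (Store a s) (pc, M) = (Suc pc, M(M a := M s))"
| "exec w S D (Read_String d a) (pc, M) =
    (Suc pc, M(d := (if M a < length S then S ! M a else 0)))"
| "exec w S D (Read_Bits d a b) (pc, M) = (Suc pc, M(d := bits_at D (M a) (min (M b) w)))"
| "exec w S D (Jump t) (pc, M) = (t, M)"
| "exec w S D (Jump_Less a b t) (pc, M) = (if M a < M b then t else Suc pc, M)"
| "exec w S D (Jump_Eq a b t) (pc, M) = (if M a = M b then t else Suc pc, M)"

text \<open>The machine halts when the program counter leaves the program.\<close>

definition halted :: "prog \<Rightarrow> state \<Rightarrow> bool" where
  "halted P s \<longleftrightarrow> fst s \<ge> length P"

definition step :: "prog \<Rightarrow> nat \<Rightarrow> nat list \<Rightarrow> bool list \<Rightarrow> state \<Rightarrow> state" where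
  "step P w S D s = (if halted P s then s else exec w S D (P ! fst s) s)"

text \<open>The program is told the query, the length of the string and the word size.\<close>

definition init_state :: "nat \<Rightarrow> nat list \<Rightarrow> nat \<Rightarrow> nat \<Rightarrow> state" where
  "init_state w S l r = (0, (\<lambda>_. 0)(0 := l, 1 := r, 2 := length S, 3 := w))"

text \<open>
  On query \<open>(l, r)\<close>, the program halts after at most \<open>t\<close> steps with output \<open>a\<close>, which is left in
  cell 0.
\<close>

definition reports_within ::
    "prog \<Rightarrow> nat \<Rightarrow> nat list \<Rightarrow> bool list \<Rightarrow> nat \<Rightarrow> nat \<Rightarrow> real \<Rightarrow> nat \<Rightarrow> bool" where
  "reports_within P w S D l r t a \<longleftrightarrow>
     (\<exists>i. real i \<le> t \<and>
       (let s = (step P w S D ^^ i) (init_state w S l r) in halted P s \<and> snd s 0 = a))"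

end

theory Submission
  imports Defs
begin

text \<open>
  Let \<open>f(l, r)\<close> be the multiplicity of the modes of the half-open range \<open>S[l..<r]\<close>. For every \<open>q\<close>,
  mark the left ends and the right ends of the minimal ranges with \<open>f \<ge> q\<close>. Then \<open>f(l, r) \<ge> q\<close> iff
  there are fewer left ends before \<open>l\<close> than right ends up to \<open>r\<close>, and if \<open>q = f(l, r)\<close>, the character
  at the next left end from \<open>l\<close> on is a mode. With rank directories this takes \<open>O(n)\<close> bits for each
  \<open>q \<le> m\<close> and constant time, so it remains to find \<open>f(l, r)\<close> by \<open>O(2 ^ k)\<close> such tests.

  Let \<open>D\<close> be a power of two, at most \<open>2 ^ (2 ^ k + 1)\<close>, and let \<open>X = 2 ^ (h D) \<ge> n / m\<close>. As \<open>f\<close> changes by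
  at most 1 with each end, the value \<open>F(r) = f(u, r)\<close> at the last multiple \<open>u \<le> l\<close> of \<open>g = D\<^sup>2\<close> exceeds
  \<open>f(l, r)\<close> by less than \<open>g\<close>, and a binary search needs \<open>O(log D)\<close> tests. At multiples of \<open>X\<close>, \<open>F\<close> is
  given by a bit vector with the increments of \<open>F div X\<close> and by the residues. Between two
  multiples, the nodes of a \<open>2 ^ h\<close>-ary trie of depth \<open>D\<close> on whose parents \<open>F\<close> is not constant are
  stored in a perfect hash table, and a binary search over the levels finds the lowest such node
  above \<open>r\<close>, on which \<open>F\<close> is constant, in \<open>O(log D)\<close> steps. If \<open>F\<close> increases by \<open>s\<close>, there are at most \<open>1 + s D 2 ^ h\<close> keys of \<open>O(h D)\<close> bits.
  Over all cells this is \<open>O(n m h 2 ^ h) = O(n m 4 ^ h)\<close> bits, since only every \<open>D\<^sup>2\<close>-th left end is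
  sampled, and the least possible \<open>h\<close> satisfies \<open>4 ^ h \<le> 4 (n / m) powr (1 / 2 ^ 2 ^ k)\<close>.
\<close>

section \<open>Multiply-shift hashing and static dictionaries\<close>

text \<open>Several choices make all dictionaries together fit. \<open>X \<ge> n / m\<close> leaves
  at most \<open>m + 1\<close> cells per sampled left end, so a constant number of words per cell is
  affordable, and the increases of \<open>F\<close> telescope to at most \<open>m\<close>. The trie
  costs one factor \<open>D\<close> for its levels and one for the key length \<open>h D\<close>;
  sampling every \<open>D\<^sup>2\<close>-th left end cancels both. The factor \<open>h\<close>
  turns \<open>2 ^ h\<close> into \<open>4 ^ h\<close>, and the additional 1 in
  \<open>2 ^ (2 ^ k + 1)\<close> compensates for it: with this \<open>D\<close>, \<open>X\<close> is
  \<open>4 ^ h\<close> raised to the power \<open>2 ^ 2 ^ k\<close>.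

  \<open>k\<close> is arbitrary compared with \<open>n\<close>, but neither the program nor the
  constant in the word size may depend on it. Hence \<open>D\<close> stops growing as soon as
  \<open>h = 1\<close> suffices, which keeps \<open>D\<^sup>2\<close> and \<open>X\<close>
  polynomial in \<open>n\<close>.

  The search over levels needs membership tests in constant time. Multiply-shift hashing, which
  keeps the top \<open>W - s\<close> of the low \<open>W\<close> bits of \<open>a * x\<close>, takes
  a multiplication, a remainder and a shift. Good multipliers exist by averaging and are stored with
  the tables.\<close>

definition hash :: "nat \<Rightarrow> nat \<Rightarrow> nat \<Rightarrow> nat \<Rightarrow> nat" where
  "hash W s a x = (a * x mod 2 ^ W) div 2 ^ s"

lemma hash_less: "s \<le> W \<Longrightarrow> hash W s a x < 2 ^ (W - s)"
  unfolding hash_def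
  by (simp add: less_mult_imp_div_less flip: power_add)

lemma same_div_close:
  fixes p q t :: nat
  assumes "p div t = q div t" "t > 0"
  shows "q < p + t"
proof -
  have "q = t * (p div t) + q mod t" using assms(1) by (metis mult_div_mod_eq)
  also have "\<dots> < t * (p div t) + t" using assms(2) by simp
  also have "\<dots> \<le> p + t" by (simp add: times_div_less_eq_dividend)
  finally show ?thesis .
qed

text \<open>Equal hash values put both products into one block of length \<open>2 ^ s\<close>, so
  their difference \<open>a * d\<close> lies within \<open>2 ^ s\<close> of 0 on the cycle of
  residues modulo \<open>2 ^ W\<close>, on either side.\<close>

lemma hash_collision_window:
  assumes "hash W s a x = hash W s a (x + d)"
  shows "a * d mod 2 ^ W < 2 ^ s \<or> 2 ^ W < a * d mod 2 ^ W + 2 ^ s"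
proof -
  define p q c where "p = a * x mod 2 ^ W" and "q = a * (x + d) mod 2 ^ W"
    and "c = a * d mod 2 ^ W"
  have pq: "p div 2 ^ s = q div 2 ^ s"
    using assms by (simp add: hash_def p_def q_def)
  have lt: "p < 2 ^ W" "c < 2 ^ W" by (simp_all add: p_def c_def)
  have q: "q = (p + c) mod 2 ^ W"
    by (simp add: p_def c_def q_def mod_add_eq distrib_left)
  have close: "q < p + 2 ^ s" "p < q + 2 ^ s"
    using same_div_close[OF pq] same_div_close[OF pq[symmetric]] by simp_all
  show ?thesis
  proof (cases "p + c < 2 ^ W")
    case True
    then show ?thesis using q close unfolding c_def[symmetric] by simp
  next
    case False
    then have "q = p + c - 2 ^ W"
      using q lt by (simp add: le_mod_geq)
    then show ?thesis using close False unfolding c_def[symmetric] by linarith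
  qed
qed

text \<open>Oddness keeps \<open>a * d\<close> away from 0: if \<open>d\<close> is an odd multiple
  of \<open>2 ^ j\<close> with \<open>j < W\<close>, then so is
  \<open>a * d mod 2 ^ W\<close>.\<close>

definition multipliers :: "nat \<Rightarrow> nat set" where
  "multipliers W = {a. a < 2 ^ W \<and> odd a}"

lemma card_multipliers: "card (multipliers (Suc W)) = 2 ^ W"
proof -
  have "multipliers (Suc W) = (\<lambda>i. 2 * i + 1) ` {..<2 ^ W}"
    unfolding multipliers_def by (auto elim!: oddE)
  moreover have "inj_on (\<lambda>i::nat. 2 * i + 1) {..<2 ^ W}"
    by (auto intro: inj_onI)
  ultimately show ?thesis by (simp add: card_image)
qed

lemma finite_multipliers: "finite (multipliers W)"
  unfolding multipliers_def by (rule finite_subset[of _ "{..<2 ^ W}"]) auto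

lemma odd_mult_mod_inj:
  fixes a a' z :: nat
  assumes "odd z" "a * z mod 2 ^ k = a' * z mod 2 ^ k"
  shows "a mod 2 ^ k = a' mod 2 ^ k"
proof -
  have cop: "coprime (2 ^ k) z" using assms(1) by simp
  have *: "u mod 2 ^ k = v mod 2 ^ k" if "u * z mod 2 ^ k = v * z mod 2 ^ k" "v \<le> u" for u v :: nat
  proof -
    have "2 ^ k dvd u * z - v * z"
      using that by (subst mod_eq_dvd_iff_nat[symmetric]) auto
    then have "2 ^ k dvd (u - v) * z" by (simp add: diff_mult_distrib)
    then have "2 ^ k dvd u - v"
      using cop by (simp add: coprime_dvd_mult_left_iff)
    then show ?thesis using that(2) by (simp add: mod_eq_dvd_iff_nat)
  qed
  show ?thesis
    using *[of a a'] *[of a' a] assms(2) by (cases "a' \<le> a") auto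
qed

lemma odd_decomposition:
  assumes "d > (0::nat)"
  obtains j z where "d = 2 ^ j * z" "odd z"
  using assms
proof (induction d arbitrary: thesis rule: less_induct)
  case (less d)
  show ?case
  proof (cases "odd d")
    case True
    then show ?thesis using less.prems(1)[of 0 d] by simp
  next
    case False
    then obtain e where e: "d = 2 * e" by blast
    with less.prems(2) have "e < d" "e > 0" by auto
    from less.IH[OF this(1) _ this(2)] obtain j z where "e = 2 ^ j * z" "odd z" by blast
    then show ?thesis using less.prems(1)[of "Suc j" z] e by simp
  qed
qed

text \<open>Write \<open>y - x = 2 ^ j * z\<close> with \<open>z\<close> odd, so that
  \<open>a * d mod 2 ^ W = 2 ^ j * e a\<close> with \<open>e a\<close> odd. If
  \<open>j \<ge> s\<close>, this is too far from 0 for a collision. Otherwise \<open>e a\<close>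
  lies in a window of at most \<open>2 * 2 ^ (s - j)\<close> values, and \<open>e a\<close> together
  with the top \<open>j\<close> bits of \<open>a\<close> determines \<open>a\<close>, because
  \<open>z\<close> is invertible modulo \<open>2 ^ (W - j)\<close>.\<close>

lemma card_collisions:
  assumes "x < y" "y < 2 ^ W" "s \<le> W"
  shows "card {a \<in> multipliers W. hash W s a x = hash W s a y} \<le> 2 ^ Suc s"
proof -
  define d where "d = y - x"
  have d: "d > 0" "d < 2 ^ W" "y = x + d" using assms by (auto simp: d_def)
  obtain j z where jz: "d = 2 ^ j * z" "odd z"
    using odd_decomposition[OF d(1)] .
  have "z \<ge> 1" using jz(2) by (cases z) auto
  then have "(2::nat) ^ j < 2 ^ W" using d(2) jz(1)
    by (metis le_less_trans mult.right_neutral mult_le_mono2)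
  then have j: "j < W" by simp
  define k where "k = W - j"
  have k: "W = j + k" "k > 0" using j by (auto simp: k_def)
  define e where "e a = a * z mod 2 ^ k" for a
  have c: "a * d mod 2 ^ W = 2 ^ j * e a" for a
  proof -
    have "a * d = 2 ^ j * (a * z)" by (simp add: jz(1))
    then show ?thesis unfolding e_def k(1) power_add by (simp only: mult_mod_right)
  qed
  have "even ((2::nat) ^ k)" using k(2) by simp
  then have e: "e a < 2 ^ k" "odd a \<Longrightarrow> odd (e a)" for a
    using jz(2) by (simp_all add: e_def dvd_mod_iff)
  define Bad where "Bad = {a \<in> multipliers W. hash W s a x = hash W s a y}"
  have win: "2 ^ j * e a < 2 ^ s \<or> 2 ^ W < 2 ^ j * e a + 2 ^ s" if "a \<in> Bad" for a
    using hash_collision_window[of W s a x d] that by (simp add: Bad_def d(3) c)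
  show ?thesis
  proof (cases "j < s")
    case False
    have "a \<notin> Bad" for a
    proof
      assume a: "a \<in> Bad"
      then have "odd (e a)" using e(2) by (simp add: Bad_def multipliers_def)
      then have "e a \<ge> 1" by (cases "e a") auto
      have le: "(2::nat) ^ s \<le> 2 ^ j" using False by simp
      have "2 ^ j * 1 \<le> 2 ^ j * e a" using \<open>e a \<ge> 1\<close> by (intro mult_le_mono2)
      moreover have "2 ^ j * (e a + 1) \<le> 2 ^ j * 2 ^ k"
        using e(1)[of a] by (intro mult_le_mono2) simp
      ultimately show False using win[OF a] le unfolding k(1) power_add distrib_left mult_1_right by linarith
    qed
    then have "Bad = {}" by blast
    then show ?thesis by (simp add: Bad_def[symmetric])
  next
    case True
    define i where "i = s - j"
    have s: "s = j + i" using True by (simp add: i_def)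
    define Win where "Win = {..<(2::nat) ^ i} \<union> {2 ^ k - 2 ^ i..<2 ^ k}"
    have "i \<le> k" using assms(3) k(1) s by simp
    have "card Win \<le> 2 ^ i + 2 ^ i"
      unfolding Win_def by (rule order_trans[OF card_Un_le]) simp
    have inj: "inj_on (\<lambda>a. (e a, a div 2 ^ k)) Bad"
    proof (rule inj_onI)
      fix a a' assume "(e a, a div 2 ^ k) = (e a', a' div 2 ^ k)"
      then have "a mod 2 ^ k = a' mod 2 ^ k" "a div 2 ^ k = a' div 2 ^ k"
        using odd_mult_mod_inj[OF jz(2), of a k a'] by (simp_all add: e_def)
      then show "a = a'" by (metis mult_div_mod_eq)
    qed
    have sub: "(\<lambda>a. (e a, a div 2 ^ k)) ` Bad \<subseteq> Win \<times> {..<2 ^ j}"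
    proof (clarify)
      fix a assume a: "a \<in> Bad"
      have "a < 2 ^ j * 2 ^ k" using a by (auto simp: Bad_def multipliers_def k(1) power_add)
      then have "a div 2 ^ k < 2 ^ j" by (simp add: less_mult_imp_div_less)
      moreover have "e a \<in> Win"
        using win[OF a]
      proof
        assume "2 ^ j * e a < 2 ^ s"
        then have "e a < 2 ^ i" by (simp add: s power_add)
        then show ?thesis by (simp add: Win_def)
      next
        assume "2 ^ W < 2 ^ j * e a + 2 ^ s"
        then have "2 ^ j * 2 ^ k < 2 ^ j * (e a + 2 ^ i)"
          by (simp add: s k(1) power_add distrib_left)
        then have "2 ^ k < e a + 2 ^ i" by simp
        then have "2 ^ k - 2 ^ i \<le> e a" by linarith
          then show ?thesis using e(1)[of a] by (simp add: Win_def)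
      qed
      ultimately show "e a \<in> Win \<and> a div 2 ^ k \<in> {..<2 ^ j}" by simp
    qed
    have "card Bad \<le> card (Win \<times> {..<(2::nat) ^ j})"
      by (rule card_inj_on_le[OF inj sub]) (simp add: Win_def)
    also have "\<dots> \<le> (2 ^ i + 2 ^ i) * 2 ^ j"
      using \<open>card Win \<le> _\<close> by (simp add: card_cartesian_product)
    also have "\<dots> = 2 ^ Suc s" by (simp add: s power_add)
    finally show ?thesis by (simp add: Bad_def[symmetric])
  qed
qed

definition collisions :: "nat \<Rightarrow> nat \<Rightarrow> nat \<Rightarrow> nat set \<Rightarrow> (nat \<times> nat) set" where
  "collisions W s a K = {(x, y). x \<in> K \<and> y \<in> K \<and> x \<noteq> y \<and> hash W s a x = hash W s a y}"

text \<open>Averaging over the \<open>2 ^ (W - 1)\<close> odd multipliers: each of the at most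
  \<open>(card K)\<^sup>2\<close> ordered pairs of distinct keys collides for at most
  \<open>2 ^ Suc s\<close> of them, and the quotient of these powers is
  \<open>2 ^ s * 4 / 2 ^ W\<close>.\<close>

lemma few_collisions:
  assumes "K \<subseteq> {..<2 ^ W}" "W > 0" "s \<le> W"
  shows "\<exists>a. a < 2 ^ W \<and> 2 ^ W * card (collisions W s a K) \<le> 2 ^ s * 4 * (card K)\<^sup>2"
proof (rule ccontr)
  assume no: "\<not> ?thesis"
  have fin: "finite K" using assms(1) finite_subset by blast
  obtain V where V: "W = Suc V" using assms(2) by (cases W) auto
  define M where "M = multipliers W"
  have M: "finite M" "card M = 2 ^ V" "M \<noteq> {}"
  proof -
    show "finite M" "card M = 2 ^ V"
      by (simp_all add: M_def finite_multipliers card_multipliers V)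
    then show "M \<noteq> {}" by (metis card.empty power_not_zero zero_neq_numeral)
  qed
  define P where "P = {(x, y). x \<in> K \<and> y \<in> K \<and> x \<noteq> y}"
  have "P \<subseteq> K \<times> K" by (auto simp: P_def)
  then have P: "finite P" "card P \<le> (card K)\<^sup>2"
    using fin card_mono[of "K \<times> K" P]
    by (auto simp: card_cartesian_product power2_eq_square intro: finite_subset)
  have coll: "collisions W s a K = {p \<in> P. hash W s a (fst p) = hash W s a (snd p)}" for a
    by (auto simp: collisions_def P_def)
  have "(\<Sum>a\<in>M. card (collisions W s a K)) = (\<Sum>a\<in>M. \<Sum>p\<in>P. if hash W s a (fst p) = hash W s a (snd p) then 1 else 0)"
    unfolding coll using P(1) by (simp add: sum.If_cases Int_def)
  also have "\<dots> = (\<Sum>p\<in>P. \<Sum>a\<in>M. if hash W s a (fst p) = hash W s a (snd p) then 1 else 0)"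
    by (rule sum.swap)
  also have "\<dots> = (\<Sum>p\<in>P. card {a \<in> M. hash W s a (fst p) = hash W s a (snd p)})"
    using M(1) by (simp add: sum.If_cases Int_def)
  also have "\<dots> \<le> (\<Sum>p\<in>P. 2 ^ Suc s)"
  proof (rule sum_mono)
    fix p assume "p \<in> P"
    then obtain x y where p: "p = (x, y)" "x \<noteq> y" "x < 2 ^ W" "y < 2 ^ W"
      using assms(1) by (auto simp: P_def)
    show "card {a \<in> M. hash W s a (fst p) = hash W s a (snd p)} \<le> 2 ^ Suc s"
    proof (cases "x < y")
      case True
      then show ?thesis using card_collisions[of x y W s] p assms(3) by (simp add: M_def)
    next
      case False
      then have "y < x" using p(2) by simp
      moreover have "{a \<in> M. hash W s a (fst p) = hash W s a (snd p)} =
          {a \<in> multipliers W. hash W s a y = hash W s a x}"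
        by (auto simp: p M_def)
      ultimately show ?thesis using card_collisions[of y x W s] p assms(3) by simp
    qed
  qed
  also have "\<dots> \<le> 2 ^ Suc s * (card K)\<^sup>2" using P(2) by simp
  finally have up: "(\<Sum>a\<in>M. card (collisions W s a K)) \<le> 2 ^ Suc s * (card K)\<^sup>2" .
  have "2 ^ s * 4 * (card K)\<^sup>2 < 2 ^ W * card (collisions W s a K)" if "a \<in> M" for a
    using no that by (auto simp: M_def multipliers_def not_le)
  then have "(\<Sum>a\<in>M. 2 ^ s * 4 * (card K)\<^sup>2) < (\<Sum>a\<in>M. 2 ^ W * card (collisions W s a K))"
    using M by (intro sum_strict_mono) auto
  then have "2 ^ V * (2 ^ s * 4 * (card K)\<^sup>2) < 2 ^ W * (\<Sum>a\<in>M. card (collisions W s a K))"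
    using M by (simp add: sum_distrib_left)
  also have "\<dots> \<le> 2 ^ W * (2 ^ Suc s * (card K)\<^sup>2)" using up by simp
  finally show False by (simp add: V)
qed

text \<open>With more than \<open>4 * (card K)\<^sup>2\<close> slots the average number of
  collisions is below 1, hence 0 for some multiplier; the least such power of two is at most twice
  that number. If the universe itself is no larger, the identity is used. The bound
  \<open>2 ^ W + 1\<close> admits its multiplier 1 even for \<open>W = 0\<close>.\<close>

lemma perfect_hash:
  assumes "K \<subseteq> {..<2 ^ W}"
  shows "\<exists>a s. a < 2 ^ W + 1 \<and> s \<le> W \<and> inj_on (hash W s a) K \<and> 2 ^ (W - s) \<le> 8 * (card K)\<^sup>2 + (1::nat)"
proof (cases "4 * (card K)\<^sup>2 < 2 ^ W \<and> K \<noteq> {}")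
  case False
  then consider "K = {}" | "2 ^ W \<le> 4 * (card K)\<^sup>2" by fastforce
  then show ?thesis
  proof cases
    case 1
    then show ?thesis by (intro exI[of _ 0] exI[of _ W]) auto
  next
    case 2
    have "inj_on (hash W 0 1) K" using assms by (auto simp: inj_on_def hash_def subset_eq)
    then show ?thesis using 2 by (intro exI[of _ 1] exI[of _ 0]) auto
  qed
next
  case True
  have fin: "finite K" using assms finite_subset by blast
  define e where "e = (LEAST e. 4 * (card K)\<^sup>2 < 2 ^ e)"
  have e: "4 * (card K)\<^sup>2 < 2 ^ e" "e \<le> W"
    unfolding e_def using True LeastI[of "\<lambda>e. 4 * (card K)\<^sup>2 < 2 ^ e" W]
      Least_le[of "\<lambda>e. 4 * (card K)\<^sup>2 < 2 ^ e" W] by simp_all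
  have "card K \<noteq> 0" using True fin by simp
  then have "(card K)\<^sup>2 > 0" by simp
  then have "e \<noteq> 0" using e(1) by (intro notI) simp
  then obtain e' where e': "e = Suc e'" by (cases e) auto
  have "\<not> 4 * (card K)\<^sup>2 < 2 ^ e'" using not_less_Least[of e' "\<lambda>e. 4 * (card K)\<^sup>2 < 2 ^ e"] e' e_def by simp
  then have size: "2 ^ e \<le> 8 * (card K)\<^sup>2" by (simp add: e')
  have "W > 0" using e e' by simp
  then obtain a where a: "a < 2 ^ W" "2 ^ W * card (collisions W (W - e) a K) \<le> 2 ^ (W - e) * 4 * (card K)\<^sup>2"
    using few_collisions[OF assms, of "W - e"] by auto
  have "(2::nat) ^ W = 2 ^ (W - e) * 2 ^ e" using e(2) by (simp flip: power_add)
  then have "2 ^ (W - e) * (2 ^ e * card (collisions W (W - e) a K)) \<le> 2 ^ (W - e) * (4 * (card K)\<^sup>2)"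
    using a(2) by (simp only: mult.assoc)
  then have "2 ^ e * card (collisions W (W - e) a K) \<le> 4 * (card K)\<^sup>2" by simp
  also have "\<dots> < 2 ^ e * 1" using e(1) by simp
  finally have "card (collisions W (W - e) a K) = 0" by (simp only: mult_less_cancel1) simp
  moreover have "finite (collisions W (W - e) a K)"
    by (rule finite_subset[of _ "K \<times> K"]) (auto simp: collisions_def fin)
  ultimately have "collisions W (W - e) a K = {}" by simp
  then have "inj_on (hash W (W - e) a) K" by (auto simp: collisions_def inj_on_def)
  then show ?thesis using a(1) e(2) size by (intro exI[of _ a] exI[of _ "W - e"]) auto
qed

section \<open>Two-level dictionaries in a single array of words\<close>

lemma array_placement:
  fixes st len :: "nat \<Rightarrow> nat" and A :: "nat \<Rightarrow> nat \<Rightarrow> nat"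
  assumes "\<And>i. st i + len i \<le> st (Suc i)"
    and "\<And>i j. j < len i \<Longrightarrow> A i j < B" and "B > 0"
  shows "\<exists>L. (\<forall>i j. j < len i \<longrightarrow> L (st i + j) = A i j) \<and> (\<forall>p. L p < B)"
proof -
  \<comment> \<open>Only the first segment that ends beyond \<open>p\<close> can contain
    \<open>p\<close>; this choice also skips empty segments. Gaps between segments hold 0.\<close>
  define I where "I p = (LEAST i. p < st i + len i)" for p
  define L where "L p = (if st (I p) \<le> p \<and> p < st (I p) + len (I p) then A (I p) (p - st (I p)) else 0)" for p
  have mono: "st i + len i \<le> st i'" if "i < i'" for i i'
  proof -
    have "st (Suc i) \<le> st i'"
      using lift_Suc_mono_le[of st "Suc i" i'] assms(1) that by (meson Suc_leI add_leD1)
    then show ?thesis using assms(1)[of i] by linarith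
  qed
  have "I (st i + j) = i" if "j < len i" for i j
    unfolding I_def
  proof (rule Least_equality)
    show "st i + j < st i + len i" using that by simp
    fix y assume "st i + j < st y + len y"
    then show "i \<le> y" using mono[of y i] by (cases "y < i") auto
  qed
  then have "L (st i + j) = A i j" if "j < len i" for i j
    using that by (simp add: L_def)
  moreover have "L p < B" for p
    using assms(2,3) by (auto simp: L_def)
  ultimately show ?thesis by blast
qed

text \<open>
  Word layout of a two-level dictionary \<open>A\<close>: a top-level hash function (2 words), for each of its
  values a bottom-level hash function and the address of its table (3 words), and then the tables
  of key-value pairs. The slot of \<open>x\<close> holds \<open>x\<close> itself if and only if \<open>x\<close> is a key.
\<close>

definition dict_slot :: "nat \<Rightarrow> (nat \<Rightarrow> nat) \<Rightarrow> nat \<Rightarrow> nat" where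
  "dict_slot W A x = (let p = 2 + 3 * hash W (A 1) (A 0) x
     in A (p + 2) + 2 * hash W (A (p + 1)) (A p) x)"

text \<open>The scheme of Fredman, Komlos and Szemeredi. With about \<open>card K\<close> buckets
  the top level has linearly many collisions, so the squares of the bucket sizes have a linear sum,
  and each bucket can afford a collision-free table of quadratic size.\<close>

lemma dictionary:
  fixes K :: "nat set" and v :: "nat \<Rightarrow> nat"
  assumes K: "K \<subseteq> {..<2 ^ W}" "K \<noteq> {}" and W: "W > 0"
    and v: "\<And>x. x \<in> K \<Longrightarrow> v x < 2 ^ W"
  shows "\<exists>A. (\<forall>p. A p < 2 ^ (W + 8)) \<and>
    (\<forall>x < 2 ^ W. 2 + 3 * hash W (A 1) (A 0) x + 2 < 128 * card K \<and>
       dict_slot W A x + 1 < 128 * card K \<and>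
       (A (dict_slot W A x) = x \<longleftrightarrow> x \<in> K) \<and>
       (x \<in> K \<longrightarrow> A (dict_slot W A x + 1) = v x))"
proof -
  define S where "S = card K"
  have fin: "finite K" using K(1) finite_subset by blast
  then have S: "S > 0" using K(2) by (simp add: S_def card_gt_0_iff)
  have SW: "S \<le> 2 ^ W" unfolding S_def using card_mono[OF _ K(1)] by simp
  define d where "d = (LEAST d. S \<le> 2 ^ d)"
  have d: "S \<le> 2 ^ d" "d \<le> W"
    unfolding d_def using SW LeastI[of "\<lambda>d. S \<le> 2 ^ d" W] Least_le[of "\<lambda>d. S \<le> 2 ^ d" W] by simp_all
  have d2: "2 ^ d \<le> 2 * S"
  proof (cases d)
    case 0
    then show ?thesis using S by simp
  next
    case (Suc d')
    then have "\<not> S \<le> 2 ^ d'"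
      using not_less_Least[of d' "\<lambda>d. S \<le> 2 ^ d"] by (simp add: d_def)
    then show ?thesis by (simp add: Suc)
  qed
  define s0 where "s0 = W - d"
  have s0: "s0 \<le> W" "W - s0 = d" using d(2) by (simp_all add: s0_def)
  obtain a0 where a0: "a0 < 2 ^ W" "2 ^ W * card (collisions W s0 a0 K) \<le> 2 ^ s0 * 4 * S\<^sup>2"
    using few_collisions[OF K(1) W s0(1)] by (auto simp: S_def)
  have "(2::nat) ^ W = 2 ^ s0 * 2 ^ d" using d(2) by (simp add: s0_def flip: power_add)
  then have "2 ^ s0 * (2 ^ d * card (collisions W s0 a0 K)) \<le> 2 ^ s0 * (4 * S\<^sup>2)"
    using a0(2) by (simp only: mult.assoc)
  then have "2 ^ d * card (collisions W s0 a0 K) \<le> 4 * S\<^sup>2" by simp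
  moreover have "S * card (collisions W s0 a0 K) \<le> 2 ^ d * card (collisions W s0 a0 K)"
    using d(1) by (intro mult_le_mono1)
  moreover have "4 * S\<^sup>2 = S * (4 * S)" by (simp add: power2_eq_square)
  ultimately have "S * card (collisions W s0 a0 K) \<le> S * (4 * S)" by linarith
  then have coll: "card (collisions W s0 a0 K) \<le> 4 * S" using S by simp
  define h where "h = hash W s0 a0"
  have h: "h x < 2 ^ d" for x using hash_less[OF s0(1)] by (simp add: h_def s0(2))
  define Bk where "Bk i = {x \<in> K. h x = i}" for i
  have Bk: "finite (Bk i)" "Bk i \<subseteq> {..<2 ^ W}" for i
    using fin K(1) by (auto simp: Bk_def)
  \<comment> \<open>Counted by buckets, these pairs give the sum of the squares of the bucket sizes;
    counted directly, they are the collisions and the diagonal, at most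
    \<open>4 * S + S\<close>.\<close>
  define Pr where "Pr = {(x, y). x \<in> K \<and> y \<in> K \<and> h x = h y}"
  have "Pr = (\<Union>i<2 ^ d. Bk i \<times> Bk i)" using h by (auto simp: Pr_def Bk_def)
  also have "card \<dots> = (\<Sum>i<2 ^ d. card (Bk i \<times> Bk i))"
    using Bk(1) by (intro card_UN_disjoint) (auto simp: Bk_def)
  finally have cPr: "card Pr = (\<Sum>i<2 ^ d. (card (Bk i))\<^sup>2)"
    by (simp add: card_cartesian_product power2_eq_square)
  have "Pr = collisions W s0 a0 K \<union> (\<lambda>x. (x, x)) ` K" by (auto simp: Pr_def collisions_def h_def)
  then have "card Pr \<le> card (collisions W s0 a0 K) + card ((\<lambda>x. (x, x)) ` K)"
    by (simp add: card_Un_le)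
  also have "card ((\<lambda>x. (x, x)) ` K) \<le> S" using card_image_le[OF fin] by (simp add: S_def)
  finally have sq: "(\<Sum>i<2 ^ d. (card (Bk i))\<^sup>2) \<le> 5 * S" using coll cPr by linarith
  have "\<forall>i. \<exists>as. fst as < 2 ^ W + 1 \<and> snd as \<le> W \<and> inj_on (hash W (snd as) (fst as)) (Bk i) \<and>
      2 ^ (W - snd as) \<le> 8 * (card (Bk i))\<^sup>2 + (1::nat)"
    using perfect_hash[OF Bk(2)] by simp
  then obtain as where "\<forall>i. fst (as i) < 2 ^ W + 1 \<and> snd (as i) \<le> W \<and> inj_on (hash W (snd (as i)) (fst (as i))) (Bk i) \<and>
      2 ^ (W - snd (as i)) \<le> 8 * (card (Bk i))\<^sup>2 + (1::nat)"
    by (rule choice[THEN exE]) blast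
  then obtain a s where as: "\<And>i. a i < 2 ^ W + 1" "\<And>i. s i \<le> W"
    "\<And>i. inj_on (hash W (s i) (a i)) (Bk i)" "\<And>i. 2 ^ (W - s i) \<le> 8 * (card (Bk i))\<^sup>2 + (1::nat)"
    using that[of "\<lambda>i. fst (as i)" "\<lambda>i. snd (as i)"] by blast
  define sz where "sz i = (2::nat) ^ (W - s i)" for i
  have "(\<Sum>i<2 ^ d. sz i) \<le> (\<Sum>i<2 ^ d. 8 * (card (Bk i))\<^sup>2 + 1)"
    unfolding sz_def using as(4) by (intro sum_mono) auto
  also have "\<dots> = 8 * (\<Sum>i<2 ^ d. (card (Bk i))\<^sup>2) + 2 ^ d"
    unfolding sum.distrib sum_distrib_left by simp
  also have "\<dots> \<le> 42 * S" using sq d2 by linarith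
  finally have sz: "(\<Sum>i<2 ^ d. sz i) \<le> 42 * S" .
  define off where "off i = 2 + 3 * 2 ^ d + 2 * (\<Sum>i'<i. sz i')" for i
  \<comment> \<open>Keys stand at even and values at odd offsets. An empty slot holds
    \<open>2 ^ W\<close>, which exceeds every argument of a lookup, so the comparison with
    \<open>x\<close> fails there.\<close>
  define tab where "tab i j = (if \<exists>x\<in>Bk i. hash W (s i) (a i) x = j div 2
      then (let x = THE x. x \<in> Bk i \<and> hash W (s i) (a i) x = j div 2 in if even j then x else v x)
      else 2 ^ W)" for i j
  have the: "(THE y. y \<in> Bk i \<and> hash W (s i) (a i) y = hash W (s i) (a i) x) = x" if "x \<in> Bk i" for i x
    using that as(3)[of i] by (intro the_equality) (auto simp: inj_on_def)
  have tab_in: "tab i (2 * hash W (s i) (a i) x) = x \<and> tab i (2 * hash W (s i) (a i) x + 1) = v x"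
    if "x \<in> Bk i" for i x
    using that the[OF that] by (auto simp: tab_def)
  have tab_out: "tab i (2 * hash W (s i) (a i) x) \<noteq> x" if "x \<notin> Bk i" "x < 2 ^ W" for i x
  proof (cases "\<exists>y\<in>Bk i. hash W (s i) (a i) y = hash W (s i) (a i) x")
    case True
    then obtain y where y: "y \<in> Bk i" "hash W (s i) (a i) y = hash W (s i) (a i) x" by blast
    then show ?thesis using tab_in[OF y(1)] that by metis
  next
    case False
    then show ?thesis using that by (simp add: tab_def)
  qed
  have tab_less: "tab i j < 2 ^ W + 1" for i j
  proof (cases "\<exists>x\<in>Bk i. hash W (s i) (a i) x = j div 2")
    case True
    then obtain x where x: "x \<in> Bk i" "hash W (s i) (a i) x = j div 2" by blast
    have "x < 2 ^ W" "v x < 2 ^ W" using x(1) Bk(2) v by (auto simp: Bk_def)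
    moreover have "tab i j = (if even j then x else v x)"
      using the[OF x(1)] True unfolding tab_def x(2) by simp
    ultimately show ?thesis by simp
  qed (simp add: tab_def)
  have off_bound: "off i + 2 * sz i \<le> 92 * S" if "i < 2 ^ d" for i
  proof -
    have "(\<Sum>i'<Suc i. sz i') \<le> (\<Sum>i<2 ^ d. sz i)" using that by (intro sum_mono2) auto
    then have "off i + 2 * sz i \<le> 2 + 3 * 2 ^ d + 2 * (42 * S)" using sz by (simp add: off_def)
    then show ?thesis using d2 S by linarith
  qed
  \<comment> \<open>The tables start at \<open>2 + 3 * 2 ^ d\<close>, at most
    \<open>2 + 6 * S\<close>, and take at most \<open>84 * S\<close> words, which gives
    \<open>92 * S\<close>. As \<open>S \<le> 2 ^ W\<close>, 8 bits more than a key suffice for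
    addresses.\<close>
  have big: "92 * S < 2 ^ (W + 8)" "2 ^ W + 1 < (2::nat) ^ (W + 8)" "W < 2 ^ (W + 8)"
  proof -
    have *: "(2::nat) ^ (W + 8) = 256 * 2 ^ W" by (simp add: power_add)
    have "(2::nat) ^ W \<ge> 1" by simp
    then show "92 * S < 2 ^ (W + 8)" "2 ^ W + 1 < (2::nat) ^ (W + 8)"
      unfolding * using SW by linarith+
    show "W < 2 ^ (W + 8)" by (rule less_le_trans[OF less_exp]) (simp add: power_increasing)
  qed
  have "\<exists>T. (\<forall>i j. j < 2 * sz i \<longrightarrow> T (off i + j) = tab i j) \<and> (\<forall>p. T p < 2 ^ W + 1)"
    by (rule array_placement) (use tab_less in \<open>auto simp: off_def\<close>)
  then obtain T where T: "\<And>i j. j < 2 * sz i \<Longrightarrow> T (off i + j) = tab i j" "\<And>p. T p < 2 ^ W + 1"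
    by blast
  define entry where "entry i = [a i, s i, off i]" for i
  define A where "A p = (if p = 0 then a0 else if p = 1 then s0
      else if p < 2 + 3 * 2 ^ d then entry ((p - 2) div 3) ! ((p - 2) mod 3) else T p)" for p
  have A0: "A 0 = a0" "A 1 = s0" by (simp_all add: A_def)
  have A1: "A (2 + 3 * i) = a i" "A (2 + 3 * i + 1) = s i" "A (2 + 3 * i + 2) = off i" if "i < 2 ^ d" for i
  proof -
    have "(3 * i + 1) div 3 = i" "(3 * i + 1) mod 3 = 1" "(3 * i + 2) div 3 = i" "(3 * i + 2) mod 3 = 2"
      by presburger+
    then show "A (2 + 3 * i) = a i" "A (2 + 3 * i + 1) = s i" "A (2 + 3 * i + 2) = off i"
      using that by (simp_all add: A_def entry_def)
  qed
  have A2: "A (off i + j) = tab i j" if "j < 2 * sz i" for i j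
    using T(1)[OF that] by (simp add: A_def off_def)
  have A_less: "A p < 2 ^ (W + 8)" for p
  proof -
    consider "p = 0" | "p = 1" | "p \<noteq> 0" "p \<noteq> 1" "p < 2 + 3 * 2 ^ d" | "p \<noteq> 0" "p \<noteq> 1" "\<not> p < 2 + 3 * 2 ^ d"
      by blast
    then show ?thesis
    proof cases
      case 1
      then show ?thesis using a0(1) big(2) by (simp add: A_def)
    next
      case 2
      then show ?thesis using s0(1) big(3) by (simp add: A_def)
    next
      case 3
      define i where "i = (p - 2) div 3"
      have i: "i < 2 ^ d" using 3 by (auto simp: i_def)
      have "A p = entry i ! ((p - 2) mod 3)" using 3 by (simp add: A_def i_def)
      moreover have "(p - 2) mod 3 < 3" by simp
      ultimately have "A p \<in> {a i, s i, off i}"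
        using nth_mem[of "(p - 2) mod 3" "entry i"] by (simp add: entry_def)
      moreover have "a i < 2 ^ (W + 8)" using as(1)[of i] big(2) by linarith
      moreover have "s i < 2 ^ (W + 8)" using as(2)[of i] big(3) by linarith
      moreover have "off i < 2 ^ (W + 8)" using off_bound[OF i] big(1) by linarith
      ultimately show ?thesis by auto
    next
      case 4
      then show ?thesis using T(2)[of p] big(2) by (simp add: A_def)
    qed
  qed
  have main: "2 + 3 * hash W (A 1) (A 0) x + 2 < 128 * S \<and> dict_slot W A x + 1 < 128 * S \<and>
      (A (dict_slot W A x) = x \<longleftrightarrow> x \<in> K) \<and> (x \<in> K \<longrightarrow> A (dict_slot W A x + 1) = v x)"
    if x: "x < 2 ^ W" for x
  proof -
    define i where "i = h x"
    have i: "i < 2 ^ d" using h by (simp add: i_def)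
    have top: "hash W (A 1) (A 0) x = i" by (simp only: A0 i_def h_def)
    define j where "j = hash W (s i) (a i) x"
    have j: "j < sz i" using hash_less[OF as(2)] by (simp add: j_def sz_def)
    have slot: "dict_slot W A x = off i + 2 * j"
      unfolding dict_slot_def Let_def top A1[OF i] j_def ..
    have cells: "A (off i + 2 * j) = tab i (2 * j)" "A (off i + 2 * j + 1) = tab i (2 * j + 1)"
      using A2[of "2 * j" i] A2[of "2 * j + 1" i] j by (simp_all add: add.assoc)
    have "x \<in> Bk i \<longleftrightarrow> x \<in> K" by (simp add: Bk_def i_def)
    then show ?thesis
      using top slot cells tab_in[of x i] tab_out[of x i] x off_bound[OF i] j i d2 S
      unfolding j_def[symmetric] by (cases "x \<in> K") auto
  qed
  show ?thesis
    using A_less main unfolding S_def by blast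
qed

section \<open>Structured programs for the word RAM\<close>

datatype com =
    Block "instr list"
  | Seq com com  (infixr \<open>;;\<close> 60)
  | If_Less nat nat com com
  | If_Eq nat nat com com
  | While_Less nat nat com

primrec csize :: "com \<Rightarrow> nat" where
  "csize (Block is) = length is"
| "csize (c1 ;; c2) = csize c1 + csize c2"
| "csize (If_Less a b c1 c2) = csize c1 + csize c2 + 2"
| "csize (If_Eq a b c1 c2) = csize c1 + csize c2 + 2"
| "csize (While_Less a b c) = csize c + 3"

text \<open>Jump targets are absolute, so the code depends on its position. The branch for a failed
  test comes first and is entered by falling through.\<close>

primrec code :: "nat \<Rightarrow> com \<Rightarrow> prog" where
  "code pc (Block is) = is"
| "code pc (c1 ;; c2) = code pc c1 @ code (pc + csize c1) c2"
| "code pc (If_Less a b c1 c2) =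
    Jump_Less a b (pc + 2 + csize c2) # code (pc + 1) c2 @
    Jump (pc + 2 + csize c2 + csize c1) # code (pc + 2 + csize c2) c1"
| "code pc (If_Eq a b c1 c2) =
    Jump_Eq a b (pc + 2 + csize c2) # code (pc + 1) c2 @
    Jump (pc + 2 + csize c2 + csize c1) # code (pc + 2 + csize c2) c1"
| "code pc (While_Less a b c) =
    Jump_Less a b (pc + 2) # Jump (pc + 3 + csize c) # code (pc + 2) c @ [Jump pc]"

lemma length_code [simp]: "length (code pc c) = csize c"
  by (induction c arbitrary: pc) auto

section \<open>Total correctness with time bounds for code at any position\<close>

definition has_code :: "prog \<Rightarrow> nat \<Rightarrow> prog \<Rightarrow> bool" where
  "has_code P pc xs \<longleftrightarrow> (\<exists>ys zs. P = ys @ xs @ zs \<and> length ys = pc)"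

lemma has_code_append:
  "has_code P pc (xs @ ys) \<longleftrightarrow> has_code P pc xs \<and> has_code P (pc + length xs) ys" (is "?l \<longleftrightarrow> ?r")
proof
  assume ?l
  then obtain us vs where "P = us @ (xs @ ys) @ vs" "length us = pc" by (auto simp: has_code_def)
  then show ?r unfolding has_code_def
    by (intro conjI exI[of _ us] exI[of _ "ys @ vs"] exI[of _ "us @ xs"] exI[of _ vs]) auto
next
  assume ?r
  then obtain us vs us' vs' where *: "P = us @ xs @ vs" "length us = pc" "P = us' @ ys @ vs'" "length us' = pc + length xs"
    unfolding has_code_def by blast
  then have "(us @ xs) @ vs = us' @ (ys @ vs')" by simp
  then have "us @ xs = us'" using *(2,4) by (subst (asm) append_eq_append_conv) auto
  then show ?l using * unfolding has_code_def by (intro exI[of _ us] exI[of _ vs']) auto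
qed

lemma has_code_Cons:
  "has_code P pc (x # xs) \<longleftrightarrow> has_code P pc [x] \<and> has_code P (Suc pc) xs"
  using has_code_append[of P pc "[x]" xs] by simp

lemma has_code_single: "has_code P pc [x] \<Longrightarrow> pc < length P \<and> P ! pc = x"
  by (auto simp: has_code_def nth_append)

lemma step_single:
  "has_code P pc [x] \<Longrightarrow> step P w S D (pc, M) = exec w S D x (pc, M)"
  using has_code_single[of P pc x] by (simp add: step_def halted_def)

fun eff :: "nat \<Rightarrow> nat list \<Rightarrow> bool list \<Rightarrow> instr \<Rightarrow> (nat \<Rightarrow> nat) \<Rightarrow> (nat \<Rightarrow> nat)" where
  "eff w S D (Const d a) M = M(d := a mod 2 ^ w)"
| "eff w S D (Op f d a b) M = M(d := eval_op w f (M a) (M b))"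
| "eff w S D (Load d a) M = M(d := M (M a))"
| "eff w S D (Store a s) M = M(M a := M s)"
| "eff w S D (Read_String d a) M = M(d := (if M a < length S then S ! M a else 0))"
| "eff w S D (Read_Bits d a b) M = M(d := bits_at D (M a) (min (M b) w))"
| "eff w S D (Jump t) M = M"
| "eff w S D (Jump_Less a b t) M = M"
| "eff w S D (Jump_Eq a b t) M = M"

fun is_jump :: "instr \<Rightarrow> bool" where
  "is_jump (Jump t) = True"
| "is_jump (Jump_Less a b t) = True"
| "is_jump (Jump_Eq a b t) = True"
| "is_jump _ = False"

lemma exec_eff: "\<not> is_jump x \<Longrightarrow> exec w S D x (pc, M) = (Suc pc, eff w S D x M)"
  by (cases x) auto

text \<open>Quantifying over every program that contains the code at its own position makes these
  timed triples compose.\<close>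

definition does :: "nat \<Rightarrow> nat list \<Rightarrow> bool list \<Rightarrow> com \<Rightarrow> (nat \<Rightarrow> nat) \<Rightarrow> nat \<Rightarrow> ((nat \<Rightarrow> nat) \<Rightarrow> bool) \<Rightarrow> bool" where
  "does w S D c M t Q \<longleftrightarrow> (\<forall>P pc. has_code P pc (code pc c) \<longrightarrow>
     (\<exists>i \<le> t. \<exists>M'. (step P w S D ^^ i) (pc, M) = (pc + csize c, M') \<and> Q M'))"

lemma doesE:
  assumes "does w S D c M t Q" "has_code P pc (code pc c)"
  obtains i M' where "i \<le> t" "(step P w S D ^^ i) (pc, M) = (pc + csize c, M')" "Q M'"
  using assms unfolding does_def by blast

lemma does_mono:
  "does w S D c M t Q \<Longrightarrow> t \<le> t' \<Longrightarrow> (\<And>M'. Q M' \<Longrightarrow> Q' M') \<Longrightarrow> does w S D c M t' Q'"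
  unfolding does_def by (meson order_trans)

lemma block_steps:
  assumes "has_code P pc xs" "\<forall>x\<in>set xs. \<not> is_jump x"
  shows "(step P w S D ^^ length xs) (pc, M) = (pc + length xs, fold (eff w S D) xs M)"
  using assms
proof (induction xs arbitrary: pc M)
  case (Cons x xs)
  have "has_code P pc [x]" "has_code P (Suc pc) xs" using Cons.prems(1) by (simp_all add: has_code_Cons[of P pc x xs])
  then show ?case using Cons.IH[of "Suc pc" "eff w S D x M"] Cons.prems(2)
    by (simp add: funpow_swap1 step_single exec_eff del: funpow.simps(2) add: funpow_Suc_right)
qed simp

lemma does_Block:
  assumes "\<forall>x\<in>set xs. \<not> is_jump x" "Q (fold (eff w S D) xs M)" "length xs \<le> t"
  shows "does w S D (Block xs) M t Q"
  unfolding does_def using block_steps[OF _ assms(1)] assms(2,3) by (auto intro!: exI[of _ "length xs"])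

lemma does_Seq:
  assumes "does w S D c1 M t1 R" "\<And>M'. R M' \<Longrightarrow> does w S D c2 M' t2 Q"
  shows "does w S D (c1 ;; c2) M (t1 + t2) Q"
  unfolding does_def
proof (intro allI impI)
  fix P pc assume "has_code P pc (code pc (c1 ;; c2))"
  then have c: "has_code P pc (code pc c1)" "has_code P (pc + csize c1) (code (pc + csize c1) c2)"
    by (simp_all add: has_code_append)
  obtain i M1 where 1: "i \<le> t1" "(step P w S D ^^ i) (pc, M) = (pc + csize c1, M1)" "R M1"
    using assms(1) c(1) unfolding does_def by blast
  obtain j M2 where 2: "j \<le> t2" "(step P w S D ^^ j) (pc + csize c1, M1) = (pc + csize c1 + csize c2, M2)" "Q M2"
    using assms(2)[OF 1(3)] c(2) unfolding does_def by blast
  have "(step P w S D ^^ (j + i)) (pc, M) = (pc + csize (c1 ;; c2), M2)"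
    using 1 2 by (simp add: funpow_add add.assoc)
  then show "\<exists>i\<le>t1 + t2. \<exists>M'. (step P w S D ^^ i) (pc, M) = (pc + csize (c1 ;; c2), M') \<and> Q M'"
    using 1(1) 2(1,3) by (intro exI[of _ "j + i"]) auto
qed

text \<open>The 2 extra steps are the conditional jump and, after the branch that falls through, the
  jump over the other branch.\<close>

lemma does_branch:
  assumes code: "\<And>pc. code pc c = I (pc + 2 + csize c2) # code (pc + 1) c2 @
      Jump (pc + 2 + csize c2 + csize c1) # code (pc + 2 + csize c2) c1"
    and size: "csize c = csize c1 + csize c2 + 2"
    and I: "\<And>pc t. exec w S D (I t) (pc, M) = (if b then t else Suc pc, M)"
    and c1: "b \<Longrightarrow> does w S D c1 M t Q" and c2: "\<not> b \<Longrightarrow> does w S D c2 M t Q"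
  shows "does w S D c M (t + 2) Q"
  unfolding does_def
proof (intro allI impI)
  fix P pc assume "has_code P pc (code pc c)"
  then have h: "has_code P pc [I (pc + 2 + csize c2)]" "has_code P (pc + 1) (code (pc + 1) c2)"
    "has_code P (pc + 1 + csize c2) [Jump (pc + 2 + csize c2 + csize c1)]"
    "has_code P (pc + 2 + csize c2) (code (pc + 2 + csize c2) c1)"
    unfolding code has_code_Cons[of _ _ _ "_ @ _"] has_code_append has_code_Cons[of _ _ _ "code _ _"]
    by simp_all
  show "\<exists>i\<le>t + 2. \<exists>M'. (step P w S D ^^ i) (pc, M) = (pc + csize c, M') \<and> Q M'"
  proof (cases b)
    case True
    obtain i M' where i: "i \<le> t" "(step P w S D ^^ i) (pc + 2 + csize c2, M) = (pc + 2 + csize c2 + csize c1, M')" "Q M'"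
      using c1[OF True] h(4) unfolding does_def by blast
    have "(step P w S D ^^ Suc i) (pc, M) = (pc + csize c, M')"
      using i(2) by (simp add: funpow_Suc_right step_single[OF h(1)] I True size add_ac del: funpow.simps(2))
    then show ?thesis using i(1,3) by (intro exI[of _ "Suc i"]) auto
  next
    case False
    obtain i M' where i: "i \<le> t" "(step P w S D ^^ i) (pc + 1, M) = (pc + 1 + csize c2, M')" "Q M'"
      using c2[OF False] h(2) unfolding does_def by blast
    have "(step P w S D ^^ Suc i) (pc, M) = (pc + 1 + csize c2, M')"
      using i(2) by (simp add: funpow_Suc_right step_single[OF h(1)] I False del: funpow.simps(2))
    then have "(step P w S D ^^ Suc (Suc i)) (pc, M) = (pc + csize c, M')"
      using step_single[OF h(3), of w S D M'] by (simp add: size add_ac)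
    then show ?thesis using i(1,3) by (intro exI[of _ "Suc (Suc i)"]) auto
  qed
qed

lemma does_If_Less:
  assumes "M a < M b \<Longrightarrow> does w S D c1 M t Q" "\<not> M a < M b \<Longrightarrow> does w S D c2 M t Q"
  shows "does w S D (If_Less a b c1 c2) M (t + 2) Q"
  by (rule does_branch[where I = "Jump_Less a b" and b = "M a < M b", OF _ _ _ assms]) simp_all

lemma does_If_Eq:
  assumes "M a = M b \<Longrightarrow> does w S D c1 M t Q" "M a \<noteq> M b \<Longrightarrow> does w S D c2 M t Q"
  shows "does w S D (If_Eq a b c1 c2) M (t + 2) Q"
  by (rule does_branch[where I = "Jump_Eq a b" and b = "M a = M b", OF _ _ _ assms]) simp_all

text \<open>The argument \<open>k\<close> of the invariant bounds the remaining iterations. Besides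
  its body, an iteration takes the test and the jump back; leaving takes the failed test and the
  jump out.\<close>

lemma does_While_Less:
  assumes "Inv k M"
    and body: "\<And>k M. Inv k M \<Longrightarrow> M a < M b \<Longrightarrow> k > 0 \<and> does w S D c M t (Inv (k - 1))"
    and exit: "\<And>k M. Inv k M \<Longrightarrow> \<not> M a < M b \<Longrightarrow> Q M"
  shows "does w S D (While_Less a b c) M (k * (t + 2) + 2) Q"
  unfolding does_def
proof (intro allI impI)
  fix P pc assume "has_code P pc (code pc (While_Less a b c))"
  then have h: "has_code P pc [Jump_Less a b (pc + 2)]" "has_code P (pc + 1) [Jump (pc + 3 + csize c)]"
    "has_code P (pc + 2) (code (pc + 2) c)" "has_code P (pc + 2 + csize c) [Jump pc]"
    unfolding code.simps has_code_Cons[of _ _ _ "_ @ _"] has_code_append has_code_Cons[of _ _ _ "_ # _"]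
    by simp_all
  show "\<exists>i\<le>k * (t + 2) + 2. \<exists>M'. (step P w S D ^^ i) (pc, M) = (pc + csize (While_Less a b c), M') \<and> Q M'"
    using assms(1)
  proof (induction k arbitrary: M)
    case 0
    then have "\<not> M a < M b" using body by blast
    then have "(step P w S D ^^ 2) (pc, M) = (pc + csize (While_Less a b c), M)"
      using step_single[OF h(1)] step_single[OF h(2)] by (simp add: numeral_2_eq_2)
    then show ?case using exit[OF 0 \<open>\<not> _\<close>] by (intro exI[of _ 2]) auto
  next
    case (Suc k)
    show ?case
    proof (cases "M a < M b")
      case False
      then have "(step P w S D ^^ 2) (pc, M) = (pc + csize (While_Less a b c), M)"
        using step_single[OF h(1)] step_single[OF h(2)] by (simp add: numeral_2_eq_2)
      then show ?thesis using exit[OF Suc.prems False] by (intro exI[of _ 2]) auto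
    next
      case True
      then obtain i M1 where i: "i \<le> t" "(step P w S D ^^ i) (pc + 2, M) = (pc + 2 + csize c, M1)" "Inv k M1"
        using doesE[OF conjunct2[OF body[OF Suc.prems True]] h(3)] by auto
      obtain j M2 where j: "j \<le> k * (t + 2) + 2"
        "(step P w S D ^^ j) (pc, M1) = (pc + csize (While_Less a b c), M2)" "Q M2"
        using Suc.IH[OF i(3)] by blast
      have "(step P w S D ^^ Suc i) (pc, M) = (pc + 2 + csize c, M1)"
        using i(2) True by (simp add: funpow_Suc_right step_single[OF h(1)] del: funpow.simps(2))
      then have "(step P w S D ^^ Suc (Suc i)) (pc, M) = (pc, M1)"
        using step_single[OF h(4), of w S D M1] by simp
      then have "(step P w S D ^^ (j + Suc (Suc i))) (pc, M) = (pc + csize (While_Less a b c), M2)"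
        using j(2) unfolding funpow_add comp_apply by (simp del: funpow.simps(2))
      then show ?thesis using i(1) j(1,3) by (intro exI[of _ "j + Suc (Suc i)"]) auto
    qed
  qed
qed

lemma reports_within_does:
  assumes "does w S D c (snd (init_state w S l r)) t (\<lambda>M. M 0 = x)" "real t \<le> T"
  shows "reports_within (code 0 c) w S D l r T x"
proof -
  have "has_code (code 0 c) 0 (code 0 c)" by (auto simp: has_code_def)
  then obtain i M where "i \<le> t" "(step (code 0 c) w S D ^^ i) (init_state w S l r) = (csize c, M)" "M 0 = x"
    using doesE[OF assms(1), of "code 0 c" 0] by (auto simp: init_state_def)
  then show ?thesis
    using assms(2) unfolding reports_within_def Let_def by (intro exI[of _ i]) (auto simp: halted_def)
qed

section \<open>Frequencies of modes\<close>

text \<open>Half-open, so that empty ranges exist; indices beyond the string are ignored, so all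
  \<open>l\<close> and \<open>r\<close> are admissible.\<close>

definition occs :: "'a list \<Rightarrow> nat \<Rightarrow> nat \<Rightarrow> 'a \<Rightarrow> nat" where
  "occs S l r c = card {i \<in> {l..<r}. i < length S \<and> S ! i = c}"

definition freq :: "'a list \<Rightarrow> nat \<Rightarrow> nat \<Rightarrow> nat" where
  "freq S l r = Max (insert 0 (occs S l r ` set S))"

lemma occs_le_freq: "c \<in> set S \<Longrightarrow> occs S l r c \<le> freq S l r"
  unfolding freq_def by (intro Max_ge) auto

lemma freq_le: "(\<And>c. c \<in> set S \<Longrightarrow> occs S l r c \<le> k) \<Longrightarrow> freq S l r \<le> k"
  unfolding freq_def by (subst Max_le_iff) auto

lemma freq_attained:
  assumes "freq S l r > 0"
  obtains c where "c \<in> set S" "occs S l r c = freq S l r"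
proof -
  have "freq S l r \<in> insert 0 (occs S l r ` set S)"
    unfolding freq_def by (rule Max_in) auto
  then show ?thesis using that assms by auto
qed

lemma occs_mono: "l' \<le> l \<Longrightarrow> r \<le> r' \<Longrightarrow> occs S l r c \<le> occs S l' r' c"
  unfolding occs_def by (intro card_mono) auto

lemma freq_mono:
  assumes "l' \<le> l" "r \<le> r'"
  shows "freq S l r \<le> freq S l' r'"
  by (rule freq_le) (meson assms occs_mono occs_le_freq order_trans)

lemma occs_Suc_left: "occs S l r c \<le> occs S (Suc l) r c + (if l < length S \<and> S ! l = c then 1 else 0)"
proof -
  have "{i \<in> {l..<r}. i < length S \<and> S ! i = c} \<subseteq>
      {i \<in> {Suc l..<r}. i < length S \<and> S ! i = c} \<union> (if l < length S \<and> S ! l = c then {l} else {})"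
    by (auto simp: le_less Suc_le_eq)
  then have "occs S l r c \<le> card \<dots>" unfolding occs_def by (intro card_mono) auto
  also have "\<dots> \<le> occs S (Suc l) r c + card (if l < length S \<and> S ! l = c then {l} else {})"
    unfolding occs_def by (rule card_Un_le)
  finally show ?thesis by (auto split: if_splits)
qed

lemma occs_Suc_right: "occs S l (Suc r) c \<le> Suc (occs S l r c)"
proof -
  have "{i \<in> {l..<Suc r}. i < length S \<and> S ! i = c} \<subseteq>
      insert r {i \<in> {l..<r}. i < length S \<and> S ! i = c}"
    by (auto simp: less_Suc_eq)
  then have "occs S l (Suc r) c \<le> card \<dots>" unfolding occs_def by (intro card_mono) auto
  also have "\<dots> \<le> Suc (occs S l r c)"
    unfolding occs_def by (simp add: card_insert_if)
  finally show ?thesis .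
qed

lemma freq_Suc_left: "freq S l r \<le> Suc (freq S (Suc l) r)"
proof (rule freq_le)
  fix c assume "c \<in> set S"
  then show "occs S l r c \<le> Suc (freq S (Suc l) r)"
    using occs_Suc_left[of S l r c] occs_le_freq[of c S "Suc l" r] by (auto split: if_splits)
qed

lemma freq_Suc_right: "freq S l (Suc r) \<le> Suc (freq S l r)"
proof (rule freq_le)
  fix c assume "c \<in> set S"
  then show "occs S l (Suc r) c \<le> Suc (freq S l r)"
    using occs_Suc_right[of S l r c] occs_le_freq[of c S l r] by auto
qed

lemma freq_add_left: "freq S l r \<le> freq S (l + k) r + k"
proof (induction k)
  case (Suc k)
  then show ?case using freq_Suc_left[of S "l + k" r] by simp
qed simp

lemma freq_add_right: "freq S l (r + k) \<le> freq S l r + k"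
proof (induction k)
  case (Suc k)
  then show ?case using freq_Suc_right[of S l "r + k"] by simp
qed simp

lemma freq_empty [simp]: "freq S l 0 = 0"
  using freq_le[of S l 0 0] by (simp add: occs_def)

lemma freq_le_length: "freq S l r \<le> freq S 0 (length S)"
proof (rule freq_le)
  fix c assume c: "c \<in> set S"
  have "occs S l r c \<le> occs S 0 (length S) c" unfolding occs_def by (intro card_mono) auto
  then show "occs S l r c \<le> freq S 0 (length S)" using occs_le_freq[OF c] order_trans by blast
qed

lemma freq_total_le: "freq S 0 (length S) \<le> length S"
proof (rule freq_le)
  fix c
  show "occs S 0 (length S) c \<le> length S"
    unfolding occs_def using card_mono[of "{..<length S}" "{i \<in> {0..<length S}. i < length S \<and> S ! i = c}"]
    by auto
qed

lemma freq_pos: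
  assumes "l < r" "l < length S"
  shows "freq S l r > 0"
proof -
  have "l \<in> {i \<in> {l..<r}. i < length S \<and> S ! i = S ! l}" using assms by simp
  then have "occs S l r (S ! l) > 0" unfolding occs_def by (subst card_gt_0_iff) auto
  then show ?thesis using occs_le_freq[of "S ! l" S l r] assms(2) by simp
qed

lemma count_range_mset:
  assumes "r < length S"
  shows "count (range_mset S l r) c = occs S l (Suc r) c"
proof -
  have "count (range_mset S l r) c = card {i \<in> {l..r}. c = S ! i}"
    unfolding range_mset_def count_image_mset
    by (simp add: Int_def conj_commute eq_commute)
  also have "{i \<in> {l..r}. c = S ! i} = {i \<in> {l..<Suc r}. i < length S \<and> S ! i = c}"
    using assms by auto
  finally show ?thesis by (simp add: occs_def)
qed

lemma is_mode_range_mset: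
  assumes "l \<le> r" "r < length S" "c \<in> set S" "freq S l (Suc r) \<le> occs S l (Suc r) c"
  shows "is_mode (range_mset S l r) c"
proof -
  have "freq S l (Suc r) > 0" using assms(1,2) by (intro freq_pos) auto
  then have "c \<in># range_mset S l r"
    using assms by (simp add: count_range_mset flip: count_greater_zero_iff)
  moreover have "count (range_mset S l r) y \<le> count (range_mset S l r) c" if "y \<in># range_mset S l r" for y
  proof -
    have "y \<in> set S" using that assms(1,2) by (auto simp: range_mset_def)
    then show ?thesis
      using occs_le_freq[of y S l "Suc r"] assms by (simp add: count_range_mset)
  qed
  ultimately show ?thesis by (simp add: is_mode_def)
qed

lemma range_freq_eq:
  assumes "S \<noteq> []"
  shows "range_freq S 0 (length S - 1) = freq S 0 (length S)"
proof -
  define n where "n = length S"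
  have n: "n > 0" "Suc (n - 1) = n" "n - 1 < length S" using assms by (auto simp: n_def)
  have "freq S 0 n > 0" using n by (intro freq_pos) auto
  then obtain c where c: "c \<in> set S" "occs S 0 n c = freq S 0 n" by (rule freq_attained)
  then have "is_mode (range_mset S 0 (n - 1)) c"
    using n by (intro is_mode_range_mset) auto
  moreover have "count (range_mset S 0 (n - 1)) c = freq S 0 n"
    using count_range_mset[OF n(3), of 0 c] n(2) c(2) by simp
  ultimately show ?thesis
    by (simp add: range_freq_def mode_mult_eq n_def)
qed

text \<open>
  Ranges are half-open from here on. If no right end reaches multiplicity \<open>q\<close>, the value is
  \<open>length S + 1\<close>.
\<close>

definition reach :: "'a list \<Rightarrow> nat \<Rightarrow> nat \<Rightarrow> nat" where
  "reach S q l = (LEAST r. length S < r \<or> q \<le> freq S l r)"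

section \<open>Minimal ranges of given multiplicity as jumps of a monotone function\<close>

lemma reach_le_iff:
  assumes "r \<le> length S"
  shows "reach S q l \<le> r \<longleftrightarrow> q \<le> freq S l r"
proof
  assume le: "reach S q l \<le> r"
  have "length S < reach S q l \<or> q \<le> freq S l (reach S q l)"
    unfolding reach_def by (rule LeastI[of _ "Suc (length S)"]) simp
  then show "q \<le> freq S l r" using le assms freq_mono[OF order_refl le, of S l] by linarith
next
  assume "q \<le> freq S l r"
  then show "reach S q l \<le> r" unfolding reach_def by (intro Least_le) simp
qed

lemma reach_mono: "l \<le> l' \<Longrightarrow> reach S q l \<le> reach S q l'"
proof -
  assume l: "l \<le> l'"
  have "length S < reach S q l' \<or> q \<le> freq S l' (reach S q l')"
    unfolding reach_def by (rule LeastI[of _ "Suc (length S)"]) simp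
  then show ?thesis
    unfolding reach_def[of S q l] using freq_mono[OF l order_refl, of S] by (intro Least_le) (metis order_trans)
qed

lemma reach_pos: "q > 0 \<Longrightarrow> reach S q l > 0"
  using reach_le_iff[of 0 S q l] by (auto simp: neq0_conv[symmetric] simp del: neq0_conv)

text \<open>A range from \<open>l\<close> to \<open>reach S q l\<close> cannot be shortened on the
  right; it cannot be shortened on the left exactly if the next start has a larger
  \<open>reach\<close>.\<close>

definition left_end :: "'a list \<Rightarrow> nat \<Rightarrow> nat \<Rightarrow> bool" where
  "left_end S q l \<longleftrightarrow> reach S q l < reach S q (Suc l)"

text \<open>\<open>r\<close> is the last index of the range, hence \<open>Suc\<close>. The value
  \<open>length S + 1\<close> of unreachable multiplicities marks index \<open>length S\<close>,
  which is not counted among \<open>i < r\<close> as long as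
  \<open>r \<le> length S\<close>.\<close>

definition right_end :: "'a list \<Rightarrow> nat \<Rightarrow> nat \<Rightarrow> bool" where
  "right_end S q r \<longleftrightarrow> (\<exists>l. reach S q l = Suc r)"

text \<open>Every value of \<open>reach S q\<close> below \<open>reach S q l\<close> has a last
  argument that attains it; this is a left end before \<open>l\<close>, and all left ends before
  \<open>l\<close> arise in this way.\<close>

lemma card_left_ends:
  "card {i. i < l \<and> left_end S q i} = card {v \<in> range (reach S q). v < reach S q l}"
proof (induction l)
  case 0
  have "{v \<in> range (reach S q). v < reach S q 0} = {}"
    using reach_mono[of 0 _ S q] by (auto simp: not_less)
  then show ?case by simp
next
  case (Suc l)
  define V where "V l = {v \<in> range (reach S q). v < reach S q l}" for l
  have fin: "finite (V l)" for l by (rule finite_subset[of _ "{..<reach S q l}"]) (auto simp: V_def)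
  have le: "reach S q l \<le> reach S q (Suc l)" by (rule reach_mono) simp
  show ?case
  proof (cases "left_end S q l")
    case True
    then have "V (Suc l) = insert (reach S q l) (V l)"
    proof -
      have "v < reach S q l \<or> v = reach S q l" if v: "v \<in> V (Suc l)" for v
      proof -
        obtain i where i: "v = reach S q i" "reach S q i < reach S q (Suc l)" using v unfolding V_def by blast
        then have "i \<le> l" using reach_mono[of "Suc l" i S q] by (meson not_less not_less_eq_eq)
        then show ?thesis using reach_mono[of i l S q] i(1) by auto
      qed
      then show ?thesis using True by (auto simp: V_def left_end_def)
    qed
    moreover have "{i. i < Suc l \<and> left_end S q i} = insert l {i. i < l \<and> left_end S q i}"
      using True by (auto simp: less_Suc_eq)
    ultimately show ?thesis using Suc.IH fin by (simp add: V_def[symmetric]) (simp add: V_def)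
  next
    case False
    then have "V (Suc l) = V l" using le by (simp add: V_def left_end_def)
    moreover have "{i. i < Suc l \<and> left_end S q i} = {i. i < l \<and> left_end S q i}"
      using False by (auto simp: less_Suc_eq)
    ultimately show ?thesis using Suc.IH by (simp add: V_def)
  qed
qed

lemma card_right_ends:
  assumes "q > 0"
  shows "card {i. i < r \<and> right_end S q i} = card {v \<in> range (reach S q). v \<le> r}"
proof -
  have "{v \<in> range (reach S q). v \<le> r} = Suc ` {i. i < r \<and> right_end S q i}"
  proof (intro set_eqI iffI)
    fix v assume v: "v \<in> {v \<in> range (reach S q). v \<le> r}"
    then obtain l where l: "v = reach S q l" by blast
    then have "v = Suc (v - 1)" using reach_pos[OF assms, of S l] by simp
    then obtain i where "v = Suc i" by blast
    then show "v \<in> Suc ` {i. i < r \<and> right_end S q i}" using v l by (auto simp: right_end_def)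
  qed (auto simp: right_end_def dest: sym)
  then show ?thesis by (simp add: card_image)
qed

text \<open>Both counts are sizes of initial segments of the range of \<open>reach S q\<close>: the
  values below \<open>reach S q l\<close> and the values up to \<open>r\<close>. The second is
  strictly larger iff it contains \<open>reach S q l\<close> itself.\<close>

lemma freq_test:
  assumes "q > 0" "r \<le> length S"
  shows "q \<le> freq S l r \<longleftrightarrow> card {i. i < l \<and> left_end S q i} < card {i. i < r \<and> right_end S q i}"
proof -
  define A where "A = {v \<in> range (reach S q). v < reach S q l}"
  define B where "B = {v \<in> range (reach S q). v \<le> r}"
  have fin: "finite A" "finite B"
    by (rule finite_subset[of _ "{..<reach S q l}"], auto simp: A_def)
       (rule finite_subset[of _ "{..r}"], auto simp: B_def)
  have "reach S q l \<le> r \<longleftrightarrow> card A < card B"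
  proof
    assume "reach S q l \<le> r"
    then have "A \<subset> B" by (auto simp: A_def B_def)
    then show "card A < card B" using fin(2) by (rule psubset_card_mono[rotated])
  next
    assume less: "card A < card B"
    show "reach S q l \<le> r"
    proof (rule ccontr)
      assume "\<not> reach S q l \<le> r"
      then have "B \<subseteq> A" by (auto simp: A_def B_def)
      then show False using card_mono[OF fin(1)] less by (simp add: not_less[symmetric])
    qed
  qed
  then show ?thesis
    using reach_le_iff[OF assms(2)] card_left_ends card_right_ends[OF assms(1)] by (metis A_def B_def)
qed

text \<open>Otherwise \<open>reach S q\<close> would keep its value from \<open>l\<close> up to
  \<open>length S\<close>, where no character is left to occur.\<close>

lemma next_left_end:
  assumes "q \<le> freq S l r" "q > 0" "r \<le> length S"
  shows "\<exists>i. l \<le> i \<and> i < length S \<and> left_end S q i"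
proof (rule ccontr)
  assume no: "\<not> ?thesis"
  have "reach S q (l + k) = reach S q l" if "l + k \<le> length S" for k
    using that
  proof (induction k)
    case (Suc k)
    then have "\<not> left_end S q (l + k)" using no by auto
    then show ?case using Suc reach_mono[of "l + k" "l + Suc k" S q] by (simp add: left_end_def)
  qed simp
  moreover have "l < length S"
  proof (rule ccontr)
    assume "\<not> l < length S"
    then have "occs S l r c = 0" for c by (auto simp: occs_def)
    then have "freq S l r \<le> 0" by (intro freq_le) simp
    then show False using assms(1,2) by simp
  qed
  ultimately have "reach S q (length S) = reach S q l" by (metis le_add_diff_inverse less_imp_le order_refl)
  then have "q \<le> freq S (length S) r" using assms reach_le_iff[OF assms(3)] by metis
  moreover have "freq S (length S) r = 0" using freq_le[of S "length S" r 0] by (simp add: occs_def)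
  ultimately show False using assms(2) by simp
qed

text \<open>At the next left end, the character is one whose removal lowers the frequency.\<close>

lemma next_left_end_is_mode:
  assumes lr: "l \<le> r" "r < length S" and q: "q = freq S l (Suc r)"
    and i: "i = (LEAST i. l \<le> i \<and> left_end S q i)"
  shows "is_mode (range_mset S l r) (S ! i)" "l \<le> i" "i < length S" "left_end S q i"
proof -
  have q0: "q > 0" using freq_pos[of l "Suc r" S] lr q by simp
  obtain i' where i': "l \<le> i' \<and> left_end S q i'" "i' < length S"
    using next_left_end[of q S l "Suc r"] lr q q0 by auto
  have li: "l \<le> i \<and> left_end S q i" unfolding i using i'(1) by (rule LeastI)
  have "i \<le> i'" unfolding i using i'(1) by (rule Least_le)
  then show il: "l \<le> i" "i < length S" "left_end S q i" using li i'(2) by auto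
  have same: "reach S q (l + k) = reach S q l" if "l + k \<le> i" for k
    using that
  proof (induction k)
    case (Suc k)
    then have "\<not> (l \<le> l + k \<and> left_end S q (l + k))" unfolding i by (intro not_less_Least) simp
    then show ?case using Suc reach_mono[of "l + k" "l + Suc k" S q] by (simp add: left_end_def)
  qed simp
  define v where "v = reach S q i"
  have "v = reach S q l" using same[of "i - l"] il(1) by (simp add: v_def)
  then have vr: "v \<le> Suc r" using reach_le_iff[of "Suc r" S q l] lr q by simp
  then have v: "v \<le> length S" using lr by simp
  have up: "q \<le> freq S i v" using reach_le_iff[OF v, of q i] by (simp add: v_def)
  have down: "freq S (Suc i) v < q"
    using reach_le_iff[OF v, of q "Suc i"] il(3) by (simp add: v_def left_end_def)
  obtain c where c: "c \<in> set S" "occs S i v c = freq S i v"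
    using freq_attained[of S i v] up q0 by auto
  \<comment> \<open>\<open>c\<close> occurs at least \<open>q\<close> times before position
    \<open>i\<close> is dropped and less than \<open>q\<close> times afterwards, so the dropped
    character is \<open>c\<close>.\<close>
  have "occs S (Suc i) v c < occs S i v c"
    using c up down occs_le_freq[OF c(1), of "Suc i" v] by linarith
  then have "S ! i = c" using occs_Suc_left[of S i v c] by (auto split: if_splits)
  moreover have "q \<le> occs S l (Suc r) c"
    using up c(2) occs_mono[OF il(1) vr, of S c] by simp
  ultimately show "is_mode (range_mset S l r) (S ! i)"
    using lr q c(1) by (intro is_mode_range_mset) auto
qed

section \<open>Locating a monotone function value\<close>

text \<open>
  For a monotone function \<open>H\<close> on \<open>{X..<2 * X}\<close>, where \<open>X = 2 ^ (h * D)\<close>, the dictionary contains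
  the intervals of the \<open>2 ^ h\<close>-ary trie on \<open>{X..<2 * X}\<close> on whose parent interval \<open>H\<close> is not
  constant. The leading bit of \<open>z div 2 ^ (h * i)\<close> encodes the level \<open>i\<close>, so one dictionary serves
  all levels. The ancestors of a leaf in the dictionary are those from some level upwards, and \<open>H\<close>
  is constant on the lowest of them.
\<close>

lemma trie_dictionary:
  fixes H :: "nat \<Rightarrow> nat" and D h X s :: nat
  defines "B \<equiv> \<lambda>i. 2 ^ (h * i)"
  assumes H: "mono H" "H (2 * X - 1) \<le> H X + s" "s < 2 * X"
    and h: "h > 0" and X: "X = 2 ^ (h * D)"
  shows "\<exists>A. (\<forall>p. A p < 2 ^ (h * D + 9)) \<and>
    (\<forall>z. X \<le> z \<longrightarrow> z < 2 * X \<longrightarrow> (\<exists>i0 \<le> D.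
      (\<forall>i \<le> D. 2 + 3 * hash (h * D + 1) (A 1) (A 0) (z div B i) + 2 < 128 * (1 + s * (D * 2 ^ h)) \<and>
        dict_slot (h * D + 1) A (z div B i) + 1 < 128 * (1 + s * (D * 2 ^ h)) \<and>
        (A (dict_slot (h * D + 1) A (z div B i)) = z div B i \<longleftrightarrow> i0 \<le> i)) \<and>
      A (dict_slot (h * D + 1) A (z div B i0) + 1) = H z - H X \<and> (i0 = D \<longrightarrow> H z = H X)))"
proof -
  \<comment> \<open>First and last leaf of the level-\<open>i\<close> interval around
    \<open>z\<close>. Since \<open>H\<close> is monotone, it varies on the interval iff it differs
    at these two leaves.\<close>
  define start stop where "start i z = z div B i * B i" and "stop i z = start i z + (B i - 1)" for i z
  define varies where "varies i z \<longleftrightarrow> H (start i z) < H (stop i z)" for i z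
  have Bpos: "B i > 0" for i by (simp add: B_def)
  have B0: "B 0 = 1" "B D = X" by (simp_all add: B_def X)
  have Badd: "B (i + j) = B i * B j" for i j by (simp add: B_def power_add distrib_left)
  have XB: "X = B (D - i) * B i" if "i \<le> D" for i
    using that by (simp add: B0(2)[symmetric] Badd[symmetric])
  have around: "start i z \<le> z" "z \<le> stop i z" for i z
  proof -
    show "start i z \<le> z" by (simp add: start_def)
    have "z mod B i < B i" using Bpos by simp
    moreover have "z = start i z + z mod B i" by (simp add: start_def)
    ultimately show "z \<le> stop i z" unfolding stop_def by linarith
  qed
  have within: "X \<le> start i z" "stop i z < 2 * X" if "X \<le> z" "z < 2 * X" "i \<le> D" for i z
  proof -
    have "B (D - i) \<le> z div B i"
      using that XB[OF that(3)] by (metis Bpos div_le_mono nonzero_mult_div_cancel_right neq0_conv)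
    then show "X \<le> start i z" unfolding start_def XB[OF that(3)] by simp
    have "z < 2 * B (D - i) * B i" using that XB[OF that(3)] by simp
    then have "z div B i < 2 * B (D - i)" by (simp add: less_mult_imp_div_less)
    then have "(z div B i + 1) * B i \<le> 2 * B (D - i) * B i" by (intro mult_le_mono1) simp
    then have "start i z + B i \<le> 2 * X" unfolding start_def using XB[OF that(3)] by simp
    then show "stop i z < 2 * X" unfolding stop_def using Bpos[of i] by linarith
  qed
  \<comment> \<open>At level \<open>i\<close> the number \<open>z div B i\<close> lies between
    \<open>B (D - i)\<close> and twice that. Since \<open>h > 0\<close>, these ranges are disjoint
    for different levels, so a key determines its level.\<close>
  have level: "i = j" if "z div B i = z' div B j" "X \<le> z" "z < 2 * X" "X \<le> z'" "z' < 2 * X" "i \<le> D" "j \<le> D" for i j z z'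
  proof -
    have rng: "B (D - i) \<le> z div B i \<and> z div B i < 2 * B (D - i)" if "X \<le> z" "z < 2 * X" "i \<le> D" for i z
      using that within[OF that] XB[OF that(3)]
      by (metis Bpos div_le_mono nonzero_mult_div_cancel_right neq0_conv less_mult_imp_div_less mult.assoc)
    have lt: False if "a < c" "B c \<le> k" "k < 2 * B a" for a c k
    proof -
      have "h * a + 1 \<le> h * c" using mult_le_mono2[of "Suc a" c h] that(1) h by simp
      then have "(2::nat) ^ (h * a + 1) \<le> 2 ^ (h * c)" by (intro power_increasing) auto
      then show False using that(2,3) by (simp add: B_def)
    qed
    have "D - i = D - j"
      using rng[of z i] rng[of z' j] lt[of "D - i" "D - j" "z div B i"] lt[of "D - j" "D - i" "z div B i"] that
      by (metis linorder_neqE_nat)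
    then show ?thesis using that(6,7) by simp
  qed
  have same: "start i z = start i z'" "stop i z = stop i z'" if "z div B i = z' div B i" for i z z'
    using that by (simp_all add: start_def stop_def)
  have const: "H z = H z'" if "\<not> varies i z" "z div B i = z' div B i" for i z z'
  proof -
    have "H (start i z) \<le> H z" "H z \<le> H (stop i z)" "H (start i z) \<le> H z'" "H z' \<le> H (stop i z)"
      using around(1)[of i z] around(2)[of z i] around(1)[of i z'] around(2)[of z' i] same[OF that(2)] monoD[OF H(1)] by simp_all
    then show ?thesis using that(1) by (simp add: varies_def)
  qed
  have up: "z div B j = z' div B j" if "z div B i = z' div B i" "i \<le> j" for i j z z'
  proof -
    have "B j = B i * B (j - i)" using that(2) by (simp add: Badd[symmetric])
    then show ?thesis using that(1) by (simp add: div_mult2_eq)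
  qed
  have varies_up: "varies j z" if "varies i z" "i \<le> j" for i j z
  proof (rule ccontr)
    assume no: "\<not> varies j z"
    have "start i z div B i = z div B i" using Bpos by (simp add: start_def)
    moreover have "stop i z div B i = z div B i"
      unfolding stop_def start_def using Bpos[of i] by (intro div_nat_eqI) (simp_all add: mult.commute)
    ultimately have "z div B j = start i z div B j" "z div B j = stop i z div B j"
      using up[OF _ that(2)] by metis+
    then have "H (start i z) = H (stop i z)" using const[OF no] by metis
    then show False using that(1) by (simp add: varies_def)
  qed
  define K where "K = {z div B i | z i. X \<le> z \<and> z < 2 * X \<and> i \<le> D \<and> (i = D \<or> varies (Suc i) z)}"
  have K_iff: "z div B i \<in> K \<longleftrightarrow> i = D \<or> varies (Suc i) z" if "X \<le> z" "z < 2 * X" "i \<le> D" for z i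
  proof
    assume "z div B i \<in> K"
    then obtain z' j where z': "z div B i = z' div B j" "X \<le> z'" "z' < 2 * X" "j \<le> D" "j = D \<or> varies (Suc j) z'"
      by (auto simp: K_def)
    have ij: "j = i" using level[OF z'(1)] z' that by simp
    have "z' div B i = z div B i" using z'(1) ij by simp
    then have "z' div B (Suc i) = z div B (Suc i)" by (rule up) simp
    then show "i = D \<or> varies (Suc i) z"
      using z'(5) same[of z' "Suc i" z] by (simp add: ij varies_def)
  qed (use that in \<open>auto simp: K_def\<close>)
  \<comment> \<open>The intervals of level \<open>i\<close> on which \<open>H\<close> varies.
    \<open>H\<close> is strictly larger at the start of each later one, and its values at the starts
    lie in \<open>{H X..<H X + s}\<close>, so each level has at most \<open>s\<close> of
    them.\<close>
  define NC where "NC i = {z div B i | z. X \<le> z \<and> z < 2 * X \<and> varies i z}" for i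
  have NC: "finite (NC i) \<and> card (NC i) \<le> s" if "i \<le> D" for i
  proof -
    have fin: "finite (NC i)"
    proof (rule finite_subset)
      show "NC i \<subseteq> {..2 * X}" unfolding NC_def by (auto intro: order_trans[OF div_le_dividend])
    qed simp
    have inj: "inj_on (\<lambda>k. H (k * B i)) (NC i)"
    proof (rule linorder_inj_onI')
      fix k k' assume kk: "k \<in> NC i" "k' \<in> NC i" "k < k'"
      obtain z where z: "k = z div B i" "varies i z" using kk(1) by (auto simp: NC_def)
      have "(k + 1) * B i \<le> k' * B i" using kk(3) by (intro mult_le_mono1) simp
      then have "stop i z \<le> k' * B i" unfolding stop_def start_def z(1) distrib_right by linarith
      then have "H (stop i z) \<le> H (k' * B i)" using monoD[OF H(1)] by blast
      then show "H (k * B i) \<noteq> H (k' * B i)" using z by (simp add: varies_def start_def)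
    qed
    have "(\<lambda>k. H (k * B i)) ` NC i \<subseteq> {H X..<H X + s}"
    proof (clarsimp simp: NC_def)
      fix z assume z: "X \<le> z" "z < 2 * X" "varies i z"
      note w = within[OF z(1,2) that]
      have "H X \<le> H (start i z)" using monoD[OF H(1) w(1)] .
      moreover have "H (stop i z) \<le> H (2 * X - 1)" using w(2) by (intro monoD[OF H(1)]) linarith
      ultimately show "H X \<le> H (z div B i * B i) \<and> H (z div B i * B i) < H X + s"
        using z(3) H(2) by (simp add: varies_def start_def)
    qed
    then have "card (NC i) \<le> card {H X..<H X + s}"
      by (rule card_inj_on_le[OF inj]) simp
    then show ?thesis using fin by simp
  qed
  \<comment> \<open>Every key but the root, whose number is 1, is one of the \<open>2 ^ h\<close>
    children of an interval on which \<open>H\<close> varies.\<close>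
  have "K \<subseteq> insert 1 (\<Union>i<D. (\<lambda>(k, j). k * 2 ^ h + j) ` (NC (Suc i) \<times> {..<2 ^ h}))"
  proof
    fix k assume "k \<in> K"
    then obtain z i where z: "k = z div B i" "X \<le> z" "z < 2 * X" "i \<le> D" "i = D \<or> varies (Suc i) z"
      by (auto simp: K_def)
    show "k \<in> insert 1 (\<Union>i<D. (\<lambda>(k, j). k * 2 ^ h + j) ` (NC (Suc i) \<times> {..<2 ^ h}))"
    proof (cases "i = D")
      case True
      have "z div X = 1" using z(2,3) by (intro div_nat_eqI) auto
      then show ?thesis using True z(1) by (simp add: B0)
    next
      case False
      then have i: "i < D" "varies (Suc i) z" using z by auto
      have "B (Suc i) = B i * 2 ^ h" by (simp add: B_def power_add)
      then have "k div 2 ^ h = z div B (Suc i)" by (simp add: z(1) div_mult2_eq)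
      then have "k div 2 ^ h \<in> NC (Suc i)" using z i by (auto simp: NC_def)
      moreover have "k = k div 2 ^ h * 2 ^ h + k mod 2 ^ h" "k mod 2 ^ h < 2 ^ h"
        by (rule div_mult_mod_eq[symmetric]) simp
      ultimately show ?thesis using i(1) by (intro insertI2 UN_I[of i]) (auto intro!: image_eqI[of _ _ "(k div 2 ^ h, k mod 2 ^ h)"])
    qed
  qed
  moreover have fin: "finite (insert 1 (\<Union>i<D. (\<lambda>(k, j). k * 2 ^ h + j) ` (NC (Suc i) \<times> {..<2 ^ h})))"
    using NC by (intro finite.insertI finite_UN_I finite_imageI finite_cartesian_product) auto
  ultimately have "card K \<le> card (insert 1 (\<Union>i<D. (\<lambda>(k, j). k * 2 ^ h + j) ` (NC (Suc i) \<times> {..<2 ^ h})))"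
    by (rule card_mono[rotated])
  also have "\<dots> \<le> Suc (card (\<Union>i<D. (\<lambda>(k, j). k * 2 ^ h + j) ` (NC (Suc i) \<times> {..<2 ^ h})))"
    using fin by (simp add: card_insert_if)
  also have "card (\<Union>i<D. (\<lambda>(k, j). k * 2 ^ h + j) ` (NC (Suc i) \<times> {..<2 ^ h}))
      \<le> (\<Sum>i<D. card ((\<lambda>(k, j). k * 2 ^ h + j) ` (NC (Suc i) \<times> {..<2 ^ h})))"
    by (rule card_UN_le) simp
  also have "\<dots> \<le> (\<Sum>i<D. s * 2 ^ h)"
  proof (rule sum_mono)
    fix i assume "i \<in> {..<D}"
    then have nc: "finite (NC (Suc i))" "card (NC (Suc i)) \<le> s" using NC[of "Suc i"] by auto
    have "card ((\<lambda>(k, j). k * 2 ^ h + j) ` (NC (Suc i) \<times> {..<2 ^ h})) \<le> card (NC (Suc i) \<times> {..<(2::nat) ^ h})"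
      using nc(1) by (intro card_image_le) auto
    also have "\<dots> \<le> s * 2 ^ h" using nc(2) by (simp add: card_cartesian_product)
    finally show "card ((\<lambda>(k, j). k * 2 ^ h + j) ` (NC (Suc i) \<times> {..<2 ^ h})) \<le> s * 2 ^ h" .
  qed
  finally have cardK: "card K \<le> 1 + s * (D * 2 ^ h)" by (simp add: mult_ac)
  define W where "W = h * D + 1"
  have W: "2 ^ W = 2 * X" "W > 0" by (simp_all add: W_def X)
  have KW: "K \<subseteq> {..<2 ^ W}"
    unfolding K_def W(1) by (auto intro: le_less_trans[OF div_le_dividend])
  have X0: "X > 0" by (simp add: X)
  have "X div B D \<in> K" using K_iff[of X D] X0 by simp
  then have Kne: "K \<noteq> {}" by blast
  \<comment> \<open>Any leaf may represent the interval: the value matters only at the lowest key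
    above a leaf, and there \<open>H\<close> is constant. The difference to \<open>H X\<close> fits
    into \<open>W\<close> bits because \<open>s < 2 * X\<close>.\<close>
  define v where "v k = H (SOME z. X \<le> z \<and> z < 2 * X \<and> (\<exists>i\<le>D. k = z div B i)) - H X" for k
  have some: "X \<le> y \<and> y < 2 * X \<and> y div B i = z div B i \<and> v (z div B i) = H y - H X"
    if "X \<le> z" "z < 2 * X" "i \<le> D" "y = (SOME y. X \<le> y \<and> y < 2 * X \<and> (\<exists>j\<le>D. z div B i = y div B j))" for y z i
  proof -
    have *: "X \<le> y \<and> y < 2 * X \<and> (\<exists>j\<le>D. z div B i = y div B j)"
      unfolding that(4) by (rule someI[of _ z]) (use that in blast)
    then obtain j where j: "j \<le> D" "z div B i = y div B j" by blast
    then have "i = j" using level[OF j(2)] * that by blast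
    then show ?thesis using * j by (simp add: v_def that(4))
  qed
  have v_less: "v k < 2 ^ W" if k: "k \<in> K" for k
  proof -
    obtain z i where z: "k = z div B i" "X \<le> z" "z < 2 * X" "i \<le> D" using k by (auto simp: K_def)
    obtain y where y: "y < 2 * X" "v k = H y - H X" using some[OF z(2-4) refl] z(1) by blast
    have "H y \<le> H (2 * X - 1)" using y(1) by (intro monoD[OF H(1)]) linarith
    then show ?thesis using y(2) H(2,3) W(1) by linarith
  qed
  obtain A where A: "\<forall>p. A p < 2 ^ (W + 8)"
    "\<And>x. x < 2 ^ W \<Longrightarrow> 2 + 3 * hash W (A 1) (A 0) x + 2 < 128 * card K \<and>
       dict_slot W A x + 1 < 128 * card K \<and>
       (A (dict_slot W A x) = x \<longleftrightarrow> x \<in> K) \<and>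
       (x \<in> K \<longrightarrow> A (dict_slot W A x + 1) = v x)"
    using dictionary[OF KW Kne W(2), of v, OF v_less] by blast
  have main: "\<exists>i0 \<le> D.
      (\<forall>i \<le> D. 2 + 3 * hash W (A 1) (A 0) (z div B i) + 2 < 128 * (1 + s * (D * 2 ^ h)) \<and>
        dict_slot W A (z div B i) + 1 < 128 * (1 + s * (D * 2 ^ h)) \<and>
        (A (dict_slot W A (z div B i)) = z div B i \<longleftrightarrow> i0 \<le> i)) \<and>
      A (dict_slot W A (z div B i0) + 1) = H z - H X \<and> (i0 = D \<longrightarrow> H z = H X)"
    if z: "X \<le> z" "z < 2 * X" for z
  proof -
    have zW: "z div B i < 2 ^ W" for i
      unfolding W(1) using z(2) by (rule le_less_trans[OF div_le_dividend])
    define i0 where "i0 = (LEAST i. z div B i \<in> K)"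
    have KD: "z div B D \<in> K" using K_iff[OF z] by simp
    have i0: "i0 \<le> D" "z div B i0 \<in> K" unfolding i0_def using KD by (auto intro: LeastI Least_le)
    have up': "z div B i \<in> K \<longleftrightarrow> i0 \<le> i" if "i \<le> D" for i
    proof
      show "i0 \<le> i" if "z div B i \<in> K" unfolding i0_def using that by (rule Least_le)
      show "z div B i \<in> K" if "i0 \<le> i"
        using i0 K_iff[OF z i0(1)] K_iff[OF z \<open>i \<le> D\<close>] varies_up[of "Suc i0" z "Suc i"] that \<open>i \<le> D\<close>
        by auto
    qed
    have "v (z div B i0) = H z - H X"
    proof -
      obtain y where y: "X \<le> y" "y < 2 * X" "y div B i0 = z div B i0" "v (z div B i0) = H y - H X"
        using some[OF z i0(1) refl] by blast
      have "H y = H z"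
      proof (cases i0)
        case 0
        then show ?thesis using y(3) by (simp add: B0)
      next
        case (Suc j)
        then have "z div B j \<notin> K" using up'[of j] i0(1) by simp
        then have "\<not> varies i0 z" using K_iff[OF z, of j] Suc i0(1) by simp
        then show ?thesis using const[of i0 z y] y(3) by simp
      qed
      then show ?thesis using y(4) by simp
    qed
    then have "A (dict_slot W A (z div B i0) + 1) = H z - H X" using A(2)[OF zW] i0(2) by metis
    moreover have "2 + 3 * hash W (A 1) (A 0) (z div B i) + 2 < 128 * (1 + s * (D * 2 ^ h))"
      "dict_slot W A (z div B i) + 1 < 128 * (1 + s * (D * 2 ^ h))" for i
      using A(2)[OF zW, of i] mult_le_mono2[OF cardK, of 128] by (meson less_le_trans)+
    moreover have "A (dict_slot W A (z div B i)) = z div B i \<longleftrightarrow> i0 \<le> i" if "i \<le> D" for i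
      using A(2)[OF zW, of i] up'[OF that] by blast
    \<comment> \<open>The level search starts at the root with offset 0 and never fetches the value
      stored there, so the offset must be right already.\<close>
    moreover have "H z = H X" if D: "i0 = D"
    proof (cases D)
      case 0
      then have "X = 1" by (simp add: X)
      then have "z = X" using z by simp
      then show ?thesis by simp
    next
      case (Suc j)
      then have "z div B j \<notin> K" using up'[of j] D by simp
      then have "\<not> varies D z" using K_iff[OF z, of j] Suc by simp
      moreover have "z div B D = X div B D"
        unfolding B0 using z by (simp add: div_nat_eqI)
      ultimately show ?thesis by (rule const)
    qed
    ultimately show ?thesis using i0(1) by blast
  qed
  show ?thesis
    using A(1) main unfolding W_def by (intro exI[of _ A]) (simp add: add.commute)
qed

section \<open>The query program\<close>

text \<open>Cells 10 to 34 hold the header. Cell 7 is never written and stays 0.\<close>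

definition load_header :: com where
  "load_header = Block ([Const 5 64, Op Mul 5 5 2] @
     concat (map (\<lambda>i. [Read_Bits (10 + i) 6 5, Op Add 6 6 5]) [0..<25]))"

text \<open>The directory entry of the block plus the number of ones before the position within the
  block, from the table of popcounts. Cell \<open>a\<close> holds the position; cells 40 to 43 are
  scratch.\<close>

definition rank_code :: "nat \<Rightarrow> nat \<Rightarrow> instr list" where
  "rank_code d a = [Op Div 40 a 10, Op Mod 41 a 10, Op Mul 42 40 11, Op Add 42 15 42,
     Read_Bits 42 42 11, Op Sub 43 a 41, Op Add 43 14 43, Read_Bits 43 43 41,
     Op Mul 43 43 10, Op Add 43 17 43, Read_Bits 43 43 10, Op Add d 42 43]"

text \<open>Cell 50 receives the exclusive right end and 62 the value of \<open>F\<close> at the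
  start of the trie cell: a difference of two ranks gives the quotient by \<open>X\<close>, and the
  residue is stored. Then 63 is the bit address of the dictionary, 64 the leaf, and 65 and 66 are
  the parameters of the top-level hash function.\<close>

definition enter_cell :: com where
  "enter_cell =
     Block ([Op Add 50 1 31, Op Div 51 0 30, Op Div 52 50 21, Op Mod 53 50 21,
       Op Mul 54 51 25, Op Add 55 54 52, Op Add 56 13 55, Op Add 57 13 54] @
       rank_code 58 56 @ rank_code 59 57) ;;
     Block [Op Sub 60 58 59, Op Mul 60 60 21, Op Mul 61 55 20, Op Add 61 19 61,
       Read_Bits 61 61 20, Op Add 62 60 61] ;;
     Block [Op Mul 63 51 26, Op Mul 64 52 34, Op Mul 65 62 27, Op Add 63 63 64, Op Add 63 63 65,
       Op Mul 63 63 29, Op Add 63 28 63, Op Add 64 21 53, Read_Bits 65 63 29,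
       Op Add 66 63 29, Read_Bits 66 66 29, Op Add 67 7 7, Op Add 68 24 7, Op Add 69 7 7]"

text \<open>Cells 67 and 68 enclose the lowest stored level; 69 is the value fetched at the level in
  68, initially 0. Adding cell 7 serves as a copy instruction.\<close>

definition trie_search :: com where
  "trie_search = While_Less 67 68
     (Block [Op Add 70 67 68, Op Div 70 70 32, Op Mul 71 23 70, Op Shr 71 64 71,
        Op Mul 72 65 71, Op Mod 72 72 22, Op Shr 72 72 66] ;;
      Block [Op Mul 72 72 33, Op Add 72 72 32, Op Mul 72 72 29, Op Add 72 63 72,
        Read_Bits 73 72 29, Op Add 72 72 29, Read_Bits 74 72 29, Op Add 72 72 29,
        Read_Bits 75 72 29] ;;
      Block [Op Mul 76 73 71, Op Mod 76 76 22, Op Shr 76 76 74, Op Mul 76 76 32,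
        Op Add 76 75 76, Op Mul 76 76 29, Op Add 76 63 76, Read_Bits 77 76 29] ;;
      If_Eq 77 71
        (Block [Op Add 76 76 29, Read_Bits 69 76 29, Op Add 68 70 7])
        (Block [Op Add 67 70 31]))"

text \<open>The frequency stays at least cell 67 and below cell 68. Positions 71 and 72 lie in the
  neighbouring vectors of left and right ends for the tested multiplicity.\<close>

definition freq_search :: com where
  "freq_search =
     Block [Op Add 70 62 69, Op Add 68 70 31] ;;
     If_Less 70 30 (Block [Op Add 67 7 7]) (Block [Op Sub 67 70 30]) ;;
     Block [Op Add 69 67 31] ;;
     While_Less 69 68
       (Block ([Op Add 70 67 68, Op Div 70 70 32, Op Mul 71 32 70, Op Mul 71 71 12, Op Add 72 71 12,
          Op Add 71 71 0, Op Add 72 72 50] @ rank_code 73 71 @ rank_code 74 72) ;;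
        If_Less 73 74
          (Block [Op Add 67 70 7, Op Add 69 70 31])
          (Block [Op Add 68 70 7]))"

text \<open>The next left end is found in the rest of the current block through the table of
  trailing zeros, as a distance from \<open>l\<close>. If the rest is empty, the successor stored
  for the block is an absolute index.\<close>

definition report :: com where
  "report =
     Block [Op Mul 70 32 67, Op Mul 70 70 12, Op Add 70 70 0, Op Div 71 70 10, Op Mod 72 70 10,
       Op Sub 72 10 72, Op Add 73 14 70, Read_Bits 73 73 72] ;;
     If_Eq 73 7
       (Block [Op Mul 71 71 11, Op Add 71 16 71, Read_Bits 74 71 11])
       (Block [Op Mul 73 73 10, Op Add 73 18 73, Read_Bits 73 73 10, Op Add 74 0 73]) ;;
     Block [Read_String 0 74]"

definition query_program :: com where
  "query_program = load_header ;; enter_cell ;; trie_search ;; freq_search ;; report"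

section \<open>Bounds that exclude overflow\<close>

lemma bits_at_less: "len \<le> k \<Longrightarrow> bits_at E off len < 2 ^ k"
proof -
  assume "len \<le> k"
  have "bits_at E off len < 2 ^ length (take len (drop off E))"
    unfolding bits_at_def by (rule horner_sum_of_bool_2_less)
  also have "\<dots> \<le> 2 ^ k" using \<open>len \<le> k\<close> by (intro power_increasing) auto
  finally show ?thesis .
qed

text \<open>
  No arithmetic overflows: every intermediate value is at most \<open>Z ^ k\<close> for some \<open>k \<le> 12\<close>, where
  \<open>Z\<close> bounds the header and all stored numbers and \<open>Z ^ 12 < 2 ^ w\<close>.
\<close>

definition small :: "nat \<Rightarrow> nat \<Rightarrow> nat \<Rightarrow> bool" where
  "small Z k x \<longleftrightarrow> x \<le> Z ^ k"

lemma small_mono: "small Z j x \<Longrightarrow> j \<le> k \<Longrightarrow> Z \<ge> 2 \<Longrightarrow> small Z k x"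
  unfolding small_def by (erule order_trans, rule power_increasing) simp_all

lemma small_add: "small Z i x \<Longrightarrow> small Z j y \<Longrightarrow> Z \<ge> 2 \<Longrightarrow> small Z (Suc (max i j)) (x + y)"
proof -
  assume a: "small Z i x" "small Z j y" "Z \<ge> 2"
  then have "x \<le> Z ^ max i j" "y \<le> Z ^ max i j"
    using small_mono[OF a(1), of "max i j"] small_mono[OF a(2), of "max i j"] by (simp_all add: small_def)
  then have "x + y \<le> 2 * Z ^ max i j" by simp
  also have "\<dots> \<le> Z * Z ^ max i j" using a(3) by (rule mult_le_mono1)
  finally show ?thesis by (simp add: small_def)
qed

lemma small_mult: "small Z i x \<Longrightarrow> small Z j y \<Longrightarrow> Z \<ge> 2 \<Longrightarrow> small Z (i + j) (x * y)"
  by (simp add: small_def power_add mult_le_mono)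

lemma small_le: "small Z i y \<Longrightarrow> x \<le> y \<Longrightarrow> small Z i x"
  by (simp add: small_def)

lemma small_div: "small Z i x \<Longrightarrow> small Z i (x div y)"
  by (rule small_le) auto

lemma small_mod: "small Z i x \<Longrightarrow> small Z i (x mod y)"
  by (rule small_le) auto

lemma small_diff: "small Z i x \<Longrightarrow> small Z i (x - y)"
  by (rule small_le) auto

lemma eval_add: "x + y < 2 ^ w \<Longrightarrow> eval_op w Add x y = x + y"
  by simp

lemma eval_mul: "x * y < 2 ^ w \<Longrightarrow> eval_op w Mul x y = x * y"
  by simp

lemma eval_sub: "y \<le> x \<Longrightarrow> x < 2 ^ w \<Longrightarrow> eval_op w Sub x y = x - y"
proof -
  assume a: "y \<le> x" "x < 2 ^ w"
  then have "(int x - int y) mod 2 ^ w = int ((x - y) mod 2 ^ w)"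
    by (simp only: of_nat_diff of_nat_mod of_nat_power of_nat_numeral)
  then show "eval_op w Sub x y = x - y"
    using a(2) by (simp only: eval_op.simps nat_int mod_less less_imp_diff_less)
qed

text \<open>The interface between program and bit string: header, rank queries and size bounds,
  without reference to modes. The width conditions ensure that no read is cut off at
  \<open>w\<close> bits.\<close>

locale query_data =
  fixes w :: nat and Sc :: "nat list" and D :: "bool list"
    and Z n m b Lv V2 VL oV oDir oSuc oPop oCtz oRes xw X h DD NB PL K1 oLoc om g :: nat
    and rk :: "nat \<Rightarrow> nat"
  assumes Z: "Z \<ge> 128" "Z ^ 12 < 2 ^ w"
    and n: "n = length Sc" "n > 0"
    and header: "\<And>i. i < 25 \<Longrightarrow> bits_at D (i * (64 * n)) (min (64 * n) w) =
      [b, 4 * b, Lv, V2, oV, oDir, oSuc, oPop, oCtz, oRes, xw, X, 2 * X, h, DD, NB, PL, K1, oLoc, om,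
       g, 1, 2, 3, 128] ! i"
    and header_small: "b \<le> Z" "4 * b \<le> Z" "Lv \<le> Z" "V2 \<le> Z" "oV \<le> Z" "oDir \<le> Z" "oSuc \<le> Z"
      "oPop \<le> Z" "oCtz \<le> Z" "oRes \<le> Z" "xw \<le> Z" "X \<le> Z" "2 * X \<le> Z" "h \<le> Z" "DD \<le> Z" "NB \<le> Z"
      "PL \<le> Z" "K1 \<le> Z" "oLoc \<le> Z" "om \<le> Z" "g \<le> Z" "64 * (25 * n) \<le> Z"
    and widths: "4 * b \<le> w" "xw \<le> w" "om \<le> w" "2 ^ (4 * b) \<le> Z" "2 ^ xw \<le> Z" "2 ^ om \<le> Z"
    and pos: "b > 0" "X > 0" "g > 0"
    and VL: "VL \<le> Z"
    and rank: "\<And>P. P \<le> VL \<Longrightarrow> bits_at D (oDir + P div b * (4 * b)) (4 * b) +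
      bits_at D (oPop + bits_at D (oV + (P - P mod b)) (P mod b) * b) b = rk P"
    and rank_small: "\<And>P. rk P \<le> Z"
begin

lemma Z2: "Z \<ge> 2" using Z(1) by simp

lemma small_less: "small Z k x \<Longrightarrow> k \<le> 12 \<Longrightarrow> x < 2 ^ w"
  using le_less_trans[OF small_mono[of Z k x 12, OF _ _ Z2, unfolded small_def[of Z 12]] Z(2)] .

lemma small_1: "x \<le> Z \<Longrightarrow> small Z 1 x" by (simp add: small_def)

lemma bits_small: "2 ^ len \<le> Z \<Longrightarrow> bits_at D off len \<le> Z"
  using bits_at_less[of len len D off] by simp

lemmas header_smalls = header_small[THEN small_1]

lemma bits_small_1:
  "small Z 1 (bits_at D off (4 * b))" "small Z 1 (bits_at D off xw)" "small Z 1 (bits_at D off om)"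
  using widths(4-6)[THEN bits_small, THEN small_1] .

lemma bits_small_2: "k \<le> 4 * b \<Longrightarrow> small Z 1 (bits_at D off k)"
proof -
  assume "k \<le> 4 * b"
  then have "(2::nat) ^ k \<le> 2 ^ (4 * b)" by (intro power_increasing) auto
  then have "bits_at D off k \<le> Z" using widths(4) by (intro bits_small) (rule order_trans)
  then show "small Z 1 (bits_at D off k)" by (rule small_1)
qed

lemma num_small: "small Z 1 0" "small Z 1 1" "small Z 1 2" "small Z 1 3" "small Z 1 128"
  using Z(1) by (simp_all add: small_def)

lemmas smalls = small_add[OF _ _ Z2] small_mult[OF _ _ Z2] small_div small_mod small_diff
  header_smalls bits_small_1 num_small small_1[OF rank_small]

definition env :: "nat \<Rightarrow> nat \<Rightarrow> (nat \<Rightarrow> nat) \<Rightarrow> bool" where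
  "env l r M \<longleftrightarrow> M 0 = l \<and> M 1 = r \<and> M 7 = 0 \<and> M 10 = b \<and> M 11 = 4 * b \<and> M 12 = Lv \<and> M 13 = V2 \<and>
     M 14 = oV \<and> M 15 = oDir \<and> M 16 = oSuc \<and> M 17 = oPop \<and> M 18 = oCtz \<and> M 19 = oRes \<and> M 20 = xw \<and>
     M 21 = X \<and> M 22 = 2 * X \<and> M 23 = h \<and> M 24 = DD \<and> M 25 = NB \<and> M 26 = PL \<and> M 27 = K1 \<and>
     M 28 = oLoc \<and> M 29 = om \<and> M 30 = g \<and> M 31 = 1 \<and> M 32 = 2 \<and> M 33 = 3 \<and> M 34 = 128"

lemma load_header_steps:
  assumes "k \<le> 25" "M 6 = 0" "M 5 = 64 * n"
  shows "fold (eff w Sc D) (concat (map (\<lambda>i. [Read_Bits (10 + i) 6 5, Op Add 6 6 5]) [0..<k])) M =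
    (\<lambda>a. if a = 6 then k * (64 * n)
      else if 10 \<le> a \<and> a < 10 + k then bits_at D ((a - 10) * (64 * n)) (min (64 * n) w) else M a)"
  using assms(1)
proof (induction k)
  case 0
  then show ?case using assms(2) by auto
next
  case (Suc k)
  have "Suc k * (64 * n) \<le> 25 * (64 * n)" using Suc.prems by (intro mult_le_mono1)
  then have "k * (64 * n) + 64 * n \<le> Z" using header_small(22) unfolding mult_Suc by linarith
  then have "k * (64 * n) + 64 * n < 2 ^ w"
    by (rule small_less[OF small_1]) simp
  then show ?case
    using Suc assms(3) by (auto simp: fun_eq_iff)
qed

lemma does_load_header:
  "does w Sc D load_header (snd (init_state w Sc l r)) 52 (env l r)"
proof -
  define M where "M = fold (eff w Sc D) [Const 5 64, Op Mul 5 5 2] (snd (init_state w Sc l r))"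
  have w64: "64 < (2::nat) ^ w" "64 * n < 2 ^ w"
    by (rule small_less[OF small_1], use Z(1) header_small(22) in simp_all)+
  have M: "M 6 = 0" "M 5 = 64 * n" "M 7 = 0" "M 0 = l" "M 1 = r"
    using w64 by (simp_all add: M_def init_state_def n)
  define xs where "xs = concat (map (\<lambda>i. [Read_Bits (10 + i) 6 5, Op Add 6 6 5]) [0..<25])"
  have len: "length xs = 50" by (simp add: xs_def length_concat sum_list_triv o_def)
  have "does w Sc D load_header (snd (init_state w Sc l r)) 52 (env l r)"
    unfolding load_header_def xs_def[symmetric]
  proof (rule does_Block)
    show "\<forall>x\<in>set ([Const 5 64, Op Mul 5 5 2] @ xs). \<not> is_jump x" by (auto simp: xs_def)
    show "length ([Const 5 64, Op Mul 5 5 2] @ xs) \<le> 52" by (simp add: len)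
    define M' where "M' = fold (eff w Sc D) ([Const 5 64, Op Mul 5 5 2] @ xs) (snd (init_state w Sc l r))"
    have "M' = fold (eff w Sc D) xs M" by (simp add: M'_def M_def)
    also have "\<dots> = (\<lambda>a. if a = 6 then 25 * (64 * n)
      else if 10 \<le> a \<and> a < 10 + 25 then bits_at D ((a - 10) * (64 * n)) (min (64 * n) w) else M a)"
      unfolding xs_def by (rule load_header_steps[OF order_refl M(1,2)])
    finally have M': "M' = \<dots>" .
    have "M' a = [b, 4 * b, Lv, V2, oV, oDir, oSuc, oPop, oCtz, oRes, xw, X, 2 * X, h, DD, NB, PL, K1,
      oLoc, om, g, 1, 2, 3, 128] ! (a - 10)" if "10 \<le> a" "a < 35" for a
      using header[of "a - 10"] that by (simp add: M')
    moreover have "M' 0 = l" "M' 1 = r" "M' 7 = 0" using M(3-5) by (simp_all add: M')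
    ultimately have "env l r M'" unfolding env_def by simp
    then show "env l r (fold (eff w Sc D) ([Const 5 64, Op Mul 5 5 2] @ xs) (snd (init_state w Sc l r)))"
      unfolding M'_def .
  qed
  then show ?thesis .
qed

lemma rank_code_effect:
  assumes "env l r M" "M a = P" "P \<le> VL" "a \<notin> {40, 41, 42, 43}"
  shows "fold (eff w Sc D) (rank_code d a) M =
    M(40 := P div b, 41 := P mod b, 42 := bits_at D (oDir + P div b * (4 * b)) (4 * b),
      43 := bits_at D (oPop + bits_at D (oV + (P - P mod b)) (P mod b) * b) b, d := rk P)"
proof -
  have P: "small Z 1 P" using assms(3) VL small_1 by simp
  have "P mod b \<le> b" using pos(1) by (simp add: less_imp_le)
  then have sm: "small Z 1 (bits_at D x (P mod b))" "small Z 1 (bits_at D x b)" for x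
    by (simp_all add: bits_small_2 del: One_nat_def)
  have lt: "P div b * (4 * b) < 2 ^ w" "oDir + P div b * (4 * b) < 2 ^ w" "P < 2 ^ w"
    "oV + (P - P mod b) < 2 ^ w" "bits_at D (oV + (P - P mod b)) (P mod b) * b < 2 ^ w"
    "oPop + bits_at D (oV + (P - P mod b)) (P mod b) * b < 2 ^ w" "rk P < 2 ^ w"
    by (rule small_less, (rule P sm smalls)+, simp)+
  have min: "min (4 * b) w = 4 * b" "min b w = b" "min (P mod b) w = P mod b"
    using widths(1) \<open>P mod b \<le> b\<close> by auto
  show ?thesis
    using assms rank[OF assms(3)] lt unfolding rank_code_def env_def
    by (simp add: eval_add eval_mul eval_sub min del: eval_op.simps(1-3))
qed

lemma env_upd [simp]:
  "1 < a \<Longrightarrow> a \<noteq> 7 \<Longrightarrow> a < 10 \<or> 34 < a \<Longrightarrow> env l r (M(a := v)) = env l r M"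
proof -
  assume "1 < a" "a \<noteq> 7" "a < 10 \<or> 34 < a"
  then have "(M(a := v)) k = M k" if "k < 2 \<or> k = 7 \<or> 10 \<le> k \<and> k \<le> 34" for k
    using that by auto
  then show ?thesis unfolding env_def by (simp del: fun_upd_apply)
qed

lemma env_cells:
  assumes "env l r M"
  shows "M 0 = l" "M 1 = r" "M (Suc 0) = r" "M 7 = 0" "M 10 = b" "M 11 = 4 * b" "M 12 = Lv" "M 13 = V2"
    "M 14 = oV" "M 15 = oDir" "M 16 = oSuc" "M 17 = oPop" "M 18 = oCtz" "M 19 = oRes" "M 20 = xw"
    "M 21 = X" "M 22 = 2 * X" "M 23 = h" "M 24 = DD" "M 25 = NB" "M 26 = PL" "M 27 = K1"
    "M 28 = oLoc" "M 29 = om" "M 30 = g" "M 31 = 1" "M 32 = 2" "M 33 = 3" "M 34 = 128"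
  using assms by (simp_all add: env_def)

end

text \<open>The data of a single query. \<open>F0\<close> and \<open>Fv\<close> stand for the values
  of \<open>F\<close> at the start of the cell and at \<open>r1\<close>, \<open>rd\<close> for the
  words from address \<open>LB\<close> on, \<open>i0\<close> for the lowest stored level, and
  \<open>f\<close> for the frequency sought.\<close>

locale query_run = query_data +
  fixes l r r1 u be F0 LB z i0 Fv f ans k1 k2 W :: nat and rd :: "nat \<Rightarrow> nat"
  assumes lr: "l \<le> Z" "r1 \<le> Z" "r1 = r + 1" "l < Lv" "r1 < Lv"
    and cell: "u = l div g" "be = r1 div X" "z = X + r1 mod X" "V2 + (u * NB + be) \<le> VL"
      "rk (V2 + u * NB) \<le> rk (V2 + (u * NB + be))"
      "F0 = (rk (V2 + (u * NB + be)) - rk (V2 + u * NB)) * X + bits_at D (oRes + (u * NB + be) * xw) xw"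
      "LB = oLoc + (u * PL + be * 128 + F0 * K1) * om"
      "rd = (\<lambda>k. bits_at D (LB + k * om) om)"
    and trie: "2 ^ W = 2 * X" "i0 \<le> DD" "DD < 2 ^ k1" "F0 \<le> Fv"
      "\<And>i. i \<le> DD \<Longrightarrow> rd (dict_slot W rd (z div 2 ^ (h * i))) = z div 2 ^ (h * i) \<longleftrightarrow> i0 \<le> i"
      "rd (dict_slot W rd (z div 2 ^ (h * i0)) + 1) = Fv - F0" "i0 = DD \<Longrightarrow> Fv = F0"
    and freq: "f \<le> Fv" "Fv < f + g" "0 < f" "Fv \<le> m" "m \<le> Z" "g < 2 ^ k2"
      "\<And>q. 0 < q \<Longrightarrow> q \<le> m \<Longrightarrow> rk (2 * q * Lv + l) < rk (2 * q * Lv + Lv + r1) \<longleftrightarrow> q \<le> f"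
      "\<And>q. q \<le> m \<Longrightarrow> 2 * q * Lv + Lv + Lv \<le> VL"
    and answer: "ans = (let P = 2 * f * Lv + l; v = bits_at D (oV + P) (b - P mod b) in
        if v = 0 then bits_at D (oSuc + P div b * (4 * b)) (4 * b) else l + bits_at D (oCtz + v * b) b)"
      "ans < n"
begin

lemma more_smalls: "small Z 1 l" "small Z 1 r1" "small Z 1 r" "small Z 1 u" "small Z 1 be" "small Z 2 z"
  "small Z 7 LB" "small Z 3 F0" "small Z 1 (rd k)" "small Z 1 m"
proof -
  show lr': "small Z 1 l" "small Z 1 r1" "small Z 1 r" "small Z 1 m"
    by (rule small_1, use lr freq(5) in simp)+
  show ub: "small Z 1 u" "small Z 1 be" "small Z 1 (rd k)"
    unfolding cell(1,2,8) by (rule lr' smalls)+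
  have "small Z (Suc (max 1 1)) z" unfolding cell(3) by (rule lr' smalls)+
  then show "small Z 2 z" by (simp add: numeral_2_eq_2)
  show F0: "small Z 3 F0"
    unfolding cell(6) by (rule small_mono, (rule smalls)+) (use Z2 in simp_all)
  show "small Z 7 LB"
    unfolding cell(7) by (rule small_mono, (rule ub F0 smalls)+) (use Z2 in simp_all)
qed

section \<open>Correctness of the stages of a query\<close>

definition cell_entered :: "(nat \<Rightarrow> nat) \<Rightarrow> bool" where
  "cell_entered M \<longleftrightarrow> env l r M \<and> M 50 = r1 \<and> M 62 = F0 \<and> M 63 = LB \<and> M 64 = z \<and> M 65 = rd 0 \<and> M 66 = rd 1"

lemma min_widths: "min (4 * b) w = 4 * b" "min b w = b" "min xw w = xw" "min om w = om"
  using widths by auto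

lemma does_enter_cell:
  assumes "env l r M"
  shows "does w Sc D enter_cell M 52 (\<lambda>M. cell_entered M \<and> M 67 = 0 \<and> M 68 = DD \<and> M 69 = 0)"
proof -
  define I where "I = u * NB + be"
  have I: "V2 + I \<le> VL" "V2 + u * NB \<le> VL" using cell(4) by (simp_all add: I_def)
  define B1 where "B1 M \<longleftrightarrow> env l r M \<and> M 50 = r1 \<and> M 51 = u \<and> M 52 = be \<and> M 53 = r1 mod X \<and>
    M 55 = I \<and> M 58 = rk (V2 + I) \<and> M 59 = rk (V2 + u * NB)" for M
  have s: "u * NB < 2 ^ w" "V2 + I < 2 ^ w" "V2 + u * NB < 2 ^ w" "I < 2 ^ w" "r1 < 2 ^ w"
    by (rule small_less, (unfold I_def)?, (rule more_smalls smalls)+, simp)+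
  have 1: "does w Sc D (Block ([Op Add 50 1 31, Op Div 51 0 30, Op Div 52 50 21, Op Mod 53 50 21,
       Op Mul 54 51 25, Op Add 55 54 52, Op Add 56 13 55, Op Add 57 13 54] @
       rank_code 58 56 @ rank_code 59 57)) M 32 B1"
  proof -
    let ?xs = "[Op Add 50 1 31, Op Div 51 0 30, Op Div 52 50 21, Op Mod 53 50 21,
       Op Mul 54 51 25, Op Add 55 54 52, Op Add 56 13 55, Op Add 57 13 54]"
    define M1 where "M1 = M(50 := r1, 51 := u, 52 := be, 53 := r1 mod X, 54 := u * NB, 55 := I, 56 := V2 + I, 57 := V2 + u * NB)"
    have "fold (eff w Sc D) ?xs M = M1"
      using s unfolding M1_def I_def
      by (simp add: env_cells[OF assms] eval_add eval_mul lr(3) cell(1,2) del: eval_op.simps(1-3))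
    moreover have e1: "env l r M1" using assms by (simp add: M1_def)
    define M2 where "M2 = fold (eff w Sc D) (rank_code 58 56) M1"
    have M2: "M2 = M1(40 := (V2 + I) div b, 41 := (V2 + I) mod b, 42 := M2 42, 43 := M2 43, 58 := rk (V2 + I))"
      using rank_code_effect[OF e1, of 56 "V2 + I" 58] I(1) by (simp add: M2_def M1_def)
    have e2: "env l r M2" by (subst M2) (simp add: e1)
    have M2': "M2 50 = r1" "M2 51 = u" "M2 52 = be" "M2 53 = r1 mod X" "M2 55 = I" "M2 57 = V2 + u * NB" "M2 58 = rk (V2 + I)"
      by (subst M2, simp add: M1_def)+
    have "B1 (fold (eff w Sc D) (rank_code 59 57) M2)"
      unfolding B1_def using rank_code_effect[OF e2 M2'(6) I(2), of 59] e2 M2' by simp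
    ultimately have fin: "B1 (fold (eff w Sc D) (?xs @ rank_code 58 56 @ rank_code 59 57) M)"
      by (simp add: M2_def)
    show ?thesis
      by (rule does_Block[where Q = B1, OF _ fin]) (auto simp: rank_code_def)
  qed
  define B2 where "B2 M \<longleftrightarrow> env l r M \<and> M 50 = r1 \<and> M 51 = u \<and> M 52 = be \<and> M 53 = r1 mod X \<and> M 62 = F0" for M
  have 2: "does w Sc D (Block [Op Sub 60 58 59, Op Mul 60 60 21, Op Mul 61 55 20, Op Add 61 19 61,
       Read_Bits 61 61 20, Op Add 62 60 61]) M 6 B2" if M: "B1 M" for M
  proof -
    have e: "env l r M" using M by (simp add: B1_def)
    have s: "rk (V2 + I) < 2 ^ w" "(rk (V2 + I) - rk (V2 + u * NB)) * X < 2 ^ w" "I * xw < 2 ^ w"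
      "oRes + I * xw < 2 ^ w" "(rk (V2 + I) - rk (V2 + u * NB)) * X + bits_at D (oRes + I * xw) xw < 2 ^ w"
      by (rule small_less, (unfold I_def)?, (rule more_smalls smalls)+, simp)+
    have fin: "B2 (fold (eff w Sc D) [Op Sub 60 58 59, Op Mul 60 60 21, Op Mul 61 55 20, Op Add 61 19 61,
       Read_Bits 61 61 20, Op Add 62 60 61] M)"
      using M e s cell(5) unfolding B1_def B2_def cell(6) I_def[symmetric]
      by (simp add: env_cells[OF e] eval_add eval_mul eval_sub min_widths del: eval_op.simps(1-3))
    show ?thesis by (rule does_Block[where Q = B2, OF _ fin]) simp_all
  qed
  have 3: "does w Sc D (Block [Op Mul 63 51 26, Op Mul 64 52 34, Op Mul 65 62 27, Op Add 63 63 64, Op Add 63 63 65,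
       Op Mul 63 63 29, Op Add 63 28 63, Op Add 64 21 53, Read_Bits 65 63 29,
       Op Add 66 63 29, Read_Bits 66 66 29, Op Add 67 7 7, Op Add 68 24 7, Op Add 69 7 7]) M 14
     (\<lambda>M. cell_entered M \<and> M 67 = 0 \<and> M 68 = DD \<and> M 69 = 0)" if M: "B2 M" for M
  proof -
    have e: "env l r M" using M by (simp add: B2_def)
    have rd: "rd 0 = bits_at D LB om" "rd (Suc 0) = bits_at D (LB + om) om" by (simp_all add: cell(8))
    have s: "u * PL < 2 ^ w" "be * 128 < 2 ^ w" "F0 * K1 < 2 ^ w" "u * PL + be * 128 < 2 ^ w"
      "u * PL + be * 128 + F0 * K1 < 2 ^ w" "(u * PL + be * 128 + F0 * K1) * om < 2 ^ w"
      "LB < 2 ^ w" "LB + om < 2 ^ w" "z < 2 ^ w" "DD < 2 ^ w"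
      by (rule small_less, (rule more_smalls smalls)+, simp)+
    have "cell_entered M' \<and> M' 67 = 0 \<and> M' 68 = DD \<and> M' 69 = 0"
      if "M' = fold (eff w Sc D) [Op Mul 63 51 26, Op Mul 64 52 34, Op Mul 65 62 27, Op Add 63 63 64, Op Add 63 63 65,
       Op Mul 63 63 29, Op Add 63 28 63, Op Add 64 21 53, Read_Bits 65 63 29,
       Op Add 66 63 29, Read_Bits 66 66 29, Op Add 67 7 7, Op Add 68 24 7, Op Add 69 7 7] M" for M'
      using M e s rd unfolding B2_def cell_entered_def that
      by (simp add: env_cells[OF e] eval_add eval_mul eval_sub min_widths cell(3)[symmetric] cell(7)[symmetric]
        del: eval_op.simps(1-3))
    from this[OF refl] show ?thesis
      by (rule does_Block[where Q = "\<lambda>M. cell_entered M \<and> M 67 = 0 \<and> M 68 = DD \<and> M 69 = 0", rotated]) simp_all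
  qed
  show ?thesis
    using does_Seq[OF 1 does_Seq[OF 2 3]] unfolding enter_cell_def by simp
qed

lemma cell_entered_upd [simp]: "66 < a \<Longrightarrow> cell_entered (M(a := v)) = cell_entered M"
  unfolding cell_entered_def by simp

lemma cell_entered_cells:
  assumes "cell_entered M"
  shows "M 50 = r1" "M 62 = F0" "M 63 = LB" "M 64 = z" "M 65 = rd 0" "M 66 = rd 1"
  using assms unfolding cell_entered_def by simp_all

text \<open>The fetched value has to be right only once the upper end is \<open>i0\<close>; values
  from higher levels may be meaningless. A width below \<open>2 ^ k\<close> leaves at most
  \<open>k\<close> halvings.\<close>

definition trie_inv :: "nat \<Rightarrow> (nat \<Rightarrow> nat) \<Rightarrow> bool" where
  "trie_inv k M \<longleftrightarrow> cell_entered M \<and> M 67 \<le> i0 \<and> i0 \<le> M 68 \<and> M 68 \<le> DD \<and> M 68 - M 67 < 2 ^ k \<and>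
     (M 68 = i0 \<longrightarrow> F0 + M 69 = Fv)"

lemma does_trie_body:
  assumes "trie_inv k M" "M 67 < M 68"
  shows "does w Sc D
     (Block [Op Add 70 67 68, Op Div 70 70 32, Op Mul 71 23 70, Op Shr 71 64 71,
        Op Mul 72 65 71, Op Mod 72 72 22, Op Shr 72 72 66] ;;
      Block [Op Mul 72 72 33, Op Add 72 72 32, Op Mul 72 72 29, Op Add 72 63 72,
        Read_Bits 73 72 29, Op Add 72 72 29, Read_Bits 74 72 29, Op Add 72 72 29,
        Read_Bits 75 72 29] ;;
      Block [Op Mul 76 73 71, Op Mod 76 76 22, Op Shr 76 76 74, Op Mul 76 76 32,
        Op Add 76 75 76, Op Mul 76 76 29, Op Add 76 63 76, Read_Bits 77 76 29] ;;
      If_Eq 77 71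
        (Block [Op Add 76 76 29, Read_Bits 69 76 29, Op Add 68 70 7])
        (Block [Op Add 67 70 31])) M 29 (trie_inv (k - 1))"
proof -
  define lo hi where "lo = M 67" and "hi = M 68"
  define mid where "mid = (lo + hi) div 2"
  have lohi: "cell_entered M" "lo \<le> i0" "i0 \<le> hi" "hi \<le> DD" "hi - lo < 2 ^ k" "lo < hi"
    using assms by (simp_all add: trie_inv_def lo_def hi_def)
  have k: "k > 0" using lohi(5,6) by (intro Suc_leI gr0I) auto
  then have k2: "(2::nat) ^ k = 2 * 2 ^ (k - 1)" by (simp flip: power_Suc)
  have mid: "lo \<le> mid" "mid < hi" "mid - lo < 2 ^ (k - 1)" "hi - (mid + 1) < 2 ^ (k - 1)" "mid \<le> DD"
    using lohi(4-6) k2 unfolding mid_def by linarith+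
  define key where "key = z div 2 ^ (h * mid)"
  define i1 where "i1 = hash W (rd 1) (rd 0) key"
  define sl where "sl = dict_slot W rd key"
  have i1: "i1 = (rd 0 * key mod (2 * X)) div 2 ^ rd (Suc 0)" by (simp add: i1_def hash_def trie(1))
  have p: "2 + 3 * hash W (rd 1) (rd 0) key = i1 * 3 + 2" by (simp add: i1_def)
  have sl: "sl = rd (i1 * 3 + 2 + 2) + (rd (i1 * 3 + 2) * key mod (2 * X)) div 2 ^ rd (i1 * 3 + 2 + 1) * 2"
    unfolding sl_def dict_slot_def Let_def p hash_def[of W "rd (i1 * 3 + 2 + 1)"] trie(1)
    by (simp only: mult.commute[of 2 "_ div _"])
  have sm: "small Z 1 lo" "small Z 1 hi" "small Z 1 mid"
    using lohi mid header_small(15) by (auto intro!: small_1 simp del: One_nat_def)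
  have smk: "small Z 2 key" unfolding key_def by (rule more_smalls smalls)+
  have smi: "small Z 3 i1" unfolding i1 by (rule small_mono, (rule smk more_smalls smalls)+) (use Z2 in simp_all)
  have sms: "small Z 5 sl" unfolding sl by (rule small_mono, (rule smk more_smalls smalls)+) (use Z2 in simp_all)
  define val where "val = M 69"
  have val: "hi = i0 \<Longrightarrow> F0 + val = Fv" using assms(1) by (simp add: trie_inv_def hi_def val_def)
  define C1 where "C1 M \<longleftrightarrow> cell_entered M \<and> M 67 = lo \<and> M 68 = hi \<and> M 69 = val \<and> M 70 = mid \<and> M 71 = key" for M
  note del_eval = eval_op.simps(1-3)
  have 1: "does w Sc D (Block [Op Add 70 67 68, Op Div 70 70 32, Op Mul 71 23 70, Op Shr 71 64 71,
        Op Mul 72 65 71, Op Mod 72 72 22, Op Shr 72 72 66]) M 7 (\<lambda>M. C1 M \<and> M 72 = i1)"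
  proof -
    have e: "env l r M" using lohi(1) by (simp add: cell_entered_def)
    have s: "lo + hi < 2 ^ w" "h * mid < 2 ^ w" "rd 0 * key < 2 ^ w"
      by (rule small_less, (rule sm smk more_smalls smalls)+, simp)+
    have fin: "C1 (fold (eff w Sc D) [Op Add 70 67 68, Op Div 70 70 32, Op Mul 71 23 70, Op Shr 71 64 71,
        Op Mul 72 65 71, Op Mod 72 72 22, Op Shr 72 72 66] M) \<and>
        fold (eff w Sc D) [Op Add 70 67 68, Op Div 70 70 32, Op Mul 71 23 70, Op Shr 71 64 71,
        Op Mul 72 65 71, Op Mod 72 72 22, Op Shr 72 72 66] M 72 = i1"
      using s lohi(1) unfolding C1_def i1 val_def
      by (simp add: env_cells[OF e] cell_entered_cells[OF lohi(1)] lo_def[symmetric] hi_def[symmetric]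
        mid_def[symmetric] key_def[symmetric] eval_add eval_mul del: del_eval)
    show ?thesis by (rule does_Block[where Q = "\<lambda>M. C1 M \<and> M 72 = i1", OF _ fin]) simp_all
  qed
  have 2: "does w Sc D (Block [Op Mul 72 72 33, Op Add 72 72 32, Op Mul 72 72 29, Op Add 72 63 72,
        Read_Bits 73 72 29, Op Add 72 72 29, Read_Bits 74 72 29, Op Add 72 72 29,
        Read_Bits 75 72 29]) M 9 (\<lambda>M. C1 M \<and> M 73 = rd (i1 * 3 + 2) \<and> M 74 = rd (i1 * 3 + 2 + 1) \<and> M 75 = rd (i1 * 3 + 2 + 2))"
    if M: "C1 M \<and> M 72 = i1" for M
  proof -
    have c: "cell_entered M" using M by (simp add: C1_def)
    then have e: "env l r M" by (simp add: cell_entered_def)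
    define p where "p = LB + (i1 * 3 + 2) * om"
    have s: "i1 * 3 < 2 ^ w" "i1 * 3 + 2 < 2 ^ w" "(i1 * 3 + 2) * om < 2 ^ w" "p < 2 ^ w" "p + om < 2 ^ w" "p + om + om < 2 ^ w"
      unfolding p_def by (rule small_less, (rule smi more_smalls smalls)+, simp)+
    have rds: "rd (i1 * 3 + 2) = bits_at D p om" "rd (i1 * 3 + 2 + 1) = bits_at D (p + om) om"
      "rd (i1 * 3 + 2 + 2) = bits_at D (p + om + om) om"
      by (simp_all add: cell(8) p_def algebra_simps)
    have p': "LB + (2 * om + i1 * 3 * om) = p" by (simp add: p_def algebra_simps)
    have fin: "C1 M' \<and> M' 73 = bits_at D p om \<and> M' 74 = bits_at D (p + om) om \<and> M' 75 = bits_at D (p + om + om) om"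
      if "M' = fold (eff w Sc D) [Op Mul 72 72 33, Op Add 72 72 32, Op Mul 72 72 29, Op Add 72 63 72,
        Read_Bits 73 72 29, Op Add 72 72 29, Read_Bits 74 72 29, Op Add 72 72 29,
        Read_Bits 75 72 29] M" for M'
      using s M unfolding C1_def that
      by (simp add: env_cells[OF e] cell_entered_cells[OF c] eval_add eval_mul min_widths p' del: del_eval)
    show ?thesis unfolding rds
      by (rule does_Block[where Q = "\<lambda>M. C1 M \<and> M 73 = bits_at D p om \<and> M 74 = bits_at D (p + om) om \<and>
        M 75 = bits_at D (p + om + om) om", OF _ fin[OF refl]]) simp_all
  qed
  have 3: "does w Sc D (Block [Op Mul 76 73 71, Op Mod 76 76 22, Op Shr 76 76 74, Op Mul 76 76 32,
        Op Add 76 75 76, Op Mul 76 76 29, Op Add 76 63 76, Read_Bits 77 76 29]) M 8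
      (\<lambda>M. C1 M \<and> M 76 = LB + sl * om \<and> M 77 = rd sl)"
    if M: "C1 M \<and> M 73 = rd (i1 * 3 + 2) \<and> M 74 = rd (i1 * 3 + 2 + 1) \<and> M 75 = rd (i1 * 3 + 2 + 2)" for M
  proof -
    have c: "cell_entered M" using M by (simp add: C1_def)
    then have e: "env l r M" by (simp add: cell_entered_def)
    define x1 x2 x3 where "x1 = rd (i1 * 3 + 2)" and "x2 = rd (i1 * 3 + 2 + 1)" and "x3 = rd (i1 * 3 + 2 + 2)"
    have xs: "small Z 1 x1" "small Z 1 x2" "small Z 1 x3" by (simp_all only: x1_def x2_def x3_def more_smalls)
    have sl': "sl = x3 + x1 * key mod (2 * X) div 2 ^ x2 * 2" by (simp only: sl x1_def x2_def x3_def)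
    have s: "x1 * key < 2 ^ w" "(x1 * key mod (2 * X)) div 2 ^ x2 * 2 < 2 ^ w" "sl < 2 ^ w" "sl * om < 2 ^ w" "LB + sl * om < 2 ^ w"
      by (rule small_less, (rule xs smk sms more_smalls smalls)+, simp)+
    have rds: "rd sl = bits_at D (LB + sl * om) om"
      by (simp add: cell(8))
    have fin: "C1 M' \<and> M' 76 = LB + sl * om \<and> M' 77 = bits_at D (LB + sl * om) om"
      if "M' = fold (eff w Sc D) [Op Mul 76 73 71, Op Mod 76 76 22, Op Shr 76 76 74, Op Mul 76 76 32,
        Op Add 76 75 76, Op Mul 76 76 29, Op Add 76 63 76, Read_Bits 77 76 29] M" for M'
      using s M[folded x1_def x2_def x3_def] unfolding C1_def that
      by (simp add: env_cells[OF e] cell_entered_cells[OF c] eval_add eval_mul min_widths sl'[symmetric] del: del_eval)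
    show ?thesis unfolding rds
      by (rule does_Block[where Q = "\<lambda>M. C1 M \<and> M 76 = LB + sl * om \<and> M 77 = bits_at D (LB + sl * om) om", OF _ fin[OF refl]]) simp_all
  qed
  have 4: "does w Sc D (If_Eq 77 71
        (Block [Op Add 76 76 29, Read_Bits 69 76 29, Op Add 68 70 7])
        (Block [Op Add 67 70 31])) M (3 + 2) (trie_inv (k - 1))"
    if M: "C1 M \<and> M 76 = LB + sl * om \<and> M 77 = rd sl" for M
  proof (rule does_If_Eq)
    have c: "cell_entered M" using M by (simp add: C1_def)
    then have e: "env l r M" by (simp add: cell_entered_def)
    have found: "rd sl = key \<longleftrightarrow> i0 \<le> mid"
      using trie(5)[OF mid(5)] by (simp add: sl_def key_def)
    {
      assume "M 77 = M 71"
      then have i0: "i0 \<le> mid" using found M by (simp add: C1_def)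
      have s: "LB + sl * om + om < 2 ^ w" "mid < 2 ^ w"
        by (rule small_less, (rule sm sms more_smalls smalls)+, simp)+
      have rds: "rd (sl + 1) = bits_at D (LB + sl * om + om) om" by (simp add: cell(8) algebra_simps)
      have val': "F0 + rd (sl + 1) = Fv" if "mid = i0"
        using trie(4,6) that by (simp add: sl_def key_def)
      have fin: "trie_inv (k - 1) M'" if "M' = fold (eff w Sc D) [Op Add 76 76 29, Read_Bits 69 76 29, Op Add 68 70 7] M" for M'
      proof -
        have "M' = M(76 := LB + sl * om + om, 69 := rd (sl + 1), 68 := mid)"
          using s M unfolding that rds C1_def by (simp add: env_cells[OF e] eval_add min_widths del: del_eval)
        then show ?thesis
          using M c lohi(2) i0 mid val' unfolding trie_inv_def C1_def by simp
      qed
      show "does w Sc D (Block [Op Add 76 76 29, Read_Bits 69 76 29, Op Add 68 70 7]) M 3 (trie_inv (k - 1))"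
        by (rule does_Block[where Q = "trie_inv (k - 1)", OF _ fin[OF refl]]) simp_all
    next
      assume "M 77 \<noteq> M 71"
      then have i0: "mid < i0" using found M by (simp add: C1_def)
      have s: "mid + 1 < 2 ^ w"
        by (rule small_less, (rule sm more_smalls smalls)+, simp)+
      have fin: "trie_inv (k - 1) M'" if "M' = fold (eff w Sc D) [Op Add 67 70 31] M" for M'
      proof -
        have "M' = M(67 := mid + 1)"
          using s M unfolding that C1_def by (simp add: env_cells[OF e] eval_add del: del_eval)
        moreover have "hi = i0 \<longrightarrow> F0 + M 69 = Fv" using val M by (simp add: C1_def)
        ultimately show ?thesis
          using M c lohi i0 mid unfolding trie_inv_def C1_def by simp
      qed
      show "does w Sc D (Block [Op Add 67 70 31]) M 3 (trie_inv (k - 1))"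
        by (rule does_Block[where Q = "trie_inv (k - 1)", OF _ fin[OF refl]]) simp_all
    }
  qed
  show ?thesis
    by (rule does_mono[OF does_Seq[OF 1 does_Seq[OF 2 does_Seq[OF 3 4]]]]) simp_all
qed

definition located :: "(nat \<Rightarrow> nat) \<Rightarrow> bool" where
  "located M \<longleftrightarrow> env l r M \<and> M 50 = r1 \<and> M 62 + M 69 = Fv \<and> M 62 + M 69 < 2 ^ w"

lemma does_trie_search:
  assumes "cell_entered M \<and> M 67 = 0 \<and> M 68 = DD \<and> M 69 = 0"
  shows "does w Sc D trie_search M (k1 * (29 + 2) + 2) located"
  unfolding trie_search_def
proof (rule does_While_Less[where Inv = trie_inv])
  show "trie_inv k1 M"
    using assms trie(2,3,7) unfolding trie_inv_def by auto
next
  fix k M assume inv: "trie_inv k M" "M 67 < M 68"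
  have "k > 0" using inv by (cases k) (auto simp: trie_inv_def)
  then show "0 < k \<and> does w Sc D
     (Block [Op Add 70 67 68, Op Div 70 70 32, Op Mul 71 23 70, Op Shr 71 64 71,
        Op Mul 72 65 71, Op Mod 72 72 22, Op Shr 72 72 66] ;;
      Block [Op Mul 72 72 33, Op Add 72 72 32, Op Mul 72 72 29, Op Add 72 63 72,
        Read_Bits 73 72 29, Op Add 72 72 29, Read_Bits 74 72 29, Op Add 72 72 29,
        Read_Bits 75 72 29] ;;
      Block [Op Mul 76 73 71, Op Mod 76 76 22, Op Shr 76 76 74, Op Mul 76 76 32,
        Op Add 76 75 76, Op Mul 76 76 29, Op Add 76 63 76, Read_Bits 77 76 29] ;;
      If_Eq 77 71
        (Block [Op Add 76 76 29, Read_Bits 69 76 29, Op Add 68 70 7])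
        (Block [Op Add 67 70 31])) M 29 (trie_inv (k - 1))"
    using does_trie_body[OF inv] by blast
next
  fix k M assume inv: "trie_inv k M" "\<not> M 67 < M 68"
  then have M: "cell_entered M" "F0 + M 69 = Fv" by (auto simp: trie_inv_def)
  have "Fv < 2 ^ w" using small_less[of 1 Fv] small_1[of Fv] freq(4,5) by simp
  then show "located M" using M by (simp add: located_def cell_entered_def)
qed

text \<open>A half-open window, so width \<open>2 ^ 0\<close> leaves one candidate. Cell 69 carries
  the lower end plus 1 because the loop has to stop when the ends are adjacent.\<close>

definition freq_inv :: "nat \<Rightarrow> (nat \<Rightarrow> nat) \<Rightarrow> bool" where
  "freq_inv k M \<longleftrightarrow> env l r M \<and> M 50 = r1 \<and> M 67 \<le> f \<and> f < M 68 \<and> M 68 \<le> m + 1 \<and>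
     M 69 = M 67 + 1 \<and> M 68 - M 67 \<le> 2 ^ k"

lemma does_freq_body:
  assumes "freq_inv k M" "M 69 < M 68"
  shows "does w Sc D
     (Block ([Op Add 70 67 68, Op Div 70 70 32, Op Mul 71 32 70, Op Mul 71 71 12, Op Add 72 71 12,
          Op Add 71 71 0, Op Add 72 72 50] @ rank_code 73 71 @ rank_code 74 72) ;;
      If_Less 73 74
          (Block [Op Add 67 70 7, Op Add 69 70 31])
          (Block [Op Add 68 70 7])) M 35 (freq_inv (k - 1))"
proof -
  define lo hi where "lo = M 67" and "hi = M 68"
  define mid where "mid = (lo + hi) div 2"
  have lohi: "env l r M" "M 50 = r1" "lo \<le> f" "f < hi" "hi \<le> m + 1" "hi - lo \<le> 2 ^ k" "lo + 1 < hi"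
    using assms by (simp_all add: freq_inv_def lo_def hi_def)
  have k: "k > 0" using lohi(6,7) by (intro gr0I) auto
  then have k2: "(2::nat) ^ k = 2 * 2 ^ (k - 1)" by (simp flip: power_Suc)
  have mid: "lo < mid" "mid < hi" "mid - lo \<le> 2 ^ (k - 1)" "hi - mid \<le> 2 ^ (k - 1)" "mid \<le> m" "0 < mid"
    using lohi(5-7) k2 unfolding mid_def by linarith+
  have sm: "small Z 1 mid" "small Z 2 lo" "small Z 2 hi"
  proof -
    show "small Z 1 mid" using mid(5) freq(5) by (intro small_1) simp
    have "small Z (Suc (max 1 1)) (m + 1)" by (rule more_smalls smalls)+
    then show "small Z 2 lo" "small Z 2 hi"
      using lohi(5,7) by (auto elim!: small_le simp: numeral_2_eq_2)
  qed
  define P1 P2 where "P1 = 2 * mid * Lv + l" and "P2 = 2 * mid * Lv + Lv + r1"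
  have PVL: "P1 \<le> VL" "P2 \<le> VL" using freq(8)[OF mid(5)] lr(4,5) by (simp_all add: P1_def P2_def)
  have test: "rk P1 < rk P2 \<longleftrightarrow> mid \<le> f"
    unfolding P1_def P2_def using freq(7)[OF mid(6,5)] .
  define C1 where "C1 M \<longleftrightarrow> env l r M \<and> M 50 = r1 \<and> M 67 = lo \<and> M 68 = hi \<and> M 69 = lo + 1 \<and> M 70 = mid" for M
  have 1: "does w Sc D (Block ([Op Add 70 67 68, Op Div 70 70 32, Op Mul 71 32 70, Op Mul 71 71 12, Op Add 72 71 12,
          Op Add 71 71 0, Op Add 72 72 50] @ rank_code 73 71 @ rank_code 74 72)) M 31
       (\<lambda>M. C1 M \<and> M 73 = rk P1 \<and> M 74 = rk P2)"
  proof -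
    let ?xs = "[Op Add 70 67 68, Op Div 70 70 32, Op Mul 71 32 70, Op Mul 71 71 12, Op Add 72 71 12,
          Op Add 71 71 0, Op Add 72 72 50]"
    have s: "lo + hi < 2 ^ w" "2 * mid < 2 ^ w" "2 * mid * Lv < 2 ^ w" "2 * mid * Lv + Lv < 2 ^ w" "P1 < 2 ^ w" "P2 < 2 ^ w"
      unfolding P1_def P2_def by (rule small_less, (rule sm more_smalls smalls)+, simp)+
    define M1 where "M1 = fold (eff w Sc D) ?xs M"
    have M1: "env l r M1" "M1 71 = P1" "M1 72 = P2" "C1 M1"
      using s lohi(1,2) assms(1) unfolding M1_def C1_def P1_def P2_def freq_inv_def
      by (simp_all add: env_cells[OF lohi(1)] eval_add eval_mul lo_def[symmetric] hi_def[symmetric] mid_def[symmetric]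
        del: eval_op.simps(1-3))
    define M2 where "M2 = fold (eff w Sc D) (rank_code 73 71) M1"
    have M2: "M2 = M1(40 := P1 div b, 41 := P1 mod b, 42 := M2 42, 43 := M2 43, 73 := rk P1)"
      using rank_code_effect[OF M1(1,2) PVL(1), of 73] by (simp add: M2_def)
    have C2: "C1 M2" "M2 72 = P2" "M2 73 = rk P1"
      by (subst M2, use M1 in \<open>simp add: C1_def\<close>)+
    have e2: "env l r M2" using C2(1) by (simp add: C1_def)
    have "C1 (fold (eff w Sc D) (rank_code 74 72) M2) \<and> fold (eff w Sc D) (rank_code 74 72) M2 73 = rk P1 \<and>
       fold (eff w Sc D) (rank_code 74 72) M2 74 = rk P2"
      using rank_code_effect[OF e2 C2(2) PVL(2), of 74] C2 by (simp add: C1_def)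
    then have fin: "C1 (fold (eff w Sc D) (?xs @ rank_code 73 71 @ rank_code 74 72) M) \<and>
       fold (eff w Sc D) (?xs @ rank_code 73 71 @ rank_code 74 72) M 73 = rk P1 \<and>
       fold (eff w Sc D) (?xs @ rank_code 73 71 @ rank_code 74 72) M 74 = rk P2"
      unfolding fold_append comp_apply M1_def[symmetric] M2_def[symmetric] .
    show ?thesis
      by (rule does_Block[where Q = "\<lambda>M. C1 M \<and> M 73 = rk P1 \<and> M 74 = rk P2", OF _ fin]) (auto simp: rank_code_def)
  qed
  have 2: "does w Sc D (If_Less 73 74
          (Block [Op Add 67 70 7, Op Add 69 70 31])
          (Block [Op Add 68 70 7])) M (2 + 2) (freq_inv (k - 1))"
    if M: "C1 M \<and> M 73 = rk P1 \<and> M 74 = rk P2" for M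
  proof (rule does_If_Less)
    have e: "env l r M" using M by (simp add: C1_def)
    have s: "mid < 2 ^ w" "mid + 1 < 2 ^ w" by (rule small_less, (rule sm more_smalls smalls)+, simp)+
    {
      assume "M 73 < M 74"
      then have f: "mid \<le> f" using test M by simp
      have "fold (eff w Sc D) [Op Add 67 70 7, Op Add 69 70 31] M = M(67 := mid, 69 := mid + 1)"
        using s M unfolding C1_def by (simp add: env_cells[OF e] eval_add del: eval_op.simps(1-3))
      then have "freq_inv (k - 1) (fold (eff w Sc D) [Op Add 67 70 7, Op Add 69 70 31] M)"
        using M f lohi mid unfolding freq_inv_def C1_def by simp
      then show "does w Sc D (Block [Op Add 67 70 7, Op Add 69 70 31]) M 2 (freq_inv (k - 1))"
        by (rule does_Block[where Q = "freq_inv (k - 1)", rotated]) simp_all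
    next
      assume "\<not> M 73 < M 74"
      then have f: "f < mid" using test M by simp
      have "fold (eff w Sc D) [Op Add 68 70 7] M = M(68 := mid)"
        using s M unfolding C1_def by (simp add: env_cells[OF e] eval_add del: eval_op.simps(1-3))
      then have "freq_inv (k - 1) (fold (eff w Sc D) [Op Add 68 70 7] M)"
        using M f lohi mid unfolding freq_inv_def C1_def by simp
      then show "does w Sc D (Block [Op Add 68 70 7]) M 2 (freq_inv (k - 1))"
        by (rule does_Block[where Q = "freq_inv (k - 1)", rotated]) simp_all
    }
  qed
  show ?thesis
    by (rule does_mono[OF does_Seq[OF 1 2]]) simp_all
qed

lemma does_freq_search:
  assumes "located M"
  shows "does w Sc D freq_search M (k2 * (35 + 2) + 8) (\<lambda>M. env l r M \<and> M 67 = f)"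
proof -
  have sFv: "small Z 1 Fv" using freq(4,5) by (intro small_1) simp
  define C0 where "C0 M \<longleftrightarrow> env l r M \<and> M 50 = r1 \<and> M 70 = Fv \<and> M 68 = Fv + 1" for M
  have s: "Fv < 2 ^ w" "Fv + 1 < 2 ^ w" by (rule small_less, (rule sFv smalls)+, simp)+
  have 1: "does w Sc D (Block [Op Add 70 62 69, Op Add 68 70 31]) M 2 C0"
  proof -
    have e: "env l r M" using assms by (simp add: located_def)
    have "C0 (fold (eff w Sc D) [Op Add 70 62 69, Op Add 68 70 31] M)"
      using s assms unfolding C0_def located_def
      by (simp add: env_cells[OF e] eval_add del: eval_op.simps(1-3))
    then show ?thesis by (rule does_Block[where Q = C0, rotated]) simp_all
  qed
  define C1 where "C1 M \<longleftrightarrow> env l r M \<and> M 50 = r1 \<and> M 67 = Fv - g \<and> M 68 = Fv + 1" for M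
  \<comment> \<open>\<open>Sub\<close> wraps around modulo \<open>2 ^ w\<close>, so the program
    branches to obtain the truncated difference \<open>Fv - g\<close>.\<close>
  have 2: "does w Sc D (If_Less 70 30 (Block [Op Add 67 7 7]) (Block [Op Sub 67 70 30])) M (1 + 2) C1"
    if M: "C0 M" for M
  proof (rule does_If_Less)
    have e: "env l r M" using M by (simp add: C0_def)
    {
      assume "M 70 < M 30"
      then have "C1 (fold (eff w Sc D) [Op Add 67 7 7] M)"
        using M unfolding C1_def C0_def by (simp add: env_cells[OF e] eval_add del: eval_op.simps(1-3))
      then show "does w Sc D (Block [Op Add 67 7 7]) M 1 C1"
        by (rule does_Block[where Q = C1, rotated]) simp_all
    next
      assume "\<not> M 70 < M 30"
      then have "C1 (fold (eff w Sc D) [Op Sub 67 70 30] M)"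
        using M s unfolding C1_def C0_def by (simp add: env_cells[OF e] eval_sub del: eval_op.simps(1-3))
      then show "does w Sc D (Block [Op Sub 67 70 30]) M 1 C1"
        by (rule does_Block[where Q = C1, rotated]) simp_all
    }
  qed
  have 3: "does w Sc D (Block [Op Add 69 67 31]) M 1 (freq_inv k2)" if M: "C1 M" for M
  proof -
    have e: "env l r M" using M by (simp add: C1_def)
    have s': "Fv - g + 1 < 2 ^ w" using s(2) by simp
    have "fold (eff w Sc D) [Op Add 69 67 31] M = M(69 := Fv - g + 1)"
      using M s' unfolding C1_def by (simp add: env_cells[OF e] eval_add del: eval_op.simps(1-3))
    moreover have "Fv - g \<le> f" "Fv + 1 - (Fv - g) \<le> 2 ^ k2" using freq(2,6) by linarith+
    ultimately have "freq_inv k2 (fold (eff w Sc D) [Op Add 69 67 31] M)"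
      using M freq(1,4) unfolding freq_inv_def C1_def by simp
    then show ?thesis by (rule does_Block[where Q = "freq_inv k2", rotated]) simp_all
  qed
  have 4: "does w Sc D (While_Less 69 68
       (Block ([Op Add 70 67 68, Op Div 70 70 32, Op Mul 71 32 70, Op Mul 71 71 12, Op Add 72 71 12,
          Op Add 71 71 0, Op Add 72 72 50] @ rank_code 73 71 @ rank_code 74 72) ;;
        If_Less 73 74
          (Block [Op Add 67 70 7, Op Add 69 70 31])
          (Block [Op Add 68 70 7]))) M (k2 * (35 + 2) + 2) (\<lambda>M. env l r M \<and> M 67 = f)"
    if M: "freq_inv k2 M" for M
  proof (rule does_While_Less[where Inv = freq_inv, OF M])
    fix k M assume inv: "freq_inv k M" "M 69 < M 68"
    have "k > 0" using inv by (cases k) (auto simp: freq_inv_def)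
    then show "0 < k \<and> does w Sc D (Block ([Op Add 70 67 68, Op Div 70 70 32, Op Mul 71 32 70, Op Mul 71 71 12, Op Add 72 71 12,
          Op Add 71 71 0, Op Add 72 72 50] @ rank_code 73 71 @ rank_code 74 72) ;;
        If_Less 73 74
          (Block [Op Add 67 70 7, Op Add 69 70 31])
          (Block [Op Add 68 70 7])) M 35 (freq_inv (k - 1))"
      using does_freq_body[OF inv] by blast
  next
    fix k M assume "freq_inv k M" "\<not> M 69 < M 68"
    then show "env l r M \<and> M 67 = f" by (auto simp: freq_inv_def)
  qed
  show ?thesis
    unfolding freq_search_def
    by (rule does_mono[OF does_Seq[OF 1 does_Seq[OF 2 does_Seq[OF 3 4]]]]) simp_all
qed

lemma does_report:
  assumes "env l r M \<and> M 67 = f"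
  shows "does w Sc D report M 15 (\<lambda>M. M 0 = Sc ! ans)"
proof -
  note e = assms[THEN conjunct1]
  define P where "P = 2 * f * Lv + l"
  define v where "v = bits_at D (oV + P) (b - P mod b)"
  have fm: "f \<le> m" using freq(1,4) by simp
  have sf: "small Z 1 f" using fm freq(5) by (intro small_1) simp
  have sP: "small Z 1 P" using freq(8)[OF fm] lr(4) VL by (intro small_1) (simp add: P_def)
  have sv: "small Z 1 v" unfolding v_def by (rule bits_small_2) simp
  have sb: "small Z 1 (bits_at D x b)" for x by (rule bits_small_2) simp
  have Pb: "P mod b \<le> b" using pos(1) by (simp add: less_imp_le)
  have min: "min (b - P mod b) w = b - P mod b" using widths(1) by simp
  define C1 where "C1 M \<longleftrightarrow> env l r M \<and> M 71 = P div b \<and> M 73 = v" for M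
  have 1: "does w Sc D (Block [Op Mul 70 32 67, Op Mul 70 70 12, Op Add 70 70 0, Op Div 71 70 10, Op Mod 72 70 10,
       Op Sub 72 10 72, Op Add 73 14 70, Read_Bits 73 73 72]) M 8 C1"
  proof -
    have s: "2 * f < 2 ^ w" "2 * f * Lv < 2 ^ w" "P < 2 ^ w" "b < 2 ^ w" "oV + P < 2 ^ w"
      by (rule small_less, (rule sf sP more_smalls smalls)+, simp)+
    have "C1 (fold (eff w Sc D) [Op Mul 70 32 67, Op Mul 70 70 12, Op Add 70 70 0, Op Div 71 70 10, Op Mod 72 70 10,
       Op Sub 72 10 72, Op Add 73 14 70, Read_Bits 73 73 72] M)"
      using s assms Pb unfolding C1_def v_def
      by (simp add: env_cells[OF e] eval_add eval_mul eval_sub P_def[symmetric] min del: eval_op.simps(1-3))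
    then show ?thesis by (rule does_Block[where Q = C1, rotated]) simp_all
  qed
  have ans: "ans = (if v = 0 then bits_at D (oSuc + P div b * (4 * b)) (4 * b) else l + bits_at D (oCtz + v * b) b)"
    using answer(1) by (simp add: Let_def P_def[symmetric] v_def[symmetric])
  have 2: "does w Sc D (If_Eq 73 7
       (Block [Op Mul 71 71 11, Op Add 71 16 71, Read_Bits 74 71 11])
       (Block [Op Mul 73 73 10, Op Add 73 18 73, Read_Bits 73 73 10, Op Add 74 0 73])) M (4 + 2) (\<lambda>M. M 74 = ans)"
    if M: "C1 M" for M
  proof (rule does_If_Eq)
    have e: "env l r M" using M by (simp add: C1_def)
    {
      assume "M 73 = M 7"
      then have v0: "v = 0" using M by (simp add: C1_def env_cells[OF e])
      have s: "P div b * (4 * b) < 2 ^ w" "oSuc + P div b * (4 * b) < 2 ^ w"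
        by (rule small_less, (rule sP smalls)+, simp)+
      have "fold (eff w Sc D) [Op Mul 71 71 11, Op Add 71 16 71, Read_Bits 74 71 11] M 74 = ans"
        using s M v0 unfolding C1_def ans
        by (simp add: env_cells[OF e] eval_add eval_mul min_widths del: eval_op.simps(1-3))
      then show "does w Sc D (Block [Op Mul 71 71 11, Op Add 71 16 71, Read_Bits 74 71 11]) M 4 (\<lambda>M. M 74 = ans)"
        by (rule does_Block[where Q = "\<lambda>M. M 74 = ans", rotated]) simp_all
    next
      assume "M 73 \<noteq> M 7"
      then have v0: "v \<noteq> 0" using M by (simp add: C1_def env_cells[OF e])
      have s: "v * b < 2 ^ w" "oCtz + v * b < 2 ^ w" "l + bits_at D (oCtz + v * b) b < 2 ^ w"
        by (rule small_less, (rule sv sb more_smalls smalls)+, simp)+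
      have "fold (eff w Sc D) [Op Mul 73 73 10, Op Add 73 18 73, Read_Bits 73 73 10, Op Add 74 0 73] M 74 = ans"
        using s M v0 unfolding C1_def ans
        by (simp add: env_cells[OF e] eval_add eval_mul min_widths del: eval_op.simps(1-3))
      then show "does w Sc D (Block [Op Mul 73 73 10, Op Add 73 18 73, Read_Bits 73 73 10, Op Add 74 0 73]) M 4 (\<lambda>M. M 74 = ans)"
        by (rule does_Block[where Q = "\<lambda>M. M 74 = ans", rotated]) simp_all
    }
  qed
  have 3: "does w Sc D (Block [Read_String 0 74]) M 1 (\<lambda>M. M 0 = Sc ! ans)" if "M 74 = ans" for M
    by (rule does_Block) (use that answer(2) n(1) in simp_all)
  show ?thesis
    unfolding report_def by (rule does_mono[OF does_Seq[OF 1 does_Seq[OF 2 3]]]) simp_all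
qed

text \<open>The constant is 52 + 52 + 15 for the stages without loops and 2 + 8 for what the
  searches do besides iterating; an iteration takes at most 37 steps.\<close>

lemma does_query_program:
  "does w Sc D query_program (snd (init_state w Sc l r)) (37 * (k1 + k2) + 129) (\<lambda>M. M 0 = Sc ! ans)"
  unfolding query_program_def
  by (rule does_mono[OF does_Seq[OF does_load_header does_Seq[OF does_enter_cell does_Seq[OF does_trie_search
        does_Seq[OF does_freq_search does_report]]]]]) simp_all

end

section \<open>Packed arrays\<close>

lemma bit_bits_at: "bit (bits_at D off len) i \<longleftrightarrow> i < len \<and> off + i < length D \<and> D ! (off + i)"
  unfolding bits_at_def by (auto simp: bit_horner_sum_bit_iff)

definition packed :: "nat \<Rightarrow> nat \<Rightarrow> (nat \<Rightarrow> nat) \<Rightarrow> bool list" where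
  "packed wd c f = map (\<lambda>p. bit (f (p div wd)) (p mod wd)) [0..<c * wd]"

lemma length_packed [simp]: "length (packed wd c f) = c * wd"
  by (simp add: packed_def)

lemma bits_at_packed:
  assumes "i < c" "len \<le> wd" "f i < 2 ^ len"
  shows "bits_at (xs @ packed wd c f @ ys) (length xs + i * wd) len = f i"
proof (rule bit_eqI)
  fix k
  have fit: "i * wd + k < c * wd" if "k < wd" for k
  proof -
    have "(i + 1) * wd \<le> c * wd" using assms(1) by (intro mult_le_mono1) simp
    then show ?thesis using that by simp
  qed
  have fit': "i * wd + k < c * wd + length ys" if "k < len" for k
    using fit[of k] that assms(2) by simp
  have "\<not> bit (f i) k" if "\<not> k < len"
    using assms(3) that by (metis bit_take_bit_iff take_bit_nat_eq_self)
  moreover have "(xs @ packed wd c f @ ys) ! (length xs + i * wd + k) = bit (f i) k" if "k < len"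
    using fit[of k] that assms(2) by (simp add: nth_append packed_def)
  ultimately show "bit (bits_at (xs @ packed wd c f @ ys) (length xs + i * wd) len) k \<longleftrightarrow> bit (f i) k"
    using fit' by (auto simp: bit_bits_at)
qed

lemma bits_at_part:
  assumes "E = xs @ packed wd c f @ ys" "off = length xs" "i < c" "len \<le> wd" "f i < 2 ^ len"
  shows "bits_at E (off + i * wd) len = f i"
  using bits_at_packed[where f = f, OF assms(3-5)] assms(1,2) by simp

section \<open>The data structure\<close>

text \<open>
  The structure samples every \<open>g\<close>-th left end and every \<open>X\<close>-th right end; a cell consists of a
  sampled left end and \<open>X\<close> consecutive right ends, and has a \<open>2 ^ h\<close>-ary trie of depth \<open>DD\<close>. Ranks
  in bit vectors are stored every \<open>b\<close> bits. The bounds \<open>k1\<close> and \<open>k2\<close> on \<open>log 2 DD\<close> and \<open>log 2 g\<close>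
  determine the query time.
\<close>

locale layout =
  fixes S :: "'a list" and n m b h X DD g k1 k2 :: nat
  assumes S: "n = length S" "n > 0" and m: "m = freq S 0 n"
    and b: "64 * n < 4 ^ b" "4 ^ b \<le> 256 * n"
    and X: "h > 0" "X = 2 ^ (h * DD)" "n \<le> m * X" "DD > 0"
    and gk: "g > 0" "DD < 2 ^ k1" "g < 2 ^ k2"
begin

definition NB where "NB = n div X + 1"
definition NU where "NU = n div g + 1"
text \<open>A multiple of \<open>b\<close>, so that no block of the directory straddles two vectors,
  and larger than \<open>n\<close>, so that position \<open>n\<close> is still inside.\<close>

definition Lv where "Lv = b * (n div b + 1)"
definition V2 where "V2 = 2 * (m + 1) * Lv"
definition VL where "VL = V2 + NU * NB"
text \<open>Words per unit of increase of \<open>F\<close> within a cell: a dictionary takes 128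
  words per key, and each unit brings at most \<open>DD * 2 ^ h\<close> keys. The root key accounts
  for the fixed 128 words of a cell.\<close>

definition K1 where "K1 = 128 * (DD * 2 ^ h)"
definition PL where "PL = NB * 128 + (m + 1) * K1"
definition om where "om = h * DD + 9"
definition oV where "oV = 25 * (64 * n)"
definition oDir where "oDir = oV + VL"
definition oSuc where "oSuc = oDir + (VL div b + 1) * (4 * b)"
definition oPop where "oPop = oSuc + (VL div b + 1) * (4 * b)"
definition oCtz where "oCtz = oPop + 2 ^ b * b"
definition oRes where "oRes = oCtz + 2 ^ b * b"
definition oLoc where "oLoc = oRes + NU * NB * (h * DD)"
definition total where "total = oLoc + NU * PL * om"

lemmas offset_defs = oV_def oDir_def oSuc_def oPop_def oCtz_def oRes_def oLoc_def total_def

definition F :: "nat \<Rightarrow> nat \<Rightarrow> nat" where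
  "F u r = freq S (u * g) r"

text \<open>Vector \<open>2 * q\<close> marks the left ends for \<open>q\<close>, vector \<open>2 * q + 1\<close> the right ends; after these
  vectors come the increments of \<open>F u (\<beta> * X) div X\<close>.\<close>

definition vbit :: "nat \<Rightarrow> bool" where
  "vbit p \<longleftrightarrow> (if p < V2
     then (if even (p div Lv) then left_end S (p div Lv div 2) (p mod Lv)
       else right_end S (p div Lv div 2) (p mod Lv))
     else (let u = (p - V2) div NB; \<beta> = (p - V2) mod NB in F u (\<beta> * X) div X < F u (\<beta> * X + X) div X))"

text \<open>Counting restarts in each vector of left or right ends, so their ranks can be compared
  directly. Among the increments it runs on from \<open>V2\<close>, and a row is isolated by
  subtraction.\<close>

definition block_base :: "nat \<Rightarrow> nat" where
  "block_base B = (if B * b < V2 then B * b div Lv * Lv else V2)"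

definition dir :: "nat \<Rightarrow> nat" where
  "dir B = card {p. block_base B \<le> p \<and> p < B * b \<and> vbit p}"

text \<open>An index of the string, not of the bit vector. If no left end follows,
  \<open>LEAST\<close> is unspecified; \<open>min n\<close> makes the entry fit into
  \<open>4 * b\<close> bits anyway.\<close>

definition suc :: "nat \<Rightarrow> nat" where
  "suc B = min n (LEAST i. (B + 1) * b \<le> B * b div Lv * Lv + i \<and> left_end S (B * b div Lv div 2) i)"

definition pop :: "nat \<Rightarrow> nat" where
  "pop v = card {i. i < b \<and> bit v i}"

definition ctz :: "nat \<Rightarrow> nat" where
  "ctz v = (if v = 0 then 0 else LEAST i. bit v i)"

definition residue :: "nat \<Rightarrow> nat" where
  "residue I = F (I div NB) (I mod NB * X) mod X"

text \<open>
  The space of a cell is linear in the increase of \<open>F u\<close> within it, so its address can be computed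
  from \<open>F u (\<beta> * X)\<close> and needs no pointer, which would be too long when \<open>n / m\<close> is small.
\<close>

definition cell_start :: "nat \<Rightarrow> nat" where
  "cell_start I = I div NB * PL + I mod NB * 128 + F (I div NB) (I mod NB * X) * K1"

definition cell_gain :: "nat \<Rightarrow> nat" where
  "cell_gain I = F (I div NB) (I mod NB * X + X) - F (I div NB) (I mod NB * X)"

text \<open>Shifted so that leaf \<open>X\<close> of the trie is the first right end of the
  cell.\<close>

definition cell_H :: "nat \<Rightarrow> nat \<Rightarrow> nat" where
  "cell_H I z = F (I div NB) (I mod NB * X + (z - X))"

section \<open>Sizes of the parameters and widths of the stored fields\<close>

lemma bpos: "b > 0"
  using b(1) S(2) by (cases b) auto

lemma mpos: "m > 0"
  using freq_pos[of 0 n S] S unfolding m by simp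

lemma mn: "m \<le> n"
  using freq_total_le[of S] by (simp add: m S(1))

lemma Xpos: "X > 0" by (simp add: X(2))

lemma F_mono: "r \<le> r' \<Longrightarrow> F u r \<le> F u r'"
  unfolding F_def by (rule freq_mono) auto

lemma F_add: "F u (r + k) \<le> F u r + k"
  unfolding F_def by (rule freq_add_right)

lemma F_le: "F u r \<le> m"
  unfolding F_def m S(1) by (rule freq_le_length)

lemma NB_le: "NB \<le> m + 1"
  using div_le_mono[OF X(3), of X] Xpos by (simp add: NB_def)

lemma NB_pos: "NB > 0" by (simp add: NB_def)

lemma b_le: "b \<le> 256 * n"
proof -
  have "b < 4 ^ b" by (rule less_le_trans[OF less_exp]) (simp add: power_mono)
  then show ?thesis using b(2) by simp
qed

lemma Lv_bounds: "n < Lv" "Lv \<le> 257 * n"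
proof -
  show "n < Lv" using bpos by (simp add: Lv_def dividend_less_times_div)
  have "b * (n div b) \<le> n" by simp
  then show "Lv \<le> 257 * n" unfolding Lv_def distrib_left mult_1_right using b_le by linarith
qed

lemma VL_le: "VL \<le> 1032 * (n * m)"
proof -
  have 1: "2 * (m + 1) * Lv \<le> 4 * m * (257 * n)"
    using mult_le_mono[OF _ Lv_bounds(2), of "2 * (m + 1)" "4 * m"] mpos by simp
  have 2: "NU * NB \<le> (2 * n) * (2 * m)"
  proof (intro mult_le_mono)
    show "NU \<le> 2 * n" using S(2) div_le_dividend[of n g] unfolding NU_def by linarith
    show "NB \<le> 2 * m" using NB_le mpos by linarith
  qed
  show ?thesis unfolding VL_def V2_def by (rule order_trans[OF add_mono[OF 1 2]]) simp
qed

text \<open>This explains the bound \<open>64 * n < 4 ^ b\<close>: \<open>VL\<close> is at most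
  \<open>1032 * (n * m)\<close>, hence at most \<open>(64 * n)\<^sup>2\<close>, which is below
  \<open>4 ^ b * 4 ^ b\<close>.\<close>

lemma VL_less: "VL < 2 ^ (4 * b)"
proof -
  have "(64 * n) * (64 * n) < 4 ^ b * 4 ^ b" using b(1) by (intro mult_strict_mono) auto
  also have "(4::nat) ^ b * 4 ^ b = 2 ^ (4 * b)"
    by (simp add: power_mult flip: power_mult_distrib)
  finally have "4096 * (n * n) < 2 ^ (4 * b)" by simp
  moreover have "1032 * (n * m) \<le> 4096 * (n * n)" using mn by (intro mult_le_mono) auto
  ultimately show ?thesis using VL_le by linarith
qed

lemma n_less: "n < 2 ^ (4 * b)"
proof -
  have "Lv \<le> VL" by (simp add: VL_def V2_def)
  then show ?thesis using VL_less Lv_bounds(1) by linarith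
qed

lemma dir_less: "B * b \<le> VL \<Longrightarrow> dir B < 2 ^ (4 * b)"
proof -
  assume "B * b \<le> VL"
  have "dir B \<le> card {..<B * b}" unfolding dir_def by (rule card_mono) auto
  then show ?thesis using \<open>B * b \<le> VL\<close> VL_less by simp
qed

lemma suc_less: "suc B < 2 ^ (4 * b)"
  using n_less by (simp add: suc_def min_less_iff_disj)

lemma pop_less: "pop v < 2 ^ b"
proof -
  have "pop v \<le> card {..<b}" unfolding pop_def by (rule card_mono) auto
  then show ?thesis using less_exp[of b] by (simp only: card_lessThan le_less_trans)
qed

lemma ctz_less: "v < 2 ^ b \<Longrightarrow> ctz v < 2 ^ b"
proof -
  assume v: "v < 2 ^ b"
  show ?thesis
  proof (cases "v = 0")
    case False
    then obtain i where i: "bit v i" using bit_eq_iff[of v 0] by auto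
    then have "i < b" using v by (metis bit_take_bit_iff take_bit_nat_eq_self)
    then have "(LEAST i. bit v i) < b" using Least_le[of "bit v" i] i by simp
    then have "ctz v < b" using False by (simp add: ctz_def)
    then show ?thesis using less_exp[of b] by (rule less_trans)
  qed (simp add: ctz_def)
qed

lemma residue_less: "residue I < 2 ^ (h * DD)"
  using Xpos by (simp add: residue_def X(2)[symmetric])

text \<open>The end of a cell is the formula for its start evaluated at \<open>\<beta> + 1\<close>,
  so cells of one row abut. The last one stays within the row because
  \<open>F \<le> m\<close>.\<close>

lemma cell_fits: "cell_start I + (128 + cell_gain I * K1) \<le> cell_start (Suc I)"
  and cell_end: "cell_start I + (128 + cell_gain I * K1) \<le> (I div NB + 1) * PL"
proof -
  define u \<beta> where "u = I div NB" and "\<beta> = I mod NB"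
  have le: "F u (\<beta> * X) \<le> F u (\<beta> * X + X)" by (rule F_mono) simp
  then have "F u (\<beta> * X) * K1 + cell_gain I * K1 = F u (\<beta> * X + X) * K1"
    unfolding cell_gain_def u_def[symmetric] \<beta>_def[symmetric] distrib_right[symmetric] by simp
  then have e: "cell_start I + (128 + cell_gain I * K1) = u * PL + (\<beta> + 1) * 128 + F u (\<beta> * X + X) * K1"
    unfolding cell_start_def u_def[symmetric] \<beta>_def[symmetric] by simp
  have "\<beta> < NB" by (simp add: \<beta>_def NB_pos)
  have "(\<beta> + 1) * 128 \<le> NB * 128" using \<open>\<beta> < NB\<close> by (intro mult_le_mono1) simp
  moreover have "F u (\<beta> * X + X) * K1 \<le> (m + 1) * K1" using F_le[of u "\<beta> * X + X"] by (intro mult_le_mono1) simp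
  ultimately have up: "u * PL + (\<beta> + 1) * 128 + F u (\<beta> * X + X) * K1 \<le> (u + 1) * PL"
    unfolding distrib_right[of u 1] PL_def by simp
  then show "cell_start I + (128 + cell_gain I * K1) \<le> (I div NB + 1) * PL"
    unfolding e u_def .
  have I: "I = u * NB + \<beta>" unfolding u_def \<beta>_def by (rule div_mult_mod_eq[symmetric])
  show "cell_start I + (128 + cell_gain I * K1) \<le> cell_start (Suc I)"
  proof (cases "\<beta> + 1 < NB")
    case True
    have "Suc I = (\<beta> + 1) + u * NB" by (simp add: I)
    then have "Suc I div NB = u" "Suc I mod NB = \<beta> + 1"
      using True div_mult_self1[of NB "\<beta> + 1" u] mod_mult_self1[of "\<beta> + 1" u NB]
      by (metis add.right_neutral div_less gr_implies_not0, metis mod_less)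
    then show ?thesis unfolding e cell_start_def[of "Suc I"] by (simp add: add.commute)
  next
    case False
    then have "Suc I = (u + 1) * NB" using \<open>\<beta> < NB\<close> by (simp add: I)
    then have "Suc I div NB = u + 1" by (metis nonzero_mult_div_cancel_right NB_pos not_gr_zero)
    then have "(u + 1) * PL \<le> cell_start (Suc I)" by (simp add: cell_start_def)
    then show ?thesis using up unfolding e by linarith
  qed
qed

lemma gain_le: "cell_gain I \<le> X"
  unfolding cell_gain_def using F_add[of "I div NB" "I mod NB * X" X] by linarith

text \<open>All tries share one array. The lookups are stated for any \<open>rd\<close> that agrees
  with the array on the words of the cell, since only these are known to be recovered from the bit
  string.\<close>

lemma cell_dictionaries:
  "\<exists>L. (\<forall>p. L p < 2 ^ om) \<and> (\<forall>I z. X \<le> z \<longrightarrow> z < 2 * X \<longrightarrow>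
     (\<forall>rd. (\<forall>k < 128 + cell_gain I * K1. rd k = L (cell_start I + k)) \<longrightarrow> (\<exists>i0 \<le> DD.
       (\<forall>i \<le> DD. rd (dict_slot (h * DD + 1) rd (z div 2 ^ (h * i))) = z div 2 ^ (h * i) \<longleftrightarrow> i0 \<le> i) \<and>
       rd (dict_slot (h * DD + 1) rd (z div 2 ^ (h * i0)) + 1) = cell_H I z - cell_H I X \<and>
       (i0 = DD \<longrightarrow> cell_H I z = cell_H I X))))"
proof -
  let ?W = "h * DD + 1" and ?len = "\<lambda>I. 128 * (1 + cell_gain I * (DD * 2 ^ h))"
  have len: "?len I = 128 + cell_gain I * K1" for I by (simp add: K1_def)
  have "\<exists>A. (\<forall>p. A p < 2 ^ (h * DD + 9)) \<and>
    (\<forall>z. X \<le> z \<longrightarrow> z < 2 * X \<longrightarrow> (\<exists>i0 \<le> DD.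
      (\<forall>i \<le> DD. 2 + 3 * hash ?W (A 1) (A 0) (z div 2 ^ (h * i)) + 2 < ?len I \<and>
        dict_slot ?W A (z div 2 ^ (h * i)) + 1 < ?len I \<and>
        (A (dict_slot ?W A (z div 2 ^ (h * i))) = z div 2 ^ (h * i) \<longleftrightarrow> i0 \<le> i)) \<and>
      A (dict_slot ?W A (z div 2 ^ (h * i0)) + 1) = cell_H I z - cell_H I X \<and> (i0 = DD \<longrightarrow> cell_H I z = cell_H I X)))" for I
  proof (rule trie_dictionary)
    show "mono (cell_H I)" unfolding cell_H_def by (intro monoI F_mono) simp
    have "cell_H I (2 * X - 1) \<le> F (I div NB) (I mod NB * X + X)"
      unfolding cell_H_def by (intro F_mono) simp
    then show "cell_H I (2 * X - 1) \<le> cell_H I X + cell_gain I"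
      unfolding cell_gain_def by (simp add: cell_H_def)
    show "cell_gain I < 2 * X" using gain_le[of I] Xpos by linarith
  qed (use X(1,2) in simp_all)
  then obtain A where A: "\<And>I p. A I p < 2 ^ (h * DD + 9)"
    "\<And>I z. X \<le> z \<Longrightarrow> z < 2 * X \<Longrightarrow> \<exists>i0 \<le> DD.
      (\<forall>i \<le> DD. 2 + 3 * hash ?W (A I 1) (A I 0) (z div 2 ^ (h * i)) + 2 < ?len I \<and>
        dict_slot ?W (A I) (z div 2 ^ (h * i)) + 1 < ?len I \<and>
        (A I (dict_slot ?W (A I) (z div 2 ^ (h * i))) = z div 2 ^ (h * i) \<longleftrightarrow> i0 \<le> i)) \<and>
      A I (dict_slot ?W (A I) (z div 2 ^ (h * i0)) + 1) = cell_H I z - cell_H I X \<and> (i0 = DD \<longrightarrow> cell_H I z = cell_H I X)"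
    by metis
  have "\<exists>L. (\<forall>I k. k < ?len I \<longrightarrow> L (cell_start I + k) = A I k) \<and> (\<forall>p. L p < 2 ^ om)"
    by (rule array_placement, unfold len om_def) (use cell_fits A(1) in simp_all)
  then obtain L where L: "\<And>I k. k < ?len I \<Longrightarrow> L (cell_start I + k) = A I k" "\<And>p. L p < 2 ^ om" by blast
  show ?thesis
  proof (intro exI[of _ L] conjI allI impI)
    show "L p < 2 ^ om" for p by (rule L(2))
    fix I z rd
    assume z: "X \<le> z" "z < 2 * X" and rdL: "\<forall>k < 128 + cell_gain I * K1. rd k = L (cell_start I + k)"
    have rd: "rd k = A I k" if k: "k < ?len I" for k
    proof -
      have "rd k = L (cell_start I + k)" using rdL k unfolding len by blast
      then show ?thesis using L(1)[OF k] by (rule trans)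
    qed
    obtain i0 where i0: "i0 \<le> DD"
      "\<And>i. i \<le> DD \<Longrightarrow> 2 + 3 * hash ?W (A I 1) (A I 0) (z div 2 ^ (h * i)) + 2 < ?len I \<and>
        dict_slot ?W (A I) (z div 2 ^ (h * i)) + 1 < ?len I \<and>
        (A I (dict_slot ?W (A I) (z div 2 ^ (h * i))) = z div 2 ^ (h * i) \<longleftrightarrow> i0 \<le> i)"
      "A I (dict_slot ?W (A I) (z div 2 ^ (h * i0)) + 1) = cell_H I z - cell_H I X" "i0 = DD \<longrightarrow> cell_H I z = cell_H I X"
      using A(2)[OF z] by blast
    have slot: "dict_slot ?W rd (z div 2 ^ (h * i)) = dict_slot ?W (A I) (z div 2 ^ (h * i))" if "i \<le> DD" for i
    proof -
      define p where "p = 2 + 3 * hash ?W (A I 1) (A I 0) (z div 2 ^ (h * i))"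
      have "p + 2 < ?len I" using i0(2)[OF that] unfolding p_def by blast
      then have "rd p = A I p" "rd (p + 1) = A I (p + 1)" "rd (p + 2) = A I (p + 2)" "rd 0 = A I 0" "rd 1 = A I 1"
        by (intro rd, linarith)+
      then show ?thesis unfolding dict_slot_def Let_def by (simp only: p_def)
    qed
    have cells: "rd (dict_slot ?W rd (z div 2 ^ (h * i))) = A I (dict_slot ?W (A I) (z div 2 ^ (h * i)))"
      "rd (dict_slot ?W rd (z div 2 ^ (h * i)) + 1) = A I (dict_slot ?W (A I) (z div 2 ^ (h * i)) + 1)" if "i \<le> DD" for i
      unfolding slot[OF that] using i0(2)[OF that] by (intro rd, linarith)+
    show "\<exists>i0\<le>DD. (\<forall>i\<le>DD. (rd (dict_slot ?W rd (z div 2 ^ (h * i))) = z div 2 ^ (h * i)) = (i0 \<le> i)) \<and>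
        rd (dict_slot ?W rd (z div 2 ^ (h * i0)) + 1) = cell_H I z - cell_H I X \<and> (i0 = DD \<longrightarrow> cell_H I z = cell_H I X)"
      using i0 cells by (intro exI[of _ i0]) auto
  qed
qed

text \<open>The program initially knows only the query, \<open>n\<close> and \<open>w\<close>, so
  field positions have to be computable from \<open>n\<close>. Fields of \<open>64 * n\<close> bits
  are wide enough for numbers polynomial in \<open>n\<close> and cost only linear space.\<close>

definition header :: "nat list" where
  "header = [b, 4 * b, Lv, V2, oV, oDir, oSuc, oPop, oCtz, oRes, h * DD, X, 2 * X, h, DD, NB, PL, K1,
     oLoc, om, g, 1, 2, 3, 128]"

definition data :: "(nat \<Rightarrow> nat) \<Rightarrow> bool list" where
  "data L = packed (64 * n) 25 (\<lambda>i. header ! i) @ map vbit [0..<VL] @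
     packed (4 * b) (VL div b + 1) dir @ packed (4 * b) (VL div b + 1) suc @
     packed b (2 ^ b) pop @ packed b (2 ^ b) ctz @
     packed (h * DD) (NU * NB) residue @ packed om (NU * PL) L"

lemma length_data: "length (data L) = total"
  by (simp add: data_def offset_defs)

section \<open>Recovering the stored fields from the bit string\<close>

lemma read_header:
  assumes "i < 25" "len \<le> 64 * n" "header ! i < 2 ^ len"
  shows "bits_at (data L) (i * (64 * n)) len = header ! i"
  using bits_at_packed[where xs = "[]" and f = "\<lambda>i. header ! i", OF assms] by (simp add: data_def offset_defs)

lemma read_vbits:
  assumes "P + s \<le> VL"
  shows "bit (bits_at (data L) (oV + P) s) i \<longleftrightarrow> i < s \<and> vbit (P + i)"
  using assms by (auto simp: bit_bits_at data_def offset_defs nth_append)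

lemma read_dir:
  assumes "P \<le> VL"
  shows "bits_at (data L) (oDir + P div b * (4 * b)) (4 * b) = dir (P div b)"
proof -
  let ?xs = "packed (64 * n) 25 (\<lambda>i. header ! i) @ map vbit [0..<VL]"
  have "P div b < VL div b + 1" using div_le_mono[OF assms, of b] by simp
  moreover have "P div b * b \<le> VL" using assms by (meson div_times_less_eq_dividend order_trans)
  ultimately show ?thesis
    by (intro bits_at_part[where xs = ?xs and f = dir] dir_less) (simp_all add: data_def offset_defs)
qed

lemma read_suc:
  assumes "P \<le> VL"
  shows "bits_at (data L) (oSuc + P div b * (4 * b)) (4 * b) = suc (P div b)"
proof -
  let ?xs = "packed (64 * n) 25 (\<lambda>i. header ! i) @ map vbit [0..<VL] @ packed (4 * b) (VL div b + 1) dir"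
  have "P div b < VL div b + 1" using div_le_mono[OF assms, of b] by simp
  then show ?thesis
    by (intro bits_at_part[where xs = ?xs and f = suc] suc_less) (simp_all add: data_def offset_defs)
qed

lemma read_pop:
  assumes "v < 2 ^ b"
  shows "bits_at (data L) (oPop + v * b) b = pop v"
proof -
  let ?xs = "packed (64 * n) 25 (\<lambda>i. header ! i) @ map vbit [0..<VL] @ packed (4 * b) (VL div b + 1) dir @
    packed (4 * b) (VL div b + 1) suc"
  show ?thesis
    using assms by (intro bits_at_part[where xs = ?xs and f = pop] pop_less) (simp_all add: data_def offset_defs)
qed

lemma read_ctz:
  assumes "v < 2 ^ b"
  shows "bits_at (data L) (oCtz + v * b) b = ctz v"
proof -
  let ?xs = "packed (64 * n) 25 (\<lambda>i. header ! i) @ map vbit [0..<VL] @ packed (4 * b) (VL div b + 1) dir @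
    packed (4 * b) (VL div b + 1) suc @ packed b (2 ^ b) pop"
  show ?thesis
    using assms by (intro bits_at_part[where xs = ?xs and f = ctz] ctz_less) (simp_all add: data_def offset_defs)
qed

lemma read_residue:
  assumes "I < NU * NB"
  shows "bits_at (data L) (oRes + I * (h * DD)) (h * DD) = residue I"
proof -
  let ?xs = "packed (64 * n) 25 (\<lambda>i. header ! i) @ map vbit [0..<VL] @ packed (4 * b) (VL div b + 1) dir @
    packed (4 * b) (VL div b + 1) suc @ packed b (2 ^ b) pop @ packed b (2 ^ b) ctz"
  show ?thesis
    using assms by (intro bits_at_part[where xs = ?xs and f = residue] residue_less) (simp_all add: data_def offset_defs)
qed

lemma read_local:
  assumes "p < NU * PL" "L p < 2 ^ om"
  shows "bits_at (data L) (oLoc + p * om) om = L p"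
proof -
  let ?xs = "packed (64 * n) 25 (\<lambda>i. header ! i) @ map vbit [0..<VL] @ packed (4 * b) (VL div b + 1) dir @
    packed (4 * b) (VL div b + 1) suc @ packed b (2 ^ b) pop @ packed b (2 ^ b) ctz @
    packed (h * DD) (NU * NB) residue"
  show ?thesis
    using assms by (intro bits_at_part[where xs = ?xs and f = L and ys = "[]"]) (simp_all add: data_def offset_defs)
qed

text \<open>The value 0 beyond \<open>VL\<close> makes a uniform bound on \<open>rk\<close>
  available.\<close>

definition rk :: "nat \<Rightarrow> nat" where
  "rk P = (if P \<le> VL then dir (P div b) + card {p. P div b * b \<le> p \<and> p < P \<and> vbit p} else 0)"

lemma read_rank:
  assumes "P \<le> VL"
  shows "bits_at (data L) (oDir + P div b * (4 * b)) (4 * b) +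
    bits_at (data L) (oPop + bits_at (data L) (oV + (P - P mod b)) (P mod b) * b) b = rk P"
proof -
  define B where "B = P div b * b"
  have PB: "P - P mod b = B" "B + P mod b = P" by (simp_all add: B_def minus_mod_eq_div_mult)
  have Pb: "P mod b < b" using bpos by simp
  define v where "v = bits_at (data L) (oV + B) (P mod b)"
  have v: "v < 2 ^ b" unfolding v_def using Pb by (intro bits_at_less) simp
  have bits: "bit v i \<longleftrightarrow> i < P mod b \<and> vbit (B + i)" for i
    unfolding v_def using read_vbits[of B "P mod b" L i] PB assms by simp
  have "{p. B \<le> p \<and> p < P \<and> vbit p} = (\<lambda>i. B + i) ` {i. i < b \<and> bit v i}"
  proof (intro set_eqI iffI)
    fix p assume p: "p \<in> {p. B \<le> p \<and> p < P \<and> vbit p}"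
    then have "p = B + (p - B)" "p - B < P mod b" using PB(2) by auto
    then show "p \<in> (\<lambda>i. B + i) ` {i. i < b \<and> bit v i}"
      using p Pb by (intro image_eqI[of _ _ "p - B"]) (auto simp: bits)
  qed (use PB(2) in \<open>auto simp: bits\<close>)
  then have "card {p. B \<le> p \<and> p < P \<and> vbit p} = pop v"
    by (simp add: pop_def card_image)
  then show ?thesis
    unfolding PB(1) v_def[symmetric] read_pop[OF v] read_dir[OF assms] using assms by (simp add: rk_def B_def)
qed

section \<open>Ranks within the padded vectors\<close>

lemma rk_from_base:
  assumes "P \<le> VL" "block_base (P div b) = s" "s \<le> P div b * b"
  shows "rk P = card {k. k < P - s \<and> vbit (s + k)}"
proof -
  define B where "B = P div b * b"
  have B: "s \<le> B" "B \<le> P" using assms(3) by (simp_all add: B_def)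
  have "rk P = card {p. s \<le> p \<and> p < B \<and> vbit p} + card {p. B \<le> p \<and> p < P \<and> vbit p}"
    using assms(1,2) by (simp add: rk_def dir_def B_def)
  also have "\<dots> = card ({p. s \<le> p \<and> p < B \<and> vbit p} \<union> {p. B \<le> p \<and> p < P \<and> vbit p})"
    by (intro card_Un_disjoint[symmetric]) auto
  also have "\<dots> = card ((\<lambda>k. s + k) ` {k. k < P - s \<and> vbit (s + k)})"
  proof (rule arg_cong[of _ _ card], intro set_eqI iffI)
    fix p assume p: "p \<in> {p. s \<le> p \<and> p < B \<and> vbit p} \<union> {p. B \<le> p \<and> p < P \<and> vbit p}"
    then have "p = s + (p - s)" "p < P" "vbit p" using B by auto
    then show "p \<in> (\<lambda>k. s + k) ` {k. k < P - s \<and> vbit (s + k)}"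
      using p by (intro image_eqI[of _ _ "p - s"]) auto
  qed (use B in auto)
  finally show ?thesis by (simp add: card_image)
qed

lemma block_in_vector:
  assumes "i < Lv"
  shows "v * Lv \<le> (v * Lv + i) div b * b" "(v * Lv + i) div b * b div Lv = v"
proof -
  have "v * Lv = v * (n div b + 1) * b" by (simp only: Lv_def mult_ac)
  then have "v * Lv div b * b = v * Lv" using bpos by (metis nonzero_mult_div_cancel_right not_gr_zero)
  moreover have "v * Lv div b \<le> (v * Lv + i) div b" by (intro div_le_mono) simp
  ultimately show le: "v * Lv \<le> (v * Lv + i) div b * b" by (metis mult_le_mono1)
  have "(v * Lv + i) div b * b \<le> v * Lv + i" by simp
  then have "(v * Lv + i) div b * b < (v + 1) * Lv" using assms unfolding distrib_right mult_1 by linarith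
  then show "(v * Lv + i) div b * b div Lv = v" using le by (intro div_nat_eqI) (simp_all only: mult.commute Suc_eq_plus1)
qed

lemma vector_less: "v < 2 * (m + 1) \<Longrightarrow> i \<le> Lv \<Longrightarrow> v * Lv + i \<le> V2"
proof -
  assume "v < 2 * (m + 1)" "i \<le> Lv"
  then have "(v + 1) * Lv \<le> 2 * (m + 1) * Lv" by (intro mult_le_mono1) simp
  then show ?thesis using \<open>i \<le> Lv\<close> unfolding V2_def distrib_right[of v 1] mult_1 by linarith
qed

lemma rk_vector:
  assumes "v < 2 * (m + 1)" "i < Lv"
  shows "rk (v * Lv + i) = card {k. k < i \<and> vbit (v * Lv + k)}"
proof -
  have less: "v * Lv + i < V2" using vector_less[OF assms(1), of "Suc i"] assms(2) by simp
  have "(v * Lv + i) div b * b \<le> v * Lv + i" by simp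
  then have "(v * Lv + i) div b * b < V2" using less by (rule le_less_trans)
  then have "block_base ((v * Lv + i) div b) = v * Lv"
    using block_in_vector[OF assms(2)] by (simp only: block_base_def if_True)
  from rk_from_base[OF _ this block_in_vector(1)[OF assms(2)]] show ?thesis using less by (simp add: VL_def)
qed

lemma vbit_vector:
  assumes "v < 2 * (m + 1)" "i < Lv"
  shows "vbit (v * Lv + i) \<longleftrightarrow> (if even v then left_end S (v div 2) i else right_end S (v div 2) i)"
proof -
  have "v * Lv + i < V2" using vector_less[OF assms(1), of "Suc i"] assms(2) by simp
  moreover have "(v * Lv + i) div Lv = v" "(v * Lv + i) mod Lv = i" using assms(2) by simp_all
  ultimately show ?thesis unfolding vbit_def by (simp only: if_True)
qed

lemma rank_test:
  assumes "0 < q" "q \<le> m" "l < Lv" "r \<le> n"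
  shows "rk (2 * q * Lv + l) < rk (2 * q * Lv + Lv + r) \<longleftrightarrow> q \<le> freq S l r"
proof -
  have r: "r < Lv" using assms(4) Lv_bounds(1) by simp
  have "rk (2 * q * Lv + l) = card {k. k < l \<and> left_end S q k}"
  proof -
    have "vbit (2 * q * Lv + k) \<longleftrightarrow> left_end S q k" if "k < l" for k
      using vbit_vector[of "2 * q" k] assms that by simp
    then show ?thesis
      using rk_vector[of "2 * q" l] assms by (simp cong: conj_cong)
  qed
  moreover have "rk (2 * q * Lv + Lv + r) = card {k. k < r \<and> right_end S q k}"
  proof -
    have e: "2 * q * Lv + Lv + k = (2 * q + 1) * Lv + k" for k by simp
    have "vbit ((2 * q + 1) * Lv + k) \<longleftrightarrow> right_end S q k" if "k < r" for k
      using vbit_vector[of "2 * q + 1" k] assms(2) that r by simp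
    then show ?thesis
      unfolding e using rk_vector[of "2 * q + 1" r] assms(2) r by (simp cong: conj_cong del: mult_Suc)
  qed
  ultimately show ?thesis using freq_test[OF assms(1), of r S l] assms(4) by (simp add: S(1))
qed

section \<open>Recovering \<open>F\<close> at the starts of cells\<close>

lemma rk_cells:
  assumes "I \<le> NU * NB"
  shows "rk (V2 + I) = card {k. k < I \<and> vbit (V2 + k)}"
proof -
  have V2: "V2 = 2 * (m + 1) * (n div b + 1) * b" by (simp only: V2_def Lv_def mult_ac)
  then have "V2 div b * b = V2" using bpos by (metis nonzero_mult_div_cancel_right not_gr_zero)
  moreover have "V2 div b \<le> (V2 + I) div b" by (intro div_le_mono) simp
  ultimately have le: "V2 \<le> (V2 + I) div b * b" by (metis mult_le_mono1)
  then have "block_base ((V2 + I) div b) = V2" by (simp only: block_base_def not_less[symmetric] if_False)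
  from rk_from_base[OF _ this le] show ?thesis using assms by (simp add: VL_def)
qed

text \<open>Over \<open>X\<close> right ends \<open>F\<close> grows by at most \<open>X\<close>, so
  \<open>F div X\<close> grows by 0 or 1. One bit per cell therefore records it, and the bits sum to
  the total growth from \<open>F u 0 = 0\<close>.\<close>

lemma card_increments:
  "card {k. k < \<beta> \<and> F u (k * X) div X < F u (k * X + X) div X} = F u (\<beta> * X) div X"
proof (induction \<beta>)
  case 0
  then show ?case by (simp add: F_def)
next
  case (Suc \<beta>)
  let ?I = "{k. k < \<beta> \<and> F u (k * X) div X < F u (k * X + X) div X}"
  have "F u (\<beta> * X) div X \<le> F u (\<beta> * X + X) div X" by (intro div_le_mono F_mono) simp
  moreover have "F u (\<beta> * X + X) div X \<le> (F u (\<beta> * X) + X) div X" by (intro div_le_mono F_add)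
  moreover have "(F u (\<beta> * X) + X) div X = F u (\<beta> * X) div X + 1" using Xpos by simp
  moreover have "{k. k < Suc \<beta> \<and> F u (k * X) div X < F u (k * X + X) div X} =
      (if F u (\<beta> * X) div X < F u (\<beta> * X + X) div X then insert \<beta> ?I else ?I)"
    by (auto simp: less_Suc_eq)
  ultimately show ?case using Suc.IH by (simp add: add.commute)
qed

lemma rk_cell:
  assumes "u < NU" "\<beta> < NB"
  shows "rk (V2 + (u * NB + \<beta>)) = rk (V2 + u * NB) + F u (\<beta> * X) div X" "u * NB + \<beta> < NU * NB"
proof -
  have "(u + 1) * NB \<le> NU * NB" using assms(1) by (intro mult_le_mono1) simp
  then show less: "u * NB + \<beta> < NU * NB" using assms(2) unfolding distrib_right mult_1 by linarith
  have vb: "vbit (V2 + (u * NB + k)) \<longleftrightarrow> F u (k * X) div X < F u (k * X + X) div X" if "k < \<beta>" for k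
  proof -
    have "(u * NB + k) div NB = u" "(u * NB + k) mod NB = k" using that assms(2) by simp_all
    then show ?thesis by (simp add: vbit_def)
  qed
  have "{k. k < u * NB + \<beta> \<and> vbit (V2 + k)} = {k. k < u * NB \<and> vbit (V2 + k)} \<union>
      (\<lambda>k. u * NB + k) ` {k. k < \<beta> \<and> F u (k * X) div X < F u (k * X + X) div X}"
  proof (intro set_eqI iffI)
    fix p assume p: "p \<in> {k. k < u * NB + \<beta> \<and> vbit (V2 + k)}"
    show "p \<in> {k. k < u * NB \<and> vbit (V2 + k)} \<union>
      (\<lambda>k. u * NB + k) ` {k. k < \<beta> \<and> F u (k * X) div X < F u (k * X + X) div X}"
    proof (cases "p < u * NB")
      case False
      then have e: "p = u * NB + (p - u * NB)" "p - u * NB < \<beta>" using p by auto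
      then show ?thesis
        using p vb[OF e(2)] by (intro UnI2 image_eqI[where x = "p - u * NB"]) auto
    qed (use p in simp)
  qed (auto simp: vb)
  then have "card {k. k < u * NB + \<beta> \<and> vbit (V2 + k)} = card {k. k < u * NB \<and> vbit (V2 + k)} +
      card ((\<lambda>k. u * NB + k) ` {k. k < \<beta> \<and> F u (k * X) div X < F u (k * X + X) div X})"
    by (simp only:) (intro card_Un_disjoint, auto)
  then show "rk (V2 + (u * NB + \<beta>)) = rk (V2 + u * NB) + F u (\<beta> * X) div X"
    unfolding rk_cells[OF less_imp_le[OF less]] rk_cells[OF order_trans[OF le_add1 less_imp_le[OF less]]]
    by (simp add: card_image card_increments)
qed

lemma rk_le: "rk P \<le> VL"
proof (cases "P \<le> VL")
  case True
  have "dir (P div b) \<le> card {..<P div b * b}" unfolding dir_def by (rule card_mono) auto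
  moreover have "card {p. P div b * b \<le> p \<and> p < P \<and> vbit p} \<le> card {P div b * b..<P}" by (rule card_mono) auto
  moreover have "P div b * b \<le> P" by simp
  ultimately have "dir (P div b) + card {p. P div b * b \<le> p \<and> p < P \<and> vbit p} \<le> P"
    unfolding card_lessThan card_atLeastLessThan by linarith
  then show ?thesis using True unfolding rk_def by simp
qed (simp add: rk_def)

lemma read_answer:
  assumes "l \<le> r" "r < n" and f: "f = freq S l (r + 1)" and P: "P = 2 * f * Lv + l"
    and v: "v = bits_at (data L) (oV + P) (b - P mod b)"
  shows "(if v = 0 then bits_at (data L) (oSuc + P div b * (4 * b)) (4 * b)
      else l + bits_at (data L) (oCtz + v * b) b) = (LEAST i. l \<le> i \<and> left_end S f i)"
proof -
  define ans where "ans = (LEAST i. l \<le> i \<and> left_end S f i)"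
  have ans: "l \<le> ans" "ans < n" "left_end S f ans"
    using next_left_end_is_mode[of l r S f ans] assms(1,2) by (simp_all add: ans_def f S(1))
  have fm: "f \<le> m" unfolding f m S(1) by (rule freq_le_length)
  have l: "l < Lv" using assms(1,2) Lv_bounds(1) by simp
  define B where "B = P div b * b"
  have B: "2 * f * Lv \<le> B" "B div Lv = 2 * f" "B + P mod b = P"
    using block_in_vector[OF l, of "2 * f"] by (simp_all add: B_def P)
  have Pb: "P mod b < b" using bpos by simp
  \<comment> \<open>The block of \<open>P\<close> ends inside the vector of \<open>P\<close>, so the
    bits read after \<open>P\<close> all concern left ends for \<open>f\<close>.\<close>
  have stop: "B + b \<le> (2 * f + 1) * Lv"
  proof -
    have "P < (2 * f + 1) * Lv" using l by (simp add: P)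
    also have "(2 * f + 1) * Lv = (2 * f + 1) * (n div b + 1) * b" by (simp only: Lv_def mult_ac)
    finally have "P div b < (2 * f + 1) * (n div b + 1)" by (simp add: less_mult_imp_div_less)
    then have "(P div b + 1) * b \<le> (2 * f + 1) * (n div b + 1) * b" by (intro mult_le_mono1) simp
    then show ?thesis by (simp add: B_def Lv_def algebra_simps)
  qed
  have "(2 * f + 1) * Lv \<le> V2" using vector_less[of "2 * f" Lv] fm by simp
  then have PVL: "P + (b - P mod b) \<le> VL" using stop B(3) Pb by (simp add: VL_def)
  have bit: "bit v i \<longleftrightarrow> i < b - P mod b \<and> left_end S f (l + i)" for i
  proof -
    have "vbit (P + i) \<longleftrightarrow> left_end S f (l + i)" if "i < b - P mod b"
    proof -
      have "l + i < Lv" using that stop B(3) Pb by (simp add: P)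
      then show ?thesis using vbit_vector[of "2 * f" "l + i"] fm by (simp add: P add.assoc)
    qed
    then show ?thesis using read_vbits[OF PVL] by (auto simp: v)
  qed
  show ?thesis
  proof (cases "v = 0")
    case True
    then have none: "\<not> left_end S f (l + i)" if "i < b - P mod b" for i using bit[of i] that by simp
    have "(LEAST i. B + b \<le> 2 * f * Lv + i \<and> left_end S f i) = ans"
    proof (rule Least_equality)
      have "\<not> ans - l < b - P mod b" using none[of "ans - l"] ans(1,3) by auto
      then show "B + b \<le> 2 * f * Lv + ans \<and> left_end S f ans"
        using ans(1,3) B(3) P Pb by auto
      fix y assume "B + b \<le> 2 * f * Lv + y \<and> left_end S f y"
      then have "l \<le> y \<and> left_end S f y" using B(3) P Pb by auto
      then show "ans \<le> y" unfolding ans_def by (rule Least_le)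
    qed
    then have "suc (P div b) = ans"
      using ans(2) B(2) unfolding suc_def B_def by (simp add: add.commute)
    then show ?thesis using True read_suc[of P L] PVL by (simp add: ans_def)
  next
    case False
    have v_less: "v < 2 ^ b" unfolding v by (intro bits_at_less) simp
    obtain i where i: "bit v i" using False bit_eq_iff[of v 0] by auto
    define c where "c = (LEAST i. bit v i)"
    have c: "bit v c" unfolding c_def using i by (rule LeastI)
    have "ans = l + c"
      unfolding ans_def
    proof (rule Least_equality)
      show "l \<le> l + c \<and> left_end S f (l + c)" using bit c by simp
      fix y assume y: "l \<le> y \<and> left_end S f y"
      show "l + c \<le> y"
      proof (cases "y - l < b - P mod b")
        case True
        then have "bit v (y - l)" using bit[of "y - l"] y by simp
        then have "c \<le> y - l" unfolding c_def by (rule Least_le)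
        then show ?thesis using y by linarith
      next
        case False
        then show ?thesis using bit[of c] c y by linarith
      qed
    qed
    then show ?thesis using False read_ctz[OF v_less] by (simp add: ctz_def c_def ans_def)
  qed
qed

text \<open>A single bound \<open>Z\<close> serves three purposes: its 12th power limits
  intermediate results, it exceeds all parameters and stored words, and
  \<open>Z < 2 ^ (64 * n)\<close> makes the header entries fit.\<close>

lemma query_run_layout:
  assumes L: "\<And>p. L p < 2 ^ om"
    and dict: "\<And>I z rd. X \<le> z \<Longrightarrow> z < 2 * X \<Longrightarrow>
     (\<And>k. k < 128 + cell_gain I * K1 \<Longrightarrow> rd k = L (cell_start I + k)) \<Longrightarrow> (\<exists>i0 \<le> DD.
       (\<forall>i \<le> DD. rd (dict_slot (h * DD + 1) rd (z div 2 ^ (h * i))) = z div 2 ^ (h * i) \<longleftrightarrow> i0 \<le> i) \<and>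
       rd (dict_slot (h * DD + 1) rd (z div 2 ^ (h * i0)) + 1) = cell_H I z - cell_H I X \<and>
       (i0 = DD \<longrightarrow> cell_H I z = cell_H I X))"
    and Z: "128 \<le> Z" "Z ^ 12 < 2 ^ w" "Z < 2 ^ (64 * n)" "total \<le> Z" "2 ^ om \<le> Z" "2 ^ (4 * b) \<le> Z" "g \<le> Z"
    and lr: "l \<le> r" "r < n"
  shows "\<exists>be F0 LB z i0 Fv rd. query_run w (map \<phi> S) (data L) Z n m b Lv V2 VL oV oDir oSuc oPop oCtz oRes
    (h * DD) X h DD NB PL K1 oLoc om g rk l r (r + 1) (l div g) be F0 LB z i0 Fv (freq S l (r + 1))
    (LEAST i. l \<le> i \<and> left_end S (freq S l (r + 1)) i) k1 k2 (h * DD + 1) rd"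
proof -
  define u be where "u = l div g" and "be = (r + 1) div X"
  define f Fv F0 where "f = freq S l (r + 1)" and "Fv = F u (r + 1)" and "F0 = F u (be * X)"
  define LB where "LB = oLoc + (u * PL + be * 128 + F0 * K1) * om"
  define z where "z = X + (r + 1) mod X"
  define rd where "rd k = bits_at (data L) (LB + k * om) om" for k
  define ans where "ans = (LEAST i. l \<le> i \<and> left_end S f i)"
  have u: "u < NU" using lr div_le_mono[of l n g] by (simp add: u_def NU_def)
  have be: "be < NB" using lr div_le_mono[of "r + 1" n X] by (simp add: be_def NB_def)
  note cell = rk_cell[OF u be]
  define I where "I = u * NB + be"
  have I: "I < NU * NB" "I div NB = u" "I mod NB = be" using cell(2) be by (simp_all add: I_def)
  have z: "X \<le> z" "z < 2 * X" using Xpos by (simp_all add: z_def)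
  have start: "cell_start I = u * PL + be * 128 + F0 * K1" by (simp add: cell_start_def I F0_def)
  have rdL: "rd k = L (cell_start I + k)" if "k < 128 + cell_gain I * K1" for k
  proof -
    have "cell_start I + k < (u + 1) * PL" using cell_end[of I] that unfolding I by linarith
    also have "\<dots> \<le> NU * PL" using u by (intro mult_le_mono1) simp
    finally have "bits_at (data L) (oLoc + (cell_start I + k) * om) om = L (cell_start I + k)"
      using L by (intro read_local) auto
    then show ?thesis by (simp add: rd_def LB_def start algebra_simps)
  qed
  obtain i0 where i0: "i0 \<le> DD"
    "\<And>i. i \<le> DD \<Longrightarrow> rd (dict_slot (h * DD + 1) rd (z div 2 ^ (h * i))) = z div 2 ^ (h * i) \<longleftrightarrow> i0 \<le> i"
    "rd (dict_slot (h * DD + 1) rd (z div 2 ^ (h * i0)) + 1) = cell_H I z - cell_H I X"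
    "i0 = DD \<Longrightarrow> cell_H I z = cell_H I X"
    using dict[OF z rdL] by blast
  have Hz: "cell_H I z = Fv"
    by (simp add: cell_H_def I z_def be_def Fv_def)
  have HX: "cell_H I X = F0" by (simp add: cell_H_def I F0_def)
  have Fle: "F0 \<le> Fv" unfolding F0_def Fv_def be_def by (intro F_mono) simp
  have ug: "u * g \<le> l" "l = u * g + l mod g" by (simp_all add: u_def)
  have f: "f \<le> Fv" unfolding f_def Fv_def F_def by (rule freq_mono) (use ug in auto)
  have lg: "l mod g < g" using gk(1) by simp
  have "Fv \<le> f + l mod g" using freq_add_left[of S "u * g" "r + 1" "l mod g"] ug(2) by (simp add: Fv_def F_def f_def)
  then have Fv: "Fv < f + g" using lg by linarith
  have Fvm: "Fv \<le> m" unfolding Fv_def by (rule F_le)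
  have fpos: "0 < f" unfolding f_def by (rule freq_pos) (use lr S in auto)
  have ans: "ans < n" using next_left_end_is_mode[of l r S f ans] lr by (simp add: ans_def f_def S(1))
  have F0: "F0 = (rk (V2 + I) - rk (V2 + u * NB)) * X + bits_at (data L) (oRes + I * (h * DD)) (h * DD)"
    unfolding read_residue[OF I(1)] residue_def I(2,3) cell(1)[folded I_def] F0_def by simp
  \<comment> \<open>Every word has at least one bit, so counts of words, and with them most
    parameters, are bounded by \<open>total\<close>.\<close>
  have NPL: "NU * PL \<le> NU * PL * om" by (simp add: om_def)
  have VLt: "VL \<le> total" "NU * PL \<le> total" "NU * NB * (h * DD) \<le> total" "oLoc \<le> total" "25 * (64 * n) \<le> total"
    unfolding offset_defs using NPL by linarith+
  have LvVL: "Lv \<le> V2" "V2 \<le> VL" by (simp_all add: V2_def VL_def)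
  have PLt: "PL \<le> total" using VLt(2) by (simp add: NU_def)
  have dims: "NB \<le> PL" "K1 \<le> PL" by (simp_all add: PL_def)
  have om: "h * DD \<le> om" "om \<le> 2 ^ om" "DD \<le> h * DD" "h \<le> h * DD" using X(1,4) by (simp_all add: om_def less_imp_le)
  have "(2::nat) ^ (h * DD + 1) \<le> 2 ^ om" unfolding om_def by (intro power_increasing) auto
  then have X2: "2 * X \<le> Z" using Z(5) by (simp add: X(2))
  have hZ: "h \<le> Z" using om(1,2,4) Z(5) by linarith
  have small: "b \<le> Z" "4 * b \<le> Z"
    using Z(6) less_exp[of "4 * b"] by linarith+
  have offs: "oV \<le> Z" "oDir \<le> Z" "oSuc \<le> Z" "oPop \<le> Z" "oCtz \<le> Z" "oRes \<le> Z" "oLoc \<le> Z"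
    using VLt(4) Z(4) unfolding offset_defs by linarith+
  have params: "Lv \<le> Z" "V2 \<le> Z" "VL \<le> Z" "NB \<le> Z" "PL \<le> Z" "K1 \<le> Z" "om \<le> Z" "h * DD \<le> Z" "DD \<le> Z" "X \<le> Z"
    using LvVL VLt dims PLt om X2 Z(4,5) by linarith+
  have hs: "header ! i \<le> Z" if "i < 25" for i
  proof -
    have "\<forall>x\<in>set header. x \<le> Z"
      unfolding header_def using small offs params X2 hZ Z(1,7) by simp
    moreover have "header ! i \<in> set header" using that by (intro nth_mem) (simp add: header_def)
    ultimately show ?thesis by blast
  qed
  have w: "Z < 2 ^ w" using Z(2) self_le_power[of Z 12] Z(1) by simp
  have "query_run w (map \<phi> S) (data L) Z n m b Lv V2 VL oV oDir oSuc oPop oCtz oRes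
    (h * DD) X h DD NB PL K1 oLoc om g rk l r (r + 1) u be F0 LB z i0 Fv f ans k1 k2 (h * DD + 1) rd"
  proof
    have lZ: "l \<le> Z" "r + 1 \<le> Z" using lr Lv_bounds(1) params(1) by linarith+
    show "128 \<le> Z" "Z ^ 12 < 2 ^ w" by fact+
    show "n = length (map \<phi> S)" "0 < n" using S by simp_all
    show "bits_at (data L) (i * (64 * n)) (min (64 * n) w) =
      [b, 4 * b, Lv, V2, oV, oDir, oSuc, oPop, oCtz, oRes, h * DD, X, 2 * X, h, DD, NB, PL, K1, oLoc, om,
       g, 1, 2, 3, 128] ! i" if "i < 25" for i
      using read_header[OF that, of "min (64 * n) w" L] le_less_trans[OF hs[OF that]] Z(3) w
      by (simp add: header_def min_def split: if_splits)
    show "b \<le> Z" "4 * b \<le> Z" "Lv \<le> Z" "V2 \<le> Z" "oV \<le> Z" "oDir \<le> Z" "oSuc \<le> Z"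
      "oPop \<le> Z" "oCtz \<le> Z" "oRes \<le> Z" "h * DD \<le> Z" "X \<le> Z" "2 * X \<le> Z" "h \<le> Z" "DD \<le> Z" "NB \<le> Z"
      "PL \<le> Z" "K1 \<le> Z" "oLoc \<le> Z" "om \<le> Z" "g \<le> Z" "VL \<le> Z"
      by (fact small offs params X2 hZ Z(7))+
    show "64 * (25 * n) \<le> Z" using VLt(5) Z(4) by linarith
    have exp: "k \<le> w" if "2 ^ k \<le> Z" for k
    proof -
      have "(2::nat) ^ k < 2 ^ w" using that w by (rule le_less_trans)
      then show ?thesis by simp
    qed
    have xw: "2 ^ (h * DD) \<le> Z" using X2 X(2) by simp
    show "4 * b \<le> w" "h * DD \<le> w" "om \<le> w" using exp Z(5,6) xw by blast+
    show "2 ^ (4 * b) \<le> Z" "2 ^ (h * DD) \<le> Z" "2 ^ om \<le> Z" by (fact Z(5,6) xw)+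
    show "0 < b" "0 < X" "0 < g" by (fact bpos Xpos gk(1))+
    show "bits_at (data L) (oDir + P div b * (4 * b)) (4 * b) +
      bits_at (data L) (oPop + bits_at (data L) (oV + (P - P mod b)) (P mod b) * b) b = rk P" if "P \<le> VL" for P
      by (rule read_rank[OF that])
    show "rk P \<le> Z" for P using rk_le[of P] params(3) by (rule order_trans)
    show "l \<le> Z" "r + 1 \<le> Z" by (fact lZ)+
    show "r + 1 = r + 1" "u = l div g" "be = (r + 1) div X" "z = X + (r + 1) mod X" by (simp_all add: u_def be_def z_def)
    show "l < Lv" "r + 1 < Lv" using lr Lv_bounds(1) by linarith+
    show "V2 + (u * NB + be) \<le> VL" using I(1) by (simp add: VL_def I_def)
    show "rk (V2 + u * NB) \<le> rk (V2 + (u * NB + be))" using cell(1) by simp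
    show "F0 = (rk (V2 + (u * NB + be)) - rk (V2 + u * NB)) * X + bits_at (data L) (oRes + (u * NB + be) * (h * DD)) (h * DD)"
      using F0 unfolding I_def .
    show "LB = oLoc + (u * PL + be * 128 + F0 * K1) * om" by (rule LB_def)
    show "rd = (\<lambda>k. bits_at (data L) (LB + k * om) om)" by (rule ext) (rule rd_def)
    show "2 ^ (h * DD + 1) = 2 * X" by (simp add: X(2))
    show "i0 \<le> DD" "DD < 2 ^ k1" "F0 \<le> Fv" by (fact i0(1) gk(2) Fle)+
    show "rd (dict_slot (h * DD + 1) rd (z div 2 ^ (h * i))) = z div 2 ^ (h * i) \<longleftrightarrow> i0 \<le> i" if "i \<le> DD" for i
      by (rule i0(2)[OF that])
    show "rd (dict_slot (h * DD + 1) rd (z div 2 ^ (h * i0)) + 1) = Fv - F0" using i0(3) unfolding Hz HX .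
    show "Fv = F0" if "i0 = DD" using i0(4)[OF that] unfolding Hz HX .
    show "f \<le> Fv" "Fv < f + g" "0 < f" "Fv \<le> m" "g < 2 ^ k2" by (fact f Fv fpos Fvm gk(3))+
    show "m \<le> Z" using mn lr Lv_bounds(1) params(1) by linarith
    show "rk (2 * q * Lv + l) < rk (2 * q * Lv + Lv + (r + 1)) \<longleftrightarrow> q \<le> f" if "0 < q" "q \<le> m" for q
      unfolding f_def using lr Lv_bounds(1) by (intro rank_test that) linarith+
    show "2 * q * Lv + Lv + Lv \<le> VL" if "q \<le> m" for q
    proof -
      have "2 * (q + 1) * Lv \<le> V2" unfolding V2_def using that by (intro mult_le_mono) auto
      then show ?thesis by (simp add: VL_def)
    qed
    show "ans = (let P = 2 * f * Lv + l; v = bits_at (data L) (oV + P) (b - P mod b) in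
        if v = 0 then bits_at (data L) (oSuc + P div b * (4 * b)) (4 * b) else l + bits_at (data L) (oCtz + v * b) b)"
      unfolding Let_def ans_def f_def by (rule read_answer[OF lr refl refl refl, symmetric])
    show "ans < n" by fact
  qed
  then show ?thesis unfolding u_def f_def ans_def by blast
qed

end

section \<open>The choice of the parameters\<close>

lemma square_le_exp: "D\<^sup>2 \<le> 2 * 2 ^ D" for D :: nat
proof (cases "D < 3")
  case True
  then have "D = 0 \<or> D = 1 \<or> D = 2" by auto
  then show ?thesis by auto
next
  case False
  then have "3 \<le> D" by simp
  then show ?thesis
  proof (induction D rule: dec_induct)
    case (step D)
    have "3 * D \<le> D * D" using step(1) by (intro mult_le_mono1)
    then have "2 * D + 1 \<le> D\<^sup>2" using step(1) unfolding power2_eq_square by linarith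
    then show ?case using step(3) by (simp add: power2_eq_square)
  qed simp
qed

text \<open>Large enough for \<open>4 * b\<close> bits to hold any position in the vectors, and
  small enough for tables of \<open>2 ^ b\<close> entries with \<open>b\<close> bits each to take
  linear space.\<close>

lemma block_length_exists:
  assumes "n > (0::nat)"
  obtains b where "64 * n < 4 ^ b" "4 ^ b \<le> 256 * n"
proof -
  define b where "b = (LEAST b. 64 * n < 4 ^ b)"
  have "64 * n < 4 ^ (64 * n)" by (rule less_le_trans[OF less_exp]) (simp add: power_mono)
  then have b: "64 * n < 4 ^ b" unfolding b_def by (rule LeastI)
  then obtain c where c: "b = Suc c" using assms by (cases b) auto
  then have "\<not> 64 * n < 4 ^ c" using not_less_Least[of c "\<lambda>b. 64 * n < 4 ^ b"] by (simp add: b_def)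
  then show ?thesis using that[OF b] by (simp add: c)
qed

text \<open>Take the least \<open>\<tau>\<close> with \<open>n \<le> m * 2 ^ 2 ^ \<tau>\<close>,
  capped at \<open>t + 1\<close>, and then the least \<open>h\<close>. Minimality of
  \<open>\<tau>\<close> bounds \<open>2 ^ 2 ^ \<tau>\<close> polynomially in \<open>n\<close>
  however large \<open>t\<close> is. For \<open>h = 1\<close> the last bound holds since
  \<open>n / m \<ge> 1\<close>. For \<open>h > 1\<close>, minimality of \<open>h\<close> bounds
  \<open>4 ^ (h - 1)\<close>, whence the factor 4.\<close>

lemma trie_parameters:
  fixes n m t :: nat
  assumes "0 < m" "m \<le> n"
  obtains \<tau> h where "\<tau> \<le> t + 1" "h > 0" "n \<le> m * 2 ^ (h * 2 ^ \<tau>)" "(2 ^ \<tau>)\<^sup>2 \<le> 8 * n"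
    "2 ^ (h * 2 ^ \<tau>) \<le> 2 * n ^ 3" "4 ^ h \<le> 4 * (real n / real m) powr (1 / 2 ^ t)"
proof -
  define \<tau> where "\<tau> = (LEAST \<tau>. \<tau> = t + 1 \<or> n \<le> m * 2 ^ 2 ^ \<tau>)"
  have \<tau>: "\<tau> = t + 1 \<or> n \<le> m * 2 ^ 2 ^ \<tau>" "\<tau> \<le> t + 1"
    unfolding \<tau>_def by (rule LeastI[of _ "t + 1"], simp) (rule Least_le, simp)
  define D :: nat where "D = 2 ^ \<tau>"
  have D: "D > 0" by (simp add: D_def)
  have n: "n > 0" using assms by simp
  have D_bounds: "2 ^ D \<le> 2 * n\<^sup>2 \<and> D\<^sup>2 \<le> 8 * n"
  proof (cases \<tau>)
    case 0
    then show ?thesis using n by (simp add: D_def)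
  next
    case (Suc \<sigma>)
    define D' :: nat where "D' = 2 ^ \<sigma>"
    have DD: "D = 2 * D'" by (simp add: D_def D'_def Suc)
    have "\<not> (\<sigma> = t + 1 \<or> n \<le> m * 2 ^ 2 ^ \<sigma>)"
      using not_less_Least[of \<sigma> "\<lambda>\<tau>. \<tau> = t + 1 \<or> n \<le> m * 2 ^ 2 ^ \<tau>"] Suc unfolding \<tau>_def by simp
    then have "m * 2 ^ D' < n" by (simp add: D'_def)
    moreover have "1 * 2 ^ D' \<le> m * 2 ^ D'" using assms(1) by (intro mult_le_mono1) simp
    ultimately have lt: "2 ^ D' \<le> n" by linarith
    have "(2::nat) ^ D = (2 ^ D')\<^sup>2" by (simp add: DD power_even_eq)
    also have "\<dots> \<le> n\<^sup>2" using lt by (rule power_mono) simp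
    finally have "2 ^ D \<le> n\<^sup>2" .
    moreover have "D\<^sup>2 \<le> 8 * n" using square_le_exp[of D'] lt by (simp add: DD power_mult_distrib)
    ultimately show ?thesis by simp
  qed
  define h where "h = (LEAST h. 0 < h \<and> n \<le> m * 2 ^ (h * D))"
  have "n \<le> m * 2 ^ (n * D)"
  proof -
    have "n \<le> 2 ^ n" using less_exp[of n] by simp
    also have "\<dots> \<le> 2 ^ (n * D)" using D by (intro power_increasing) auto
    also have "\<dots> \<le> m * 2 ^ (n * D)" using assms(1) by simp
    finally show ?thesis .
  qed
  then have h: "0 < h" "n \<le> m * 2 ^ (h * D)"
    unfolding h_def using LeastI[of "\<lambda>h. 0 < h \<and> n \<le> m * 2 ^ (h * D)" n] n by auto
  have X: "2 ^ (h * D) \<le> 2 * n ^ 3 \<and> 4 ^ h \<le> 4 * (real n / real m) powr (1 / 2 ^ t)"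
  proof (cases "h = 1")
    case True
    have "n\<^sup>2 \<le> n ^ 3" using n by (intro power_increasing) auto
    moreover have "1 \<le> (real n / real m) powr (1 / 2 ^ t)" using assms by (intro ge_one_powr_ge_zero) auto
    ultimately show ?thesis using True D_bounds by simp
  next
    case False
    then obtain h' where h': "h = Suc h'" "h' > 0" using h(1) by (cases h) auto
    then have "\<not> (0 < h' \<and> n \<le> m * 2 ^ (h' * D))"
      using not_less_Least[of h' "\<lambda>h. 0 < h \<and> n \<le> m * 2 ^ (h * D)"] unfolding h_def by simp
    then have lt: "m * 2 ^ (h' * D) < n" using h'(2) by simp
    moreover have "1 * 2 ^ (h' * D) \<le> m * 2 ^ (h' * D)" using assms(1) by (intro mult_le_mono1) simp
    ultimately have "2 ^ (h' * D) \<le> n" by linarith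
    then have "2 ^ (h' * D) * 2 ^ D \<le> n * (2 * n\<^sup>2)" using D_bounds by (intro mult_le_mono) auto
    then have 1: "2 ^ (h * D) \<le> 2 * n ^ 3"
      by (simp add: h'(1) power_add power2_eq_square power3_eq_cube mult_ac)
    \<comment> \<open>Since \<open>h = 1\<close> did not suffice, the search for
      \<open>\<tau>\<close> ended at its cap, so \<open>D\<close> is twice
      \<open>2 ^ t\<close>.\<close>
    have "m * 2 ^ (1 * D) \<le> m * 2 ^ (h' * D)" using h'(2) by (intro mult_le_mono2 power_increasing mult_le_mono1) auto
    then have "\<not> n \<le> m * 2 ^ D" using lt unfolding mult_1 by linarith
    then have "\<tau> = t + 1" using \<tau>(1) by (simp add: D_def)
    then have D2: "h' * D = (2 * h') * 2 ^ t" by (simp add: D_def)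
    have "real (m * 2 ^ (h' * D)) \<le> real n" using lt by (simp only: of_nat_le_iff)
    then have "2 ^ (h' * D) \<le> real n / real m"
      using assms(1) by (simp add: field_simps)
    then have "(2 ^ (2 * h')) ^ 2 ^ t \<le> real n / real m" unfolding D2 power_mult[of 2 "2 * h'"] .
    then have "((2 ^ (2 * h')) ^ 2 ^ t) powr (1 / 2 ^ t) \<le> (real n / real m) powr (1 / 2 ^ t)"
      by (intro powr_mono2) auto
    moreover have "((2 ^ (2 * h')) ^ 2 ^ t) powr (1 / 2 ^ t) = (2::real) ^ (2 * h')"
    proof -
      have "(2::real) ^ (2 * h') > 0" by simp
      then have "(((2::real) ^ (2 * h')) ^ 2 ^ t) powr (1 / 2 ^ t) = ((2 ^ (2 * h')) powr real (2 ^ t)) powr (1 / 2 ^ t)"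
        by (subst powr_realpow) auto
      then show ?thesis by (simp add: powr_powr)
    qed
    ultimately have "4 ^ h' \<le> (real n / real m) powr (1 / 2 ^ t)" by (simp add: power_mult)
    then show ?thesis using 1 by (simp add: h'(1))
  qed
  show ?thesis
    by (rule that[of \<tau> h]) (use \<tau>(2) h D_bounds X in \<open>simp_all add: D_def\<close>)
qed

lemma (in layout) total_le:
  assumes "g = DD\<^sup>2" "DD\<^sup>2 \<le> 8 * n"
  shows "total \<le> 60000 * (n * m * 4 ^ h)"
proof -
  define T where "T = n * m * 4 ^ h"
  have h2: "h \<le> 2 ^ h" using less_exp[of h] by simp
  have "(2::nat) ^ h * 2 ^ h = 4 ^ h" by (simp flip: power_mult_distrib)
  then have h4: "h * 2 ^ h \<le> 4 ^ h" using mult_le_mono1[OF h2, of "2 ^ h"] by simp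
  have "(1::nat) \<le> 4 ^ h" by simp
  then have nmT: "n * m \<le> T" unfolding T_def by simp
  have nT: "n \<le> T" using nmT mpos by (simp add: order_trans[OF _ nmT])
  have VL: "VL \<le> 1032 * T" using VL_le nmT by linarith
  have "VL div b * b \<le> VL" by simp
  moreover have "(VL div b + 1) * (4 * b) = 4 * (VL div b * b) + 4 * b" by simp
  ultimately have dirs: "(VL div b + 1) * (4 * b) \<le> 4 * VL + 1024 * n" using b_le by linarith
  have "2 ^ b * b \<le> 2 ^ b * (2::nat) ^ b" using less_exp[of b] by (intro mult_le_mono2) simp
  also have "\<dots> = 4 ^ b" by (simp flip: power_mult_distrib)
  finally have tabs: "2 ^ b * b \<le> 256 * n" using b(2) by simp
  \<comment> \<open>Rounding up the number of samples adds a whole \<open>g\<close>, which is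
    harmless as \<open>g \<le> 8 * n\<close>.\<close>
  have "n div g * g \<le> n" by simp
  moreover have "NU * g = n div g * g + g" by (simp add: NU_def)
  ultimately have "NU * g \<le> 9 * n" using assms by linarith
  then have NUg: "NU * DD\<^sup>2 \<le> 9 * n" unfolding assms(1) .
  have DD: "DD \<le> DD\<^sup>2" "1 \<le> DD" using X(4) by (simp_all add: power2_eq_square)
  have NB: "NB \<le> 2 * m" using NB_le mpos by linarith
  have "NU * NB * (h * DD) = (NU * DD) * (NB * h)" by simp
  also have "\<dots> \<le> (9 * n) * (2 * m * 4 ^ h)"
  proof (rule mult_le_mono)
    show "NU * DD \<le> 9 * n" using NUg DD(1) by (meson mult_le_mono2 order_trans)
    have "h \<le> 4 ^ h" using h4 by (rule order_trans[rotated]) simp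
    then show "NB * h \<le> 2 * m * 4 ^ h" by (intro mult_le_mono NB)
  qed
  finally have res: "NU * NB * (h * DD) \<le> 18 * T" by (simp add: T_def mult_ac)
  have PL: "PL \<le> 512 * (m * (DD * 2 ^ h))"
  proof -
    have "1 * 1 \<le> DD * 2 ^ h" using DD(2) by (intro mult_le_mono) auto
    then have "m * 1 \<le> m * (DD * 2 ^ h)" unfolding mult_1 by (rule mult_le_mono2)
    moreover have "NB * 128 \<le> 256 * m" using NB by simp
    moreover have "(m + 1) * K1 \<le> 2 * m * K1" using mpos by (intro mult_le_mono1) linarith
    moreover have "2 * m * K1 = 256 * (m * (DD * 2 ^ h))" by (simp add: K1_def)
    ultimately show ?thesis unfolding PL_def by linarith
  qed
  have "1 * 1 \<le> h * DD" using X(1) DD(2) by (intro mult_le_mono) auto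
  then have "om \<le> 10 * (h * DD)" by (simp add: om_def)
  then have "NU * PL * om \<le> NU * (512 * (m * (DD * 2 ^ h))) * (10 * (h * DD))"
    using PL by (intro mult_le_mono) auto
  also have "\<dots> = 5120 * (NU * DD\<^sup>2) * (m * (h * 2 ^ h))" by (simp add: power2_eq_square)
  also have "\<dots> \<le> 5120 * (9 * n) * (m * 4 ^ h)"
    by (rule mult_le_mono[OF mult_le_mono2[OF NUg] mult_le_mono2[OF h4]])
  finally have loc: "NU * PL * om \<le> 46080 * T" by (simp add: T_def)
  \<comment> \<open>In multiples of \<open>T\<close>: 1600 for the header, 1032 for the vectors,
    twice 5152 for the directories, twice 256 for the tables, 18 for the residues and 46080 for the
    tries, 59546 in all.\<close>
  show ?thesis
    unfolding offset_defs T_def[symmetric] using VL dirs tabs res loc nT by linarith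
qed

text \<open>The program is one fixed list of instructions; \<open>k\<close> and the string enter
  only through the bit string. The space constant is \<open>4 * 60000\<close>, from
  \<open>total_le\<close> and \<open>4 ^ h \<le> 4 * E\<close>.\<close>

theorem theorem9:
  shows "\<exists>(P :: prog) (c :: nat) (C :: real). c > 0 \<and> C > 0 \<and>
    (\<forall>(k :: nat) (\<Sigma> :: 'a set) (\<phi> :: 'a \<Rightarrow> nat) (S :: 'a list) (w :: nat) (n :: nat) (m :: nat).
       k \<ge> 1 \<longrightarrow>
       finite \<Sigma> \<longrightarrow> bij_betw \<phi> \<Sigma> {0..<card \<Sigma>} \<longrightarrow>
       set S \<subseteq> \<Sigma> \<longrightarrow> S \<noteq> [] \<longrightarrow> n = length S \<longrightarrow> m = range_freq S 0 (n - 1) \<longrightarrow>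
       real w \<ge> real c * log 2 (real n + 1) \<longrightarrow> card \<Sigma> \<le> 2 ^ w \<longrightarrow>
       (\<exists>D :: bool list.
          real (length D) \<le>
            C * (4 ^ k * real n * real m * (real n / real m) powr (1 / 2 ^ (2 ^ k))) \<and>
          (\<forall>l r. l \<le> r \<longrightarrow> r < n \<longrightarrow>
             (\<exists>x. is_mode (range_mset S l r) x \<and>
                  reports_within P w (map \<phi> S) D l r (C * 2 ^ k) (\<phi> x)))))"
proof (rule exI[of _ "code 0 query_program"], rule exI[of _ 300], rule exI[of _ 240000],
    intro conjI allI impI)
  fix k w n m :: nat and \<Sigma> :: "'a set" and \<phi> :: "'a \<Rightarrow> nat" and S :: "'a list"
  assume str: "S \<noteq> []" "n = length S" and m: "m = range_freq S 0 (n - 1)"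
    and w: "real w \<ge> real 300 * log 2 (real n + 1)"
  define t :: nat where "t = 2 ^ k"
  define E where "E = (real n / real m) powr (1 / 2 ^ t)"
  have n: "n > 0" using str by simp
  have m': "m = freq S 0 n" using range_freq_eq[OF str(1)] m str(2) by simp
  have mpos: "0 < m" unfolding m' using freq_pos[of 0 n S] n str(2) by simp
  have mn: "m \<le> n" unfolding m' str(2) by (rule freq_total_le)
  obtain b where b: "64 * n < 4 ^ b" "4 ^ b \<le> 256 * n" using block_length_exists[OF n] .
  obtain \<tau> h where par: "\<tau> \<le> t + 1" "h > 0" "n \<le> m * 2 ^ (h * 2 ^ \<tau>)" "(2 ^ \<tau>)\<^sup>2 \<le> 8 * n"
    "2 ^ (h * 2 ^ \<tau>) \<le> 2 * n ^ 3" "4 ^ h \<le> 4 * E"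
    using trie_parameters[OF mpos mn, of t] unfolding E_def by metis
  define DD :: nat where "DD = 2 ^ \<tau>"
  define X :: nat where "X = 2 ^ (h * DD)"
  define g where "g = DD\<^sup>2"
  interpret layout S n m b h X DD g "\<tau> + 1" "2 * \<tau> + 1"
  proof
    show "n = length S" "0 < n" "m = freq S 0 n" "64 * n < 4 ^ b" "4 ^ b \<le> 256 * n" "0 < h" by fact+
    show "X = 2 ^ (h * DD)" by (rule X_def)
    show "n \<le> m * X" using par(3) by (simp add: X_def DD_def)
    show "0 < DD" "0 < g" "DD < 2 ^ (\<tau> + 1)" by (simp_all add: DD_def g_def)
    have "g = 2 ^ (2 * \<tau>)" by (simp add: g_def DD_def power_even_eq)
    also have "\<dots> < (2::nat) ^ (2 * \<tau> + 1)" by (intro power_strict_increasing) auto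
    finally show "g < 2 ^ (2 * \<tau> + 1)" .
  qed
  have total: "total \<le> 60000 * (n * m * 4 ^ h)"
    by (rule total_le) (use par(4) in \<open>simp_all add: g_def DD_def\<close>)
  have "E \<le> (real n / real m) powr 1"
    unfolding E_def using mpos mn by (intro powr_mono) (auto simp: field_simps)
  also have "\<dots> \<le> real n" using mpos n by (simp add: field_simps)
  finally have "E \<le> real n" .
  then have "real (4 ^ h) \<le> real (4 * n)" using par(6) by simp
  then have h4: "4 ^ h \<le> 4 * n" by (simp only: of_nat_le_iff)
  \<comment> \<open>Cubic because \<open>total\<close> is at most
    \<open>60000 * (n * n * (4 * n))\<close> and \<open>2 ^ om = 512 * X\<close> is at most
    \<open>1024 * n ^ 3\<close>.\<close>
  define Z where "Z = 2 ^ 20 * n ^ 3"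
  have n3: "n \<le> n ^ 3" "n\<^sup>2 \<le> n ^ 3" using n by (intro self_le_power power_increasing; simp)+
  have Z1: "128 \<le> Z" using n by (simp add: Z_def)
  have Z2: "total \<le> Z"
  proof -
    have "n * m * 4 ^ h \<le> n * n * (4 * n)" using mn h4 by (intro mult_le_mono) auto
    then have "total \<le> 60000 * (n * n * (4 * n))" using total by linarith
    then show ?thesis by (simp add: Z_def power3_eq_cube)
  qed
  have Z3: "2 ^ om \<le> Z"
  proof -
    have "(2::nat) ^ om = 512 * X" by (simp add: om_def power_add X_def)
    then show ?thesis using par(5) by (simp add: X_def DD_def Z_def)
  qed
  have Z4: "2 ^ (4 * b) \<le> Z"
  proof -
    have "(2::nat) ^ (4 * b) = (4 ^ b)\<^sup>2" by (simp add: power_mult power2_eq_square flip: power_mult_distrib)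
    also have "\<dots> \<le> (256 * n)\<^sup>2" using b(2) by (rule power_mono) simp
    also have "\<dots> = 65536 * n\<^sup>2" by (simp add: power_mult_distrib)
    also have "\<dots> \<le> Z" using n3(2) by (simp add: Z_def)
    finally show ?thesis .
  qed
  have Z5: "g \<le> Z" using par(4) n3(1) by (simp add: g_def DD_def Z_def)
  have Z6: "Z < 2 ^ (64 * n)"
  proof -
    have "n ^ 3 < (2 ^ n) ^ 3" by (intro power_strict_mono less_exp) auto
    then have "Z < 2 ^ 20 * (2 ^ n) ^ 3" by (simp add: Z_def)
    also have "\<dots> = 2 ^ (20 + n * 3)" by (simp add: power_add power_mult)
    also have "\<dots> \<le> 2 ^ (64 * n)" using n by (intro power_increasing) auto
    finally show ?thesis .
  qed
  have Z7: "Z ^ 12 < 2 ^ w"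
  proof -
    \<comment> \<open>Each factor 2 is at most \<open>n + 1\<close>; this absorbs
      \<open>2 ^ 240\<close> and leads to the exponent 276, below the 300 required of the word
      size.\<close>
    have "Z ^ 12 = 2 ^ 240 * n ^ 36" by (simp add: Z_def power_mult_distrib flip: power_mult)
    also have "\<dots> \<le> (n + 1) ^ 240 * (n + 1) ^ 36"
      using n by (intro mult_le_mono power_mono) auto
    also have "\<dots> = (n + 1) ^ 276" by (simp only: power_add[symmetric]) simp
    also have "\<dots> < (n + 1) ^ 300" using n by (intro power_strict_increasing) auto
    finally have lt: "Z ^ 12 < (n + 1) ^ 300" .
    have "real ((n + 1) ^ 300) = (real n + 1) ^ 300" by (simp add: add.commute)
    also have "\<dots> = (real n + 1) powr 300" by (rule powr_numeral[symmetric]) simp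
    also have "\<dots> = (2 powr log 2 (real n + 1)) powr 300" by simp
    also have "\<dots> = 2 powr (log 2 (real n + 1) * 300)" by (rule powr_powr)
    also have "\<dots> \<le> 2 powr real w" using w by (intro powr_mono) (auto simp: mult.commute)
    also have "\<dots> = real (2 ^ w)" by (simp add: powr_realpow)
    finally have "(n + 1) ^ 300 \<le> 2 ^ w" by (simp only: of_nat_le_iff)
    then show ?thesis using lt by simp
  qed
  obtain L where L: "\<forall>p. L p < 2 ^ om"
    and dict: "\<forall>I z. X \<le> z \<longrightarrow> z < 2 * X \<longrightarrow>
     (\<forall>rd. (\<forall>k < 128 + cell_gain I * K1. rd k = L (cell_start I + k)) \<longrightarrow> (\<exists>i0 \<le> DD.
       (\<forall>i \<le> DD. rd (dict_slot (h * DD + 1) rd (z div 2 ^ (h * i))) = z div 2 ^ (h * i) \<longleftrightarrow> i0 \<le> i) \<and>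
       rd (dict_slot (h * DD + 1) rd (z div 2 ^ (h * i0)) + 1) = cell_H I z - cell_H I X \<and>
       (i0 = DD \<longrightarrow> cell_H I z = cell_H I X)))"
    using cell_dictionaries by (elim exE conjE)
  have size: "real (length (data L)) \<le> 240000 * (4 ^ k * real n * real m * E)"
  proof -
    have "real (length (data L)) \<le> real (60000 * (n * m * 4 ^ h))"
      unfolding length_data using total by (simp only: of_nat_le_iff)
    also have "\<dots> = 60000 * (real n * real m) * 4 ^ h" by simp
    also have "\<dots> \<le> 60000 * (real n * real m) * (4 * E)" using par(6) by (intro mult_left_mono) auto
    also have "\<dots> = 1 * (240000 * (real n * real m * E))" by simp
    also have "\<dots> \<le> 4 ^ k * (240000 * (real n * real m * E))"
      by (intro mult_right_mono) (auto simp: E_def)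
    finally show ?thesis by (simp add: mult_ac)
  qed
  have query: "\<exists>x. is_mode (range_mset S l r) x \<and>
      reports_within (code 0 query_program) w (map \<phi> S) (data L) l r (240000 * 2 ^ k) (\<phi> x)"
    if lr: "l \<le> r" "r < n" for l r
  proof -
    define a where "a = (LEAST i. l \<le> i \<and> left_end S (freq S l (r + 1)) i)"
    have a: "is_mode (range_mset S l r) (S ! a)" "a < length S"
      using next_left_end_is_mode[of l r S "freq S l (r + 1)" a] lr str(2) by (simp_all add: a_def)
    obtain be F0 LB z i0 Fv rd where "query_run w (map \<phi> S) (data L) Z n m b Lv V2 VL oV oDir oSuc oPop oCtz oRes
      (h * DD) X h DD NB PL K1 oLoc om g rk l r (r + 1) (l div g) be F0 LB z i0 Fv (freq S l (r + 1))
      a (\<tau> + 1) (2 * \<tau> + 1) (h * DD + 1) rd"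
      using query_run_layout[where L = L and \<phi> = \<phi>, OF L[rule_format] dict[rule_format] Z1 Z7 Z6 Z2 Z3 Z4 Z5 lr]
      unfolding a_def by blast
    from query_run.does_query_program[OF this]
    have "does w (map \<phi> S) (data L) query_program (snd (init_state w (map \<phi> S) l r))
      (37 * ((\<tau> + 1) + (2 * \<tau> + 1)) + 129) (\<lambda>M. M 0 = \<phi> (S ! a))"
      using a(2) by simp
    moreover have "real (37 * ((\<tau> + 1) + (2 * \<tau> + 1)) + 129) \<le> 240000 * 2 ^ k"
    proof -
      have "1 \<le> t" by (simp add: t_def)
      \<comment> \<open>With \<open>\<tau> \<le> t + 1\<close> the left side is at most
        \<open>111 * t + 314\<close>, and \<open>t \<ge> 1\<close>.\<close>
      then have "37 * ((\<tau> + 1) + (2 * \<tau> + 1)) + 129 \<le> 425 * t" using par(1) by simp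
      also have "\<dots> \<le> 240000 * t" by simp
      finally have "37 * ((\<tau> + 1) + (2 * \<tau> + 1)) + 129 \<le> 240000 * t" .
      then have "real (37 * ((\<tau> + 1) + (2 * \<tau> + 1)) + 129) \<le> real (240000 * t)" by (simp only: of_nat_le_iff)
      then show ?thesis by (simp add: t_def)
    qed
    ultimately show ?thesis using a(1) reports_within_does by blast
  qed
  show "\<exists>D :: bool list.
          real (length D) \<le>
            240000 * (4 ^ k * real n * real m * (real n / real m) powr (1 / 2 ^ (2 ^ k))) \<and>
          (\<forall>l r. l \<le> r \<longrightarrow> r < n \<longrightarrow>
             (\<exists>x. is_mode (range_mset S l r) x \<and>
                  reports_within (code 0 query_program) w (map \<phi> S) D l r (240000 * 2 ^ k) (\<phi> x)))"
    using size query unfolding E_def t_def by blast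
qed simp_all

end
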